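(* Assume $T$ is $G$-compact. Let $p=\operatorname{tp}(a)$ and $\bar p=\operatorname{tp}(ac)$ where $c\subseteq\operatorname{acl}(a)$ is a finite tuple, and let $\pi:\mathrm{Gal}_L^1(\bar p)\to\mathrm{Gal}_L^1(p)$ be the natural projection. Then the kernel $K$ of $\pi$ is finite.
   Context: Monster model $\mathcal{M}=\mathcal{M}^{\mathrm{eq}}$ of a complete theory $T$ with $\operatorname{acl}(\emptyset)=\operatorname{dcl}(\emptyset)$; $a$ may be an infinite tuple; types are over $\emptyset$. $\operatorname{Autf}(\mathcal{M})$ is the normal subgroup of $\operatorname{Aut}(\mathcal{M})$ generated by automorphisms fixing pointwise some small elementary submodel; $u\equiv^L v$ iff $f(u)=v$ for some $f\in\operatorname{Autf}(\mathcal{M})$. $T$ is $G$-compact if $\mathrm{Gal}_L(T)=\operatorname{Aut}(\mathcal{M})/\operatorname{Autf}(\mathcal{M})$ with its standard topology is Hausdorff. For a type $q$: $\operatorname{Aut}(q)=\{f\restriction q(\mathcal{M}):f\in\operatorname{Aut}(\mathcal{M})\}$, $\operatorname{Autf}^1(q)=\{\sigma\in\operatorname{Aut}(q):\sigma(u)\equiv^L u\text{ for all }u\models q\}$, $\mathrm{Gal}_L^1(q)=\operatorname{Aut}(q)/\operatorname{Autf}^1(q)$. The natural projection $\pi$ sends the class of $f\restriction\bar p(\mathcal{M})$ to the class of $f\restriction p(\mathcal{M})$. *)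

theory Defs
  imports "HOL-Analysis.Analysis" "HOL-Algebra.Bij" "HOL-Algebra.Coset"
begin

section \<open>Many-sorted first-order logic\<close>

record ('s, 'f, 'r) lang =
  sorts :: "'s set"
  funs :: "'f set"
  rels :: "'r set"
  fargs :: "'f \<Rightarrow> 's list"
  fres :: "'f \<Rightarrow> 's"
  rargs :: "'r \<Rightarrow> 's list"

definition lang_ok :: "('s, 'f, 'r) lang \<Rightarrow> bool" where
  "lang_ok L \<longleftrightarrow>
     (\<forall>f\<in>funs L. set (fargs L f) \<subseteq> sorts L \<and> fres L f \<in> sorts L) \<and>
     (\<forall>r\<in>rels L. set (rargs L r) \<subseteq> sorts L)"

text \<open>Free variables carry their sort and a name from an arbitrary type \<open>'v\<close> (so that infinite
  tuples of variables and parameters can be used as names); bound variables are de Bruijn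
  indices, the sort being recorded at the quantifier.\<close>

datatype ('s, 'f, 'v) tm = FV 's 'v | BV nat | Fn 'f "('s, 'f, 'v) tm list"

datatype ('s, 'f, 'r, 'v) fm =
    Eq "('s, 'f, 'v) tm" "('s, 'f, 'v) tm"
  | Rel 'r "('s, 'f, 'v) tm list"
  | Neg "('s, 'f, 'r, 'v) fm"
  | And "('s, 'f, 'r, 'v) fm" "('s, 'f, 'r, 'v) fm"
  | Ex 's "('s, 'f, 'r, 'v) fm"

inductive tm_ok :: "('s, 'f, 'r) lang \<Rightarrow> 's list \<Rightarrow> ('s, 'f, 'v) tm \<Rightarrow> 's \<Rightarrow> bool"
  for L \<Gamma> where
  "s \<in> sorts L \<Longrightarrow> tm_ok L \<Gamma> (FV s v) s"
| "k < length \<Gamma> \<Longrightarrow> tm_ok L \<Gamma> (BV k) (\<Gamma> ! k)"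
| "f \<in> funs L \<Longrightarrow> list_all2 (tm_ok L \<Gamma>) ts (fargs L f) \<Longrightarrow> tm_ok L \<Gamma> (Fn f ts) (fres L f)"

primrec fm_ok :: "('s, 'f, 'r) lang \<Rightarrow> 's list \<Rightarrow> ('s, 'f, 'r, 'v) fm \<Rightarrow> bool" where
  "fm_ok L \<Gamma> (Eq t u) \<longleftrightarrow> (\<exists>s. tm_ok L \<Gamma> t s \<and> tm_ok L \<Gamma> u s)"
| "fm_ok L \<Gamma> (Rel r ts) \<longleftrightarrow> r \<in> rels L \<and> list_all2 (tm_ok L \<Gamma>) ts (rargs L r)"
| "fm_ok L \<Gamma> (Neg \<phi>) \<longleftrightarrow> fm_ok L \<Gamma> \<phi>"
| "fm_ok L \<Gamma> (And \<phi> \<psi>) \<longleftrightarrow> fm_ok L \<Gamma> \<phi> \<and> fm_ok L \<Gamma> \<psi>"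
| "fm_ok L \<Gamma> (Ex s \<phi>) \<longleftrightarrow> s \<in> sorts L \<and> fm_ok L (s # \<Gamma>) \<phi>"

primrec tm_fvs :: "('s, 'f, 'v) tm \<Rightarrow> ('s \<times> 'v) set" where
  "tm_fvs (FV s v) = {(s, v)}"
| "tm_fvs (BV k) = {}"
| "tm_fvs (Fn f ts) = \<Union> (set (map tm_fvs ts))"

primrec fvs :: "('s, 'f, 'r, 'v) fm \<Rightarrow> ('s \<times> 'v) set" where
  "fvs (Eq t u) = tm_fvs t \<union> tm_fvs u"
| "fvs (Rel r ts) = \<Union> (tm_fvs ` set ts)"
| "fvs (Neg \<phi>) = fvs \<phi>"
| "fvs (And \<phi> \<psi>) = fvs \<phi> \<union> fvs \<psi>"
| "fvs (Ex s \<phi>) = fvs \<phi>"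

record ('s, 'f, 'r, 'a) struct =
  carr :: "'s \<Rightarrow> 'a set"
  fint :: "'f \<Rightarrow> 'a list \<Rightarrow> 'a"
  rint :: "'r \<Rightarrow> 'a list set"

definition tups :: "('s, 'f, 'r, 'a) struct \<Rightarrow> 's list \<Rightarrow> 'a list set" where
  "tups M ss = {xs. list_all2 (\<lambda>x s. x \<in> carr M s) xs ss}"

definition univ :: "('s, 'f, 'r) lang \<Rightarrow> ('s, 'f, 'r, 'a) struct \<Rightarrow> 'a set" where
  "univ L M = (\<Union>s\<in>sorts L. carr M s)"

definition is_struct :: "('s, 'f, 'r) lang \<Rightarrow> ('s, 'f, 'r, 'a) struct \<Rightarrow> bool" where
  "is_struct L M \<longleftrightarrow>
     (\<forall>s\<in>sorts L. carr M s \<noteq> {}) \<and>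
     (\<forall>s\<in>sorts L. \<forall>t\<in>sorts L. s \<noteq> t \<longrightarrow> carr M s \<inter> carr M t = {}) \<and>
     (\<forall>f\<in>funs L. \<forall>xs\<in>tups M (fargs L f). fint M f xs \<in> carr M (fres L f)) \<and>
     (\<forall>r\<in>rels L. rint M r \<subseteq> tups M (rargs L r))"

primrec eval :: "('s, 'f, 'r, 'a) struct \<Rightarrow> ('v \<Rightarrow> 'a) \<Rightarrow> 'a list \<Rightarrow> ('s, 'f, 'v) tm \<Rightarrow> 'a" where
  "eval M e \<beta> (FV s v) = e v"
| "eval M e \<beta> (BV k) = \<beta> ! k"
| "eval M e \<beta> (Fn f ts) = fint M f (map (eval M e \<beta>) ts)"

primrec sat :: "('s, 'f, 'r, 'a) struct \<Rightarrow> ('v \<Rightarrow> 'a) \<Rightarrow> 'a list \<Rightarrow> ('s, 'f, 'r, 'v) fm \<Rightarrow> bool" where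
  "sat M e \<beta> (Eq t u) \<longleftrightarrow> eval M e \<beta> t = eval M e \<beta> u"
| "sat M e \<beta> (Rel r ts) \<longleftrightarrow> map (eval M e \<beta>) ts \<in> rint M r"
| "sat M e \<beta> (Neg \<phi>) \<longleftrightarrow> \<not> sat M e \<beta> \<phi>"
| "sat M e \<beta> (And \<phi> \<psi>) \<longleftrightarrow> sat M e \<beta> \<phi> \<and> sat M e \<beta> \<psi>"
| "sat M e \<beta> (Ex s \<phi>) \<longleftrightarrow> (\<exists>x\<in>carr M s. sat M e (x # \<beta>) \<phi>)"

section \<open>Elementary submodels, types, algebraic and definable closure\<close>

definition substr :: "('s, 'f, 'r, 'a) struct \<Rightarrow> 'a set \<Rightarrow> ('s, 'f, 'r, 'a) struct" where
  "substr M X = \<lparr>carr = (\<lambda>s. carr M s \<inter> X), fint = fint M, rint = (\<lambda>r. rint M r \<inter> lists X)\<rparr>"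

text \<open>The elements of \<open>X\<close> are used as names of free variables, interpreted by themselves.\<close>

definition elem_submodel :: "('s, 'f, 'r) lang \<Rightarrow> ('s, 'f, 'r, 'a) struct \<Rightarrow> 'a set \<Rightarrow> bool" where
  "elem_submodel L M X \<longleftrightarrow>
     X \<subseteq> univ L M \<and> is_struct L (substr M X) \<and>
     (\<forall>\<phi> :: ('s, 'f, 'r, 'a) fm.
        fm_ok L [] \<phi> \<and> (\<forall>(s, x)\<in>fvs \<phi>. x \<in> carr M s \<inter> X) \<longrightarrow>
        (sat (substr M X) (\<lambda>x. x) [] \<phi> \<longleftrightarrow> sat M (\<lambda>x. x) [] \<phi>))"

text \<open>\<open>L(A)\<close>-formulas are formulas with names in \<open>'v + 'a\<close>: \<open>Inl v\<close> is a variable,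
  \<open>Inr m\<close> with \<open>m \<in> A\<close> is a parameter.\<close>

definition param_fms ::
  "('s, 'f, 'r) lang \<Rightarrow> ('s, 'f, 'r, 'a) struct \<Rightarrow> ('s \<times> 'v) set \<Rightarrow> 'a set
     \<Rightarrow> ('s, 'f, 'r, 'v + 'a) fm set" where
  "param_fms L M V A =
     {\<phi>. fm_ok L [] \<phi> \<and>
         fvs \<phi> \<subseteq> {(s, Inl v) |s v. (s, v) \<in> V} \<union> {(s, Inr m) |s m. m \<in> A \<inter> carr M s}}"

definition psat :: "('s, 'f, 'r, 'a) struct \<Rightarrow> ('v \<Rightarrow> 'a) \<Rightarrow> ('s, 'f, 'r, 'v + 'a) fm \<Rightarrow> bool" where
  "psat M a \<phi> \<longleftrightarrow> sat M (case_sum a (\<lambda>m. m)) [] \<phi>"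

text \<open>\<open>tp L M I a A\<close> is \<open>tp(a/A)\<close> for the tuple \<open>a = (a i)\<^sub>i\<close> indexed by \<open>i \<in> I\<close>.\<close>

definition tp ::
  "('s, 'f, 'r) lang \<Rightarrow> ('s, 'f, 'r, 'a) struct \<Rightarrow> 'i set \<Rightarrow> ('i \<Rightarrow> 'a) \<Rightarrow> 'a set
     \<Rightarrow> ('s, 'f, 'r, 'i + 'a) fm set" where
  "tp L M I a A = {\<phi> \<in> param_fms L M {(s, i). i \<in> I \<and> a i \<in> carr M s} A. psat M a \<phi>}"

text \<open>The set \<open>q(M)\<close> of realizations of a type \<open>q\<close> over the empty set in the variables \<open>I\<close>.\<close>

definition realizations ::
  "('s, 'f, 'r) lang \<Rightarrow> ('s, 'f, 'r, 'a) struct \<Rightarrow> 'i set \<Rightarrow> ('s, 'f, 'r, 'i + 'a) fm set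
     \<Rightarrow> ('i \<Rightarrow> 'a) set" where
  "realizations L M I q = {u \<in> I \<rightarrow>\<^sub>E univ L M. q \<subseteq> tp L M I u {}}"

definition solutions ::
  "('s, 'f, 'r, 'a) struct \<Rightarrow> 's \<Rightarrow> ('s, 'f, 'r, unit + 'a) fm \<Rightarrow> 'a set" where
  "solutions M s \<phi> = {x \<in> carr M s. psat M (\<lambda>_. x) \<phi>}"

definition acl :: "('s, 'f, 'r) lang \<Rightarrow> ('s, 'f, 'r, 'a) struct \<Rightarrow> 'a set \<Rightarrow> 'a set" where
  "acl L M A = {x. \<exists>s\<in>sorts L. \<exists>\<phi>\<in>param_fms L M {(s, ())} A.
                     x \<in> solutions M s \<phi> \<and> finite (solutions M s \<phi>)}"

definition dcl :: "('s, 'f, 'r) lang \<Rightarrow> ('s, 'f, 'r, 'a) struct \<Rightarrow> 'a set \<Rightarrow> 'a set" where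
  "dcl L M A = {x. \<exists>s\<in>sorts L. \<exists>\<phi>\<in>param_fms L M {(s, ())} A. solutions M s \<phi> = {x}}"

section \<open>Automorphisms and monster models\<close>

definition Aut :: "('s, 'f, 'r) lang \<Rightarrow> ('s, 'f, 'r, 'a) struct \<Rightarrow> ('a \<Rightarrow> 'a) set" where
  "Aut L M =
     {f \<in> Bij (univ L M).
        (\<forall>s\<in>sorts L. f ` carr M s = carr M s) \<and>
        (\<forall>h\<in>funs L. \<forall>xs\<in>tups M (fargs L h). f (fint M h xs) = fint M h (map f xs)) \<and>
        (\<forall>r\<in>rels L. \<forall>xs\<in>tups M (rargs L r). map f xs \<in> rint M r \<longleftrightarrow> xs \<in> rint M r)}"

definition AutG :: "('s, 'f, 'r) lang \<Rightarrow> ('s, 'f, 'r, 'a) struct \<Rightarrow> ('a \<Rightarrow> 'a) monoid" where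
  "AutG L M = (BijGroup (univ L M))\<lparr>carrier := Aut L M\<rparr>"

definition small :: "'k rel \<Rightarrow> 'b set \<Rightarrow> bool" where
  "small \<kappa> X \<longleftrightarrow> (card_of X, \<kappa>) \<in> ordLess"

definition saturated :: "('s, 'f, 'r) lang \<Rightarrow> 'k rel \<Rightarrow> ('s, 'f, 'r, 'a) struct \<Rightarrow> bool" where
  "saturated L \<kappa> M \<longleftrightarrow>
     (\<forall>A s \<Sigma>. A \<subseteq> univ L M \<and> small \<kappa> A \<and> s \<in> sorts L \<and> \<Sigma> \<subseteq> param_fms L M {(s, ())} A \<and>
        (\<forall>\<Sigma>0\<subseteq>\<Sigma>. finite \<Sigma>0 \<longrightarrow> (\<exists>x\<in>carr M s. \<forall>\<phi>\<in>\<Sigma>0. x \<in> solutions M s \<phi>)) \<longrightarrow>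
        (\<exists>x\<in>carr M s. \<forall>\<phi>\<in>\<Sigma>. x \<in> solutions M s \<phi>))"

text \<open>Every elementary map with small domain \<open>A\<close> extends to an automorphism; \<open>f\<close> is elementary iff
  the enumeration of \<open>A\<close> by itself has the same type as its image.\<close>

definition strongly_homogeneous ::
  "('s, 'f, 'r) lang \<Rightarrow> 'k rel \<Rightarrow> ('s, 'f, 'r, 'a) struct \<Rightarrow> bool" where
  "strongly_homogeneous L \<kappa> M \<longleftrightarrow>
     (\<forall>A f. A \<subseteq> univ L M \<and> small \<kappa> A \<and> f \<in> A \<rightarrow> univ L M \<and>
        tp L M A f {} = tp L M A (\<lambda>x. x) {} \<longrightarrow>
        (\<exists>g\<in>Aut L M. \<forall>x\<in>A. g x = f x))"

text \<open>Monster model of its complete theory: \<open>\<kappa>\<close>-saturated and strongly \<open>\<kappa>\<close>-homogeneous, where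
  \<open>\<kappa>\<close> is a cardinal above the size (number of symbols plus aleph zero) of the language.\<close>

definition monster :: "('s, 'f, 'r) lang \<Rightarrow> 'k rel \<Rightarrow> ('s, 'f, 'r, 'a) struct \<Rightarrow> bool" where
  "monster L \<kappa> M \<longleftrightarrow>
     lang_ok L \<and> is_struct L M \<and> Card_order \<kappa> \<and> (natLeq, \<kappa>) \<in> ordLess \<and>
     small \<kappa> (sorts L <+> funs L <+> rels L) \<and>
     saturated L \<kappa> M \<and> strongly_homogeneous L \<kappa> M"

section \<open>Lascar groups\<close>

definition Autf :: "('s, 'f, 'r) lang \<Rightarrow> 'k rel \<Rightarrow> ('s, 'f, 'r, 'a) struct \<Rightarrow> ('a \<Rightarrow> 'a) set" where
  "Autf L \<kappa> M =
     \<Inter> {H. H \<lhd> AutG L M \<and>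
           {f \<in> Aut L M. \<exists>X. elem_submodel L M X \<and> small \<kappa> X \<and> (\<forall>x\<in>X. f x = x)} \<subseteq> H}"

text \<open>Functions act on tuples indexed by \<open>I\<close> by \<open>compose I\<close>.\<close>

definition lascar_eq ::
  "('s, 'f, 'r) lang \<Rightarrow> 'k rel \<Rightarrow> ('s, 'f, 'r, 'a) struct \<Rightarrow> 'i set
     \<Rightarrow> ('i \<Rightarrow> 'a) \<Rightarrow> ('i \<Rightarrow> 'a) \<Rightarrow> bool" where
  "lascar_eq L \<kappa> M I u v \<longleftrightarrow> (\<exists>f\<in>Autf L \<kappa> M. compose I f u = v)"

definition Gal_L ::
  "('s, 'f, 'r) lang \<Rightarrow> 'k rel \<Rightarrow> ('s, 'f, 'r, 'a) struct \<Rightarrow> ('a \<Rightarrow> 'a) set monoid" where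
  "Gal_L L \<kappa> M = AutG L M Mod Autf L \<kappa> M"

text \<open>The standard topology on the Lascar group, for a small elementary submodel \<open>X\<close> enumerated by
  itself: \<open>type_space L M X\<close> is the space of the types \<open>tp(f(X)/X)\<close>, \<open>f\<close> an automorphism, with the
  logic topology, \<open>type_to_Gal\<close> maps \<open>tp(f(X)/X)\<close> to the class of \<open>f\<close>, and the Lascar group gets
  the quotient topology.\<close>

definition image_types ::
  "('s, 'f, 'r) lang \<Rightarrow> ('s, 'f, 'r, 'a) struct \<Rightarrow> 'a set \<Rightarrow> ('s, 'f, 'r, 'a + 'a) fm set set" where
  "image_types L M X = (\<lambda>f. tp L M X f X) ` Aut L M"

definition type_space ::
  "('s, 'f, 'r) lang \<Rightarrow> ('s, 'f, 'r, 'a) struct \<Rightarrow> 'a set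
     \<Rightarrow> ('s, 'f, 'r, 'a + 'a) fm set topology" where
  "type_space L M X =
     topology_generated_by
       (insert (image_types L M X) (range (\<lambda>\<phi>. {q \<in> image_types L M X. \<phi> \<in> q})))"

definition type_to_Gal ::
  "('s, 'f, 'r) lang \<Rightarrow> 'k rel \<Rightarrow> ('s, 'f, 'r, 'a) struct \<Rightarrow> 'a set
     \<Rightarrow> ('s, 'f, 'r, 'a + 'a) fm set \<Rightarrow> ('a \<Rightarrow> 'a) set" where
  "type_to_Gal L \<kappa> M X q =
     (THE C. \<exists>f\<in>Aut L M. q = tp L M X f X \<and> C = Autf L \<kappa> M #>\<^bsub>AutG L M\<^esub> f)"

definition Gal_topology ::
  "('s, 'f, 'r) lang \<Rightarrow> 'k rel \<Rightarrow> ('s, 'f, 'r, 'a) struct \<Rightarrow> 'a set \<Rightarrow> ('a \<Rightarrow> 'a) set topology" where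
  "Gal_topology L \<kappa> M X =
     topology (\<lambda>U. U \<subseteq> carrier (Gal_L L \<kappa> M) \<and>
       openin (type_space L M X)
         {q \<in> topspace (type_space L M X). type_to_Gal L \<kappa> M X q \<in> U})"

text \<open>The topology does not depend on the choice of \<open>X\<close>, so any small elementary submodel will do.\<close>

definition G_compact :: "('s, 'f, 'r) lang \<Rightarrow> 'k rel \<Rightarrow> ('s, 'f, 'r, 'a) struct \<Rightarrow> bool" where
  "G_compact L \<kappa> M \<longleftrightarrow>
     (\<exists>X. elem_submodel L M X \<and> small \<kappa> X \<and> Hausdorff_space (Gal_topology L \<kappa> M X))"

section \<open>Relativised Lascar groups\<close>

definition restr_aut ::
  "('s, 'f, 'r) lang \<Rightarrow> ('s, 'f, 'r, 'a) struct \<Rightarrow> 'i set \<Rightarrow> ('s, 'f, 'r, 'i + 'a) fm set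
     \<Rightarrow> ('a \<Rightarrow> 'a) \<Rightarrow> ('i \<Rightarrow> 'a) \<Rightarrow> ('i \<Rightarrow> 'a)" where
  "restr_aut L M I q f = restrict (compose I f) (realizations L M I q)"

definition Aut_tp ::
  "('s, 'f, 'r) lang \<Rightarrow> ('s, 'f, 'r, 'a) struct \<Rightarrow> 'i set \<Rightarrow> ('s, 'f, 'r, 'i + 'a) fm set
     \<Rightarrow> (('i \<Rightarrow> 'a) \<Rightarrow> ('i \<Rightarrow> 'a)) monoid" where
  "Aut_tp L M I q = (BijGroup (realizations L M I q))\<lparr>carrier := restr_aut L M I q ` Aut L M\<rparr>"

definition Autf1 ::
  "('s, 'f, 'r) lang \<Rightarrow> 'k rel \<Rightarrow> ('s, 'f, 'r, 'a) struct \<Rightarrow> 'i set \<Rightarrow> ('s, 'f, 'r, 'i + 'a) fm set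
     \<Rightarrow> (('i \<Rightarrow> 'a) \<Rightarrow> ('i \<Rightarrow> 'a)) set" where
  "Autf1 L \<kappa> M I q =
     {\<sigma> \<in> carrier (Aut_tp L M I q). \<forall>u\<in>realizations L M I q. lascar_eq L \<kappa> M I (\<sigma> u) u}"

definition Gal1 ::
  "('s, 'f, 'r) lang \<Rightarrow> 'k rel \<Rightarrow> ('s, 'f, 'r, 'a) struct \<Rightarrow> 'i set \<Rightarrow> ('s, 'f, 'r, 'i + 'a) fm set
     \<Rightarrow> (('i \<Rightarrow> 'a) \<Rightarrow> ('i \<Rightarrow> 'a)) set monoid" where
  "Gal1 L \<kappa> M I q = Aut_tp L M I q Mod Autf1 L \<kappa> M I q"

definition Gal1_class ::
  "('s, 'f, 'r) lang \<Rightarrow> 'k rel \<Rightarrow> ('s, 'f, 'r, 'a) struct \<Rightarrow> 'i set \<Rightarrow> ('s, 'f, 'r, 'i + 'a) fm set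
     \<Rightarrow> ('a \<Rightarrow> 'a) \<Rightarrow> (('i \<Rightarrow> 'a) \<Rightarrow> ('i \<Rightarrow> 'a)) set" where
  "Gal1_class L \<kappa> M I q f = Autf1 L \<kappa> M I q #>\<^bsub>Aut_tp L M I q\<^esub> restr_aut L M I q f"

text \<open>The natural projection from the group of \<open>qbar\<close> (variables \<open>J\<close>) to that of \<open>q\<close>
  (variables \<open>I\<close>).\<close>

definition Gal1_proj ::
  "('s, 'f, 'r) lang \<Rightarrow> 'k rel \<Rightarrow> ('s, 'f, 'r, 'a) struct
     \<Rightarrow> 'j set \<Rightarrow> ('s, 'f, 'r, 'j + 'a) fm set \<Rightarrow> 'i set \<Rightarrow> ('s, 'f, 'r, 'i + 'a) fm set
     \<Rightarrow> (('j \<Rightarrow> 'a) \<Rightarrow> ('j \<Rightarrow> 'a)) set \<Rightarrow> (('i \<Rightarrow> 'a) \<Rightarrow> ('i \<Rightarrow> 'a)) set" where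
  "Gal1_proj L \<kappa> M J qbar I q C =
     (THE D. \<exists>f\<in>Aut L M. C = Gal1_class L \<kappa> M J qbar f \<and> D = Gal1_class L \<kappa> M I q f)"

section \<open>Imaginaries\<close>

text \<open>An imaginary sort \<open>Imag ss E\<close> is given by a formula \<open>E(x,y)\<close> defining an equivalence relation
  on the product of the sorts \<open>ss\<close>; the variable \<open>x\<^sub>i\<close> is named \<open>Inl i\<close> and \<open>y\<^sub>i\<close> is named \<open>Inr i\<close>.\<close>

definition eq_rel ::
  "('s, 'f, 'r, 'a) struct \<Rightarrow> 's list \<Rightarrow> ('s, 'f, 'r, nat + nat) fm \<Rightarrow> 'a list rel" where
  "eq_rel N ss E =
     {(xs, ys). xs \<in> tups N ss \<and> ys \<in> tups N ss \<and> sat N (case_sum (nth xs) (nth ys)) [] E}"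

definition eq_fm ::
  "('s, 'f, 'r) lang \<Rightarrow> ('s, 'f, 'r, 'a) struct \<Rightarrow> 's list \<Rightarrow> ('s, 'f, 'r, nat + nat) fm \<Rightarrow> bool" where
  "eq_fm L N ss E \<longleftrightarrow>
     ss \<noteq> [] \<and> set ss \<subseteq> sorts L \<and> fm_ok L [] E \<and>
     fvs E \<subseteq> {(ss ! i, Inl i) |i. i < length ss} \<union> {(ss ! i, Inr i) |i. i < length ss} \<and>
     equiv (tups N ss) (eq_rel N ss E)"

datatype ('s, 'f, 'r) eqsort = Home 's | Imag "'s list" "('s, 'f, 'r, nat + nat) fm"

datatype ('s, 'f, 'r) eqfun = OldF 'f | Proj "'s list" "('s, 'f, 'r, nat + nat) fm"

datatype ('s, 'f, 'r, 'a) eqelt =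
    Real (the_real: 'a)
  | Class "'s list" "('s, 'f, 'r, nat + nat) fm" "'a list set"

definition eq_lang ::
  "('s, 'f, 'r) lang \<Rightarrow> ('s, 'f, 'r, 'a) struct
     \<Rightarrow> (('s, 'f, 'r) eqsort, ('s, 'f, 'r) eqfun, 'r) lang" where
  "eq_lang L N =
     \<lparr>sorts = Home ` sorts L \<union> {Imag ss E |ss E. eq_fm L N ss E},
      funs = OldF ` funs L \<union> {Proj ss E |ss E. eq_fm L N ss E},
      rels = rels L,
      fargs = (\<lambda>h. case h of OldF f \<Rightarrow> map Home (fargs L f) | Proj ss E \<Rightarrow> map Home ss),
      fres = (\<lambda>h. case h of OldF f \<Rightarrow> Home (fres L f) | Proj ss E \<Rightarrow> Imag ss E),
      rargs = (\<lambda>r. map Home (rargs L r))\<rparr>"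

definition eq_struct ::
  "('s, 'f, 'r, 'a) struct
     \<Rightarrow> (('s, 'f, 'r) eqsort, ('s, 'f, 'r) eqfun, 'r, ('s, 'f, 'r, 'a) eqelt) struct" where
  "eq_struct N =
     \<lparr>carr = (\<lambda>t. case t of
          Home s \<Rightarrow> Real ` carr N s
        | Imag ss E \<Rightarrow> Class ss E ` (tups N ss // eq_rel N ss E)),
      fint = (\<lambda>h xs. case h of
          OldF f \<Rightarrow> Real (fint N f (map the_real xs))
        | Proj ss E \<Rightarrow> Class ss E (eq_rel N ss E `` {map the_real xs})),
      rint = (\<lambda>r. map Real ` rint N r)\<rparr>"

end

theory Submission
  imports Defs
begin

text \<open>Let \<open>H\<close> and \<open>K\<close> be the stabilizers in the Lascar group of the Lascar types of \<open>a\<close> and \<open>b = (a, c)\<close>.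
  As \<open>c\<close> is a finite tuple algebraic over \<open>a\<close>, the index of \<open>K\<close> in \<open>H\<close> is finite, and the kernel of
  \<open>\<pi>\<close> is the quotient of the normal core of \<open>H\<close> by that of \<open>K\<close>. Let \<open>f\<close> be in the core of \<open>H\<close>.
  Conjugating \<open>f\<close> by \<open>g\<close> gives an element of \<open>H\<close>, whose coset modulo \<open>K\<close> depends continuously on \<open>g\<close>
  because \<open>T\<close> is \<open>G\<close>-compact, and takes finitely many values. As the algebraic closure of the empty set
  is its definable closure, the Lascar group is connected, so this coset is constant. Hence if \<open>f\<close> is in
  \<open>K\<close>, it is in the core of \<open>K\<close>, and the kernel embeds into the finite set of cosets of \<open>K\<close> in \<open>H\<close>.\<close>

section \<open>Substitution and automorphisms\<close>

text \<open>Topology enters only once: G-compactness makes the identity of the Lascar group a closed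
  point, so every automorphism outside \<open>Autf\<close> is separated from \<open>Autf\<close> by
  one formula over a small model \<open>X\<close>. Continuity is then replaced by compactness: if no
  finite set of formulas over \<open>X\<close> separated two sets of automorphisms, the failures
  would have a limit. Such limits are controlled only on a small set, which composition leaves. This
  does no harm, because the class of an automorphism in the Lascar group is determined by its
  restriction to \<open>X\<close>, and products are carried along as further members of the family.
  Connectedness is expressed by formulas, too: a union of cosets of \<open>Autf\<close> decided by
  finitely many formulas yields a definable equivalence relation with finitely many classes. These
  classes ought to be elements of \<open>acl\<close> of the empty set, but the relation lives on
  tuples of the expansion, whose sorts are only the quotients of the original structure. Hence
  formulas about imaginary elements are translated into formulas about their
  representatives.\<close>

primrec tm_lift :: "nat \<Rightarrow> ('s, 'f, 'v) tm \<Rightarrow> ('s, 'f, 'v) tm" where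
  "tm_lift d (FV s v) = FV s v"
| "tm_lift d (BV k) = BV (k + d)"
| "tm_lift d (Fn f ts) = Fn f (map (tm_lift d) ts)"

primrec tm_subst :: "('s \<Rightarrow> 'v \<Rightarrow> ('s, 'f, 'w) tm) \<Rightarrow> ('s, 'f, 'v) tm \<Rightarrow> ('s, 'f, 'w) tm" where
  "tm_subst \<sigma> (FV s v) = \<sigma> s v"
| "tm_subst \<sigma> (BV k) = BV k"
| "tm_subst \<sigma> (Fn f ts) = Fn f (map (tm_subst \<sigma>) ts)"

text \<open>The number \<open>d\<close> counts the quantifiers passed so far: the bound variables of the substituted terms
  refer to the context outside the formula.\<close>

primrec fm_subst ::
  "nat \<Rightarrow> ('s \<Rightarrow> 'v \<Rightarrow> ('s, 'f, 'w) tm) \<Rightarrow> ('s, 'f, 'r, 'v) fm \<Rightarrow> ('s, 'f, 'r, 'w) fm" where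
  "fm_subst d \<sigma> (Eq t u) =
     Eq (tm_subst (\<lambda>s v. tm_lift d (\<sigma> s v)) t) (tm_subst (\<lambda>s v. tm_lift d (\<sigma> s v)) u)"
| "fm_subst d \<sigma> (Rel r ts) = Rel r (map (tm_subst (\<lambda>s v. tm_lift d (\<sigma> s v))) ts)"
| "fm_subst d \<sigma> (Neg \<phi>) = Neg (fm_subst d \<sigma> \<phi>)"
| "fm_subst d \<sigma> (And \<phi> \<psi>) = And (fm_subst d \<sigma> \<phi>) (fm_subst d \<sigma> \<psi>)"
| "fm_subst d \<sigma> (Ex s \<phi>) = Ex s (fm_subst (Suc d) \<sigma> \<phi>)"

lemma tm_ok_FV_iff: "tm_ok L \<Gamma> (FV s v) t \<longleftrightarrow> t = s \<and> s \<in> sorts L"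
  by (auto elim: tm_ok.cases intro: tm_ok.intros)

lemma tm_ok_BV_iff: "tm_ok L \<Gamma> (BV k) t \<longleftrightarrow> k < length \<Gamma> \<and> t = \<Gamma> ! k"
  by (auto elim: tm_ok.cases intro: tm_ok.intros)

lemma tm_ok_Fn_iff:
  "tm_ok L \<Gamma> (Fn f ts) t \<longleftrightarrow> f \<in> funs L \<and> list_all2 (tm_ok L \<Gamma>) ts (fargs L f) \<and> t = fres L f"
  by (auto elim: tm_ok.cases intro: tm_ok.intros)

lemmas tm_ok_iff = tm_ok_FV_iff tm_ok_BV_iff tm_ok_Fn_iff

lemma eval_lift: "eval M e (\<beta>1 @ \<beta>) (tm_lift (length \<beta>1) t) = eval M e \<beta> t"
  by (induction t) (auto simp: nth_append intro: arg_cong[where f = "fint M _"])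

lemma tm_ok_lift: "tm_ok L \<Gamma>' t s \<Longrightarrow> tm_ok L (\<Gamma> @ \<Gamma>') (tm_lift (length \<Gamma>) t) s"
proof (induction t arbitrary: s)
  case (Fn f ts)
  then show ?case
    by (auto simp: tm_ok_iff list_all2_conv_all_nth)
qed (auto simp: tm_ok_iff nth_append)

lemma tm_fvs_lift [simp]: "tm_fvs (tm_lift d t) = tm_fvs t"
  by (induction t) auto

text \<open>Well-sortedness in \<open>\<Gamma>\<close> keeps every bound index of \<open>t\<close>
  below \<open>length \<beta>1\<close>. Only the lifted indices of the substituted terms reach past
  \<open>\<beta>1\<close>, into the context \<open>\<beta>\<close>.\<close>

lemma eval_subst:
  assumes "tm_ok L \<Gamma> t s" "length \<Gamma> = length \<beta>1"
    and "\<And>s v. (s, v) \<in> tm_fvs t \<Longrightarrow> e' v = eval M e \<beta> (\<sigma> s v)"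
  shows "eval M e (\<beta>1 @ \<beta>) (tm_subst (\<lambda>s v. tm_lift (length \<beta>1) (\<sigma> s v)) t) = eval M e' \<beta>1 t"
  using assms
proof (induction t arbitrary: s)
  case (Fn f ts)
  have "eval M e (\<beta>1 @ \<beta>) (tm_subst (\<lambda>s v. tm_lift (length \<beta>1) (\<sigma> s v)) t) = eval M e' \<beta>1 t"
    if t: "t \<in> set ts" for t
  proof -
    obtain s' where "tm_ok L \<Gamma> t s'"
      using t Fn.prems(1) by (auto simp: tm_ok_iff list_all2_conv_all_nth in_set_conv_nth)
    then show ?thesis
      using Fn.IH[OF t] Fn.prems t by auto
  qed
  then show ?case
    by (auto intro!: arg_cong[where f = "fint M f"])
qed (auto simp: tm_ok_iff nth_append eval_lift)

lemma tm_ok_subst: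
  assumes "tm_ok L \<Gamma> t s" "\<And>s v. (s, v) \<in> tm_fvs t \<Longrightarrow> tm_ok L \<Gamma>' (\<sigma> s v) s"
  shows "tm_ok L (\<Gamma> @ \<Gamma>') (tm_subst (\<lambda>s v. tm_lift (length \<Gamma>) (\<sigma> s v)) t) s"
  using assms
proof (induction t arbitrary: s)
  case (Fn f ts)
  have "tm_ok L (\<Gamma> @ \<Gamma>') (tm_subst (\<lambda>s v. tm_lift (length \<Gamma>) (\<sigma> s v)) (ts ! k)) (fargs L f ! k)"
    if k: "k < length ts" for k
  proof (rule Fn.IH)
    show "ts ! k \<in> set ts" "tm_ok L \<Gamma> (ts ! k) (fargs L f ! k)"
      using k Fn.prems by (auto simp: tm_ok_iff list_all2_conv_all_nth)
    show "tm_ok L \<Gamma>' (\<sigma> s v) s" if "(s, v) \<in> tm_fvs (ts ! k)" for s v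
    proof -
      have "\<exists>x\<in>set ts. (s, v) \<in> tm_fvs x"
        using nth_mem[OF k] that by blast
      then show ?thesis
        using Fn.prems(2)[of s v] by simp
    qed
  qed
  then show ?case
    using Fn.prems by (auto simp: tm_ok_iff list_all2_conv_all_nth)
qed (auto simp: tm_ok_iff nth_append intro: tm_ok_lift)

lemma tm_fvs_subst: "tm_fvs (tm_subst \<sigma> t) = (\<Union>(s, v)\<in>tm_fvs t. tm_fvs (\<sigma> s v))"
  by (induction t) auto

text \<open>Under a quantifier the local context \<open>\<beta>1\<close> and the lifting grow
  together, so the substituted terms are still read in \<open>\<beta>\<close>.\<close>

lemma sat_subst:
  assumes "fm_ok L \<Gamma> \<phi>" "length \<Gamma> = length \<beta>1"
    and "\<And>s v. (s, v) \<in> fvs \<phi> \<Longrightarrow> e' v = eval M e \<beta> (\<sigma> s v)"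
  shows "sat M e (\<beta>1 @ \<beta>) (fm_subst (length \<beta>1) \<sigma> \<phi>) \<longleftrightarrow> sat M e' \<beta>1 \<phi>"
  using assms
proof (induction \<phi> arbitrary: \<Gamma> \<beta>1)
  case (Eq t u)
  then obtain s where s: "tm_ok L \<Gamma> t s" "tm_ok L \<Gamma> u s"
    by auto
  show ?case
    using eval_subst[OF s(1) Eq.prems(2), of e' M e \<beta> \<sigma>] eval_subst[OF s(2) Eq.prems(2), of e' M e \<beta> \<sigma>]
      Eq.prems(3) by simp
next
  case (Rel r ts)
  have "map (eval M e (\<beta>1 @ \<beta>) \<circ> tm_subst (\<lambda>s v. tm_lift (length \<beta>1) (\<sigma> s v))) ts
      = map (eval M e' \<beta>1) ts" (is "?l = ?r")
  proof (intro map_cong refl)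
    fix t assume t: "t \<in> set ts"
    then obtain s where "tm_ok L \<Gamma> t s"
      using Rel.prems by (auto simp: list_all2_conv_all_nth in_set_conv_nth)
    then show "(eval M e (\<beta>1 @ \<beta>) \<circ> tm_subst (\<lambda>s v. tm_lift (length \<beta>1) (\<sigma> s v))) t
        = eval M e' \<beta>1 t"
      using eval_subst[of L \<Gamma> t s \<beta>1 e' M e \<beta> \<sigma>] Rel.prems t by auto
  qed
  then have "?l \<in> rint M r \<longleftrightarrow> ?r \<in> rint M r"
    by (simp only:)
  then show ?case
    by simp
next
  case (And \<phi>1 \<phi>2)
  then show ?case
    by (simp del: fm_ok.simps) (metis fm_ok.simps(4) UnI1 UnI2)
next
  case (Ex s \<phi>)
  have "sat M e ((x # \<beta>1) @ \<beta>) (fm_subst (length (x # \<beta>1)) \<sigma> \<phi>) \<longleftrightarrow> sat M e' (x # \<beta>1) \<phi>" for x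
    using Ex.prems by (intro Ex.IH[of "s # \<Gamma>"]) auto
  then show ?case
    by simp
qed (auto)

lemma fm_ok_subst:
  assumes "fm_ok L \<Gamma> \<phi>" "\<And>s v. (s, v) \<in> fvs \<phi> \<Longrightarrow> tm_ok L \<Gamma>' (\<sigma> s v) s"
  shows "fm_ok L (\<Gamma> @ \<Gamma>') (fm_subst (length \<Gamma>) \<sigma> \<phi>)"
  using assms
proof (induction \<phi> arbitrary: \<Gamma>)
  case (Eq t u)
  then show ?case
    by (simp del: fm_ok.simps add: fm_ok.simps(1)) (metis UnI1 UnI2 tm_ok_subst)
next
  case (Rel r ts)
  have "tm_ok L (\<Gamma> @ \<Gamma>') (tm_subst (\<lambda>s v. tm_lift (length \<Gamma>) (\<sigma> s v)) (ts ! k)) (rargs L r ! k)"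
    if k: "k < length ts" for k
  proof (rule tm_ok_subst)
    show "tm_ok L \<Gamma> (ts ! k) (rargs L r ! k)"
      using k Rel.prems by (auto simp: list_all2_conv_all_nth)
    show "tm_ok L \<Gamma>' (\<sigma> s v) s" if "(s, v) \<in> tm_fvs (ts ! k)" for s v
    proof -
      have "\<exists>x\<in>set ts. (s, v) \<in> tm_fvs x"
        using nth_mem[OF k] that by blast
      then show ?thesis
        using Rel.prems(2)[of s v] by simp
    qed
  qed
  then show ?case
    using Rel.prems by (auto simp: list_all2_conv_all_nth)
next
  case (Ex s \<phi>)
  then show ?case
    using Ex.IH[of "s # \<Gamma>"] by auto
qed auto

lemma fvs_subst: "fvs (fm_subst d \<sigma> \<phi>) = (\<Union>(s, v)\<in>fvs \<phi>. tm_fvs (\<sigma> s v))"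
  by (induction \<phi> arbitrary: d) (auto simp: tm_fvs_subst)

lemma finite_tm_fvs: "finite (tm_fvs t)"
  by (induction t) auto

lemma finite_fvs: "finite (fvs \<phi>)"
  by (induction \<phi>) (auto simp: finite_tm_fvs)

lemma eval_cong: "(\<And>s v. (s, v) \<in> tm_fvs t \<Longrightarrow> e v = e' v) \<Longrightarrow> eval M e \<beta> t = eval M e' \<beta> t"
proof (induction t)
  case (Fn f ts)
  have "eval M e \<beta> t = eval M e' \<beta> t" if t: "t \<in> set ts" for t
    using t Fn.prems by (intro Fn.IH) auto
  then show ?case
    by (auto intro!: arg_cong[where f = "fint M f"])
qed auto

lemma sat_cong: "(\<And>s v. (s, v) \<in> fvs \<phi> \<Longrightarrow> e v = e' v) \<Longrightarrow> sat M e \<beta> \<phi> \<longleftrightarrow> sat M e' \<beta> \<phi>"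
proof (induction \<phi> arbitrary: \<beta>)
  case (Eq t u)
  then have "eval M e \<beta> t = eval M e' \<beta> t" "eval M e \<beta> u = eval M e' \<beta> u"
    by (auto intro!: eval_cong)
  then show ?case
    by simp
next
  case (Rel r ts)
  then have "map (eval M e \<beta>) ts = map (eval M e' \<beta>) ts"
    by (auto intro!: eval_cong)
  then have "map (eval M e \<beta>) ts \<in> rint M r \<longleftrightarrow> map (eval M e' \<beta>) ts \<in> rint M r"
    by (simp only:)
  then show ?case
    by simp
qed auto

lemma fm_ok_sorts: "fm_ok L \<Gamma> \<phi> \<Longrightarrow> (s, v) \<in> fvs \<phi> \<Longrightarrow> s \<in> sorts L"
proof (induction \<phi> arbitrary: \<Gamma>)
  have t: "tm_ok L \<Gamma> t s' \<Longrightarrow> (s, v) \<in> tm_fvs t \<Longrightarrow> s \<in> sorts L" for t s' \<Gamma>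
  proof (induction t arbitrary: s')
    case (Fn f ts)
    then show ?case
      by (fastforce simp: tm_ok_iff list_all2_conv_all_nth in_set_conv_nth)
  qed (auto simp: tm_ok_iff)
  {
    case (Eq t u)
    then show ?case
      by (auto dest: t)
  next
    case (Rel r ts)
    then show ?case
      by (fastforce simp: list_all2_conv_all_nth in_set_conv_nth dest: t)
  }
qed auto

section \<open>Formulas and assignments over a set of sorted variables\<close>

definition okf :: "('s, 'f, 'r) lang \<Rightarrow> ('s \<times> 'v) set \<Rightarrow> ('s, 'f, 'r, 'v) fm set" where
  "okf L V = {\<phi>. fm_ok L [] \<phi> \<and> fvs \<phi> \<subseteq> V}"

definition wfa :: "('s, 'f, 'r, 'a) struct \<Rightarrow> ('s \<times> 'v) set \<Rightarrow> ('v \<Rightarrow> 'a) \<Rightarrow> bool" where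
  "wfa M V e \<longleftrightarrow> (\<forall>(s, v)\<in>V. e v \<in> carr M s)"

text \<open>Evaluation reads only the name of a variable and ignores its sort. Injectivity of
  \<open>snd\<close> lets an assignment give each variable a value of the right sort, and lets a
  quantifier bind a name without catching a variable of another sort.\<close>

definition varset :: "('s, 'f, 'r) lang \<Rightarrow> ('s \<times> 'v) set \<Rightarrow> bool" where
  "varset L V \<longleftrightarrow> fst ` V \<subseteq> sorts L \<and> inj_on snd V"

definition fm_rename :: "('v \<Rightarrow> 'w) \<Rightarrow> ('s, 'f, 'r, 'v) fm \<Rightarrow> ('s, 'f, 'r, 'w) fm" where
  "fm_rename \<rho> \<phi> = fm_subst 0 (\<lambda>s v. FV s (\<rho> v)) \<phi>"

lemma sat_rename:
  assumes "\<phi> \<in> okf L V"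
  shows "sat M e [] (fm_rename \<rho> \<phi>) \<longleftrightarrow> sat M (e \<circ> \<rho>) [] \<phi>"
  using sat_subst[of L "[]" \<phi> "[]" "e \<circ> \<rho>" M e "[]" "\<lambda>s v. FV s (\<rho> v)"] assms
  by (simp add: fm_rename_def okf_def)

lemma fvs_rename: "fvs (fm_rename \<rho> \<phi>) = map_prod id \<rho> ` fvs \<phi>"
  by (force simp: fm_rename_def fvs_subst)

lemma rename_okf:
  assumes "\<phi> \<in> okf L V" "map_prod id \<rho> ` V \<subseteq> W"
  shows "fm_rename \<rho> \<phi> \<in> okf L W"
proof -
  have "fm_ok L ([] @ []) (fm_subst (length ([] :: 'a list)) (\<lambda>s v. FV s (\<rho> v)) \<phi>)"
    using assms by (intro fm_ok_subst) (auto simp: okf_def tm_ok_iff fm_ok_sorts)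
  then show ?thesis
    using assms unfolding okf_def by (auto simp: fm_rename_def[symmetric] fvs_rename)
qed

lemma okf_Neg [simp]: "Neg \<phi> \<in> okf L V \<longleftrightarrow> \<phi> \<in> okf L V"
  and okf_And [simp]: "And \<phi> \<psi> \<in> okf L V \<longleftrightarrow> \<phi> \<in> okf L V \<and> \<psi> \<in> okf L V"
  by (auto simp: okf_def)

lemma okf_mono: "\<phi> \<in> okf L V \<Longrightarrow> V \<subseteq> W \<Longrightarrow> \<phi> \<in> okf L W"
  by (auto simp: okf_def)

definition fm_iff :: "('s, 'f, 'r, 'v) fm \<Rightarrow> ('s, 'f, 'r, 'v) fm \<Rightarrow> ('s, 'f, 'r, 'v) fm" where
  "fm_iff \<phi> \<psi> = And (Neg (And \<phi> (Neg \<psi>))) (Neg (And \<psi> (Neg \<phi>)))"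

lemma sat_iff [simp]: "sat M e \<beta> (fm_iff \<phi> \<psi>) \<longleftrightarrow> (sat M e \<beta> \<phi> \<longleftrightarrow> sat M e \<beta> \<psi>)"
  and okf_iff [simp]: "fm_iff \<phi> \<psi> \<in> okf L V \<longleftrightarrow> \<phi> \<in> okf L V \<and> \<psi> \<in> okf L V"
  by (auto simp: fm_iff_def)

text \<open>The syntax has no constant for truth; \<open>\<phi>0\<close> serves to write the empty
  conjunction as the negation of a contradiction with variables in \<open>V\<close>.\<close>

lemma finite_conj:
  assumes "finite \<Delta>" "\<Delta> \<subseteq> okf L V" "\<phi>0 \<in> okf L V"
  shows "\<exists>\<phi>\<in>okf L V. \<forall>e. sat M e [] \<phi> \<longleftrightarrow> (\<forall>\<delta>\<in>\<Delta>. sat M e [] \<delta>)"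
  using assms(1,2)
proof (induction rule: finite_induct)
  case empty
  show ?case
    using assms(3) by (intro bexI[of _ "Neg (And \<phi>0 (Neg \<phi>0))"]) auto
next
  case (insert \<delta> \<Delta>)
  then obtain \<phi> where "\<phi> \<in> okf L V" "\<forall>e. sat M e [] \<phi> \<longleftrightarrow> (\<forall>\<delta>\<in>\<Delta>. sat M e [] \<delta>)"
    by auto
  then show ?case
    using insert.prems by (intro bexI[of _ "And \<delta> \<phi>"]) auto
qed

text \<open>The name \<open>v\<close> is replaced by the bound index 0 and a quantifier of sort
  \<open>s\<close> is put in front. As \<open>V\<close> is a \<open>varset\<close>, every occurrence
  of the name \<open>v\<close> carries the sort \<open>s\<close>, so the result is
  well-sorted.\<close>

lemma ex_var:
  assumes "\<phi> \<in> okf L V" "varset L V" "(s, v) \<in> V"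
  shows "\<exists>\<psi>\<in>okf L (V - {(s, v)}).
    \<forall>e. sat M e [] \<psi> \<longleftrightarrow> (\<exists>x\<in>carr M s. sat M (e(v := x)) [] \<phi>)"
proof -
  define \<sigma> :: "'a \<Rightarrow> 'd \<Rightarrow> ('a, 'b, 'd) tm" where
    "\<sigma> = (\<lambda>s' v'. if v' = v then BV 0 else FV s' v')"
  define \<psi> where "\<psi> = fm_subst 0 \<sigma> \<phi>"
  have uniq: "s' = s" if "(s', v) \<in> fvs \<phi>" for s'
    using assms that by (force simp: okf_def varset_def inj_on_def)
  have s: "s \<in> sorts L"
    using assms by (force simp: varset_def)
  have "fm_ok L ([] @ [s]) (fm_subst (length ([] :: 'a list)) \<sigma> \<phi>)"
    using assms by (intro fm_ok_subst)
      (auto simp: okf_def \<sigma>_def tm_ok_iff fm_ok_sorts dest: uniq)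
  then have "Ex s \<psi> \<in> okf L (V - {(s, v)})"
    using assms s uniq by (auto simp: okf_def \<psi>_def fvs_subst \<sigma>_def split: if_splits)
  moreover have "sat M e [x] \<psi> \<longleftrightarrow> sat M (e(v := x)) [] \<phi>" for e x
    using sat_subst[of L "[]" \<phi> "[]" "e(v := x)" M e "[x]" \<sigma>] assms
    by (simp add: okf_def \<psi>_def \<sigma>_def)
  ultimately show ?thesis
    by (intro bexI[of _ "Ex s \<psi>"]) auto
qed

text \<open>Iterating \<open>ex_var\<close> amounts to asking for one modified assignment
  \<open>e'\<close>: since names are distinct, the values chosen for different members of
  \<open>F\<close> do not overwrite each other.\<close>

lemma ex_closure:
  assumes "finite F" "F \<subseteq> V" "\<phi> \<in> okf L V" "varset L V"
  shows "\<exists>\<psi>\<in>okf L (V - F). \<forall>e. sat M e [] \<psi> \<longleftrightarrow>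
    (\<exists>e'. (\<forall>v. v \<notin> snd ` F \<longrightarrow> e' v = e v) \<and> wfa M F e' \<and> sat M e' [] \<phi>)"
  using assms(1,2)
proof (induction rule: finite_induct)
  case empty
  show ?case
    using assms(3) by (intro bexI[of _ \<phi>]) (auto simp: wfa_def fun_eq_iff[symmetric])
next
  case (insert p F)
  obtain s v where p: "p = (s, v)"
    by (cases p)
  from insert obtain \<psi> where \<psi>: "\<psi> \<in> okf L (V - F)" and sat_\<psi>: "\<And>e. sat M e [] \<psi> \<longleftrightarrow>
    (\<exists>e'. (\<forall>v. v \<notin> snd ` F \<longrightarrow> e' v = e v) \<and> wfa M F e' \<and> sat M e' [] \<phi>)"
    by auto
  have vs: "varset L (V - F)" and sv: "(s, v) \<in> V - F"
    using assms(4) insert p by (auto simp: varset_def inj_on_def)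
  obtain \<eta> where \<eta>: "\<eta> \<in> okf L (V - F - {(s, v)})"
    and sat_\<eta>: "\<And>e. sat M e [] \<eta> \<longleftrightarrow> (\<exists>x\<in>carr M s. sat M (e(v := x)) [] \<psi>)"
    using ex_var[OF \<psi> vs sv, of M] by (elim bexE) (rule that, auto)
  have vF: "v \<notin> snd ` F"
    using assms(4) insert p by (force simp: varset_def inj_on_def)
  have "sat M e [] \<eta> \<longleftrightarrow>
    (\<exists>e'. (\<forall>w. w \<notin> snd ` insert p F \<longrightarrow> e' w = e w) \<and> wfa M (insert p F) e' \<and> sat M e' [] \<phi>)" for e
  proof
    assume "sat M e [] \<eta>"
    then obtain x e' where x: "x \<in> carr M s" "\<forall>w. w \<notin> snd ` F \<longrightarrow> e' w = (e(v := x)) w"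
      "wfa M F e'" "sat M e' [] \<phi>"
      using sat_\<eta> sat_\<psi> by blast
    moreover have "e' v = x"
      using x vF by auto
    ultimately show "\<exists>e'. (\<forall>w. w \<notin> snd ` insert p F \<longrightarrow> e' w = e w) \<and> wfa M (insert p F) e' \<and> sat M e' [] \<phi>"
      using p by (intro exI[of _ e']) (auto simp: wfa_def)
  next
    assume "\<exists>e'. (\<forall>w. w \<notin> snd ` insert p F \<longrightarrow> e' w = e w) \<and> wfa M (insert p F) e' \<and> sat M e' [] \<phi>"
    then obtain e' where e': "\<forall>w. w \<notin> snd ` insert p F \<longrightarrow> e' w = e w" "wfa M (insert p F) e'" "sat M e' [] \<phi>"
      by blast
    have "sat M (e(v := e' v)) [] \<psi>"
      unfolding sat_\<psi> using e' p by (intro exI[of _ e']) (auto simp: wfa_def)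
    moreover have "e' v \<in> carr M s"
      using e' p by (auto simp: wfa_def)
    ultimately show "sat M e [] \<eta>"
      unfolding sat_\<eta> by blast
  qed
  moreover have "V - F - {(s, v)} = V - insert p F"
    using p by auto
  ultimately show ?case
    using \<eta> by auto
qed

section \<open>Invariance of evaluation and satisfaction under automorphisms\<close>

lemma eval_sort:
  assumes "is_struct L M" "tm_ok L \<Gamma> t s" "\<beta> \<in> tups M \<Gamma>" "wfa M (tm_fvs t) e"
  shows "eval M e \<beta> t \<in> carr M s"
  using assms(2,4)
proof (induction t arbitrary: s)
  case (FV s v)
  then show ?case
    by (auto simp: tm_ok_iff wfa_def)
next
  case (BV k)
  then show ?case
    using assms(3) by (auto simp: tm_ok_iff tups_def list_all2_conv_all_nth)
next
  case (Fn f ts)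
  have "map (eval M e \<beta>) ts \<in> tups M (fargs L f)"
    using Fn by (fastforce simp: tups_def tm_ok_iff list_all2_conv_all_nth wfa_def)
  then show ?case
    using Fn assms(1) by (auto simp: is_struct_def tm_ok_iff)
qed

lemma eval_tups:
  assumes "is_struct L M" "list_all2 (tm_ok L \<Gamma>) ts ss" "\<beta> \<in> tups M \<Gamma>"
    and "wfa M (\<Union>(tm_fvs ` set ts)) e"
  shows "map (eval M e \<beta>) ts \<in> tups M ss"
proof -
  have "eval M e \<beta> (ts ! k) \<in> carr M (ss ! k)" if "k < length ts" for k
    using assms that
    by (intro eval_sort[OF assms(1) _ assms(3)]) (auto simp: list_all2_conv_all_nth wfa_def)
  then show ?thesis
    using assms(2) by (auto simp: tups_def list_all2_conv_all_nth)
qed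

lemma Aut_inj: "g \<in> Aut L M \<Longrightarrow> inj_on g (univ L M)"
  by (auto simp: Aut_def Bij_def bij_betw_def)

lemma Aut_carr: "g \<in> Aut L M \<Longrightarrow> s \<in> sorts L \<Longrightarrow> x \<in> carr M s \<Longrightarrow> g x \<in> carr M s"
  by (auto simp: Aut_def)

lemma eval_Aut:
  assumes "is_struct L M" "lang_ok L" "g \<in> Aut L M"
    and "tm_ok L \<Gamma> t s" "\<beta> \<in> tups M \<Gamma>" "wfa M (tm_fvs t) e"
  shows "eval M (g \<circ> e) (map g \<beta>) t = g (eval M e \<beta> t)"
  using assms(4,6)
proof (induction t arbitrary: s)
  case (BV k)
  then show ?case
    using assms(5) by (auto simp: tm_ok_iff tups_def list_all2_conv_all_nth)
next
  case (Fn f ts)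
  have *: "eval M (g \<circ> e) (map g \<beta>) t = g (eval M e \<beta> t)" if t: "t \<in> set ts" for t
  proof -
    obtain s' where "tm_ok L \<Gamma> t s'"
      using t Fn.prems(1) by (auto simp: tm_ok_iff list_all2_conv_all_nth in_set_conv_nth)
    moreover have "wfa M (tm_fvs t) e"
      using Fn.prems t by (auto simp: wfa_def)
    ultimately show ?thesis
      by (rule Fn.IH[OF t])
  qed
  have "map (eval M e \<beta>) ts \<in> tups M (fargs L f)"
    using Fn.prems by (intro eval_tups[OF assms(1) _ assms(5)]) (auto simp: tm_ok_iff)
  then have "g (fint M f (map (eval M e \<beta>) ts)) = fint M f (map g (map (eval M e \<beta>) ts))"
    using Fn assms(3) by (auto simp: Aut_def tm_ok_iff)
  also have "map g (map (eval M e \<beta>) ts) = map (eval M (g \<circ> e) (map g \<beta>)) ts"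
    using * by auto
  finally show ?case
    by (simp only: eval.simps)
qed auto

lemma tm_ok_sort: "lang_ok L \<Longrightarrow> set \<Gamma> \<subseteq> sorts L \<Longrightarrow> tm_ok L \<Gamma> t s \<Longrightarrow> s \<in> sorts L"
  by (cases t) (auto simp: tm_ok_iff lang_ok_def)

lemma tups_Cons: "x # \<beta> \<in> tups M (s # \<Gamma>) \<longleftrightarrow> x \<in> carr M s \<and> \<beta> \<in> tups M \<Gamma>"
  by (auto simp: tups_def)

text \<open>Equations need injectivity of \<open>g\<close>, relation symbols need preservation in
  both directions, and a quantifier needs that \<open>g\<close> maps every carrier onto itself, so
  that witnesses can be pulled back.\<close>

lemma sat_Aut:
  assumes "is_struct L M" "lang_ok L" "g \<in> Aut L M"
    and "fm_ok L \<Gamma> \<phi>" "\<beta> \<in> tups M \<Gamma>" "wfa M (fvs \<phi>) e" "set \<Gamma> \<subseteq> sorts L"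
  shows "sat M (g \<circ> e) (map g \<beta>) \<phi> \<longleftrightarrow> sat M e \<beta> \<phi>"
  using assms(4-7)
proof (induction \<phi> arbitrary: \<Gamma> \<beta>)
  case (Eq t u)
  then obtain s where s: "tm_ok L \<Gamma> t s" "tm_ok L \<Gamma> u s"
    by auto
  then have "eval M e \<beta> t \<in> carr M s" "eval M e \<beta> u \<in> carr M s"
    using Eq.prems by (auto intro!: eval_sort[OF assms(1)] simp: wfa_def)
  moreover have "s \<in> sorts L"
    using s Eq.prems tm_ok_sort[OF assms(2)] by blast
  ultimately have "eval M e \<beta> t \<in> univ L M" "eval M e \<beta> u \<in> univ L M"
    by (auto simp: univ_def)
  moreover have "eval M (g \<circ> e) (map g \<beta>) t = g (eval M e \<beta> t)"
    "eval M (g \<circ> e) (map g \<beta>) u = g (eval M e \<beta> u)"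
    using Eq.prems by (auto intro!: eval_Aut[OF assms(1-3)] s simp: wfa_def)
  ultimately show ?case
    using Aut_inj[OF assms(3)] by (auto simp only: sat.simps dest: inj_onD)
next
  case (Rel r ts)
  have "map (eval M (g \<circ> e) (map g \<beta>)) ts = map g (map (eval M e \<beta>) ts)"
  proof (clarsimp)
    fix t assume t: "t \<in> set ts"
    then obtain s where "tm_ok L \<Gamma> t s"
      using Rel.prems by (auto simp: list_all2_conv_all_nth in_set_conv_nth)
    moreover have "wfa M (tm_fvs t) e"
      using Rel.prems t by (auto simp: wfa_def)
    ultimately show "eval M (g \<circ> e) (map g \<beta>) t = g (eval M e \<beta> t)"
      by (intro eval_Aut[OF assms(1-3) _ Rel.prems(2)])
  qed
  moreover have "map (eval M e \<beta>) ts \<in> tups M (rargs L r)"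
    using Rel.prems by (intro eval_tups[OF assms(1)]) auto
  then have "map g (map (eval M e \<beta>) ts) \<in> rint M r \<longleftrightarrow> map (eval M e \<beta>) ts \<in> rint M r"
    using Rel.prems(1) assms(3) unfolding Aut_def fm_ok.simps by blast
  ultimately show ?case
    by (simp only: sat.simps)
next
  case (And \<phi>1 \<phi>2)
  then show ?case
    by (auto simp: wfa_def)
next
  case (Ex s \<phi>)
  have gs: "g ` carr M s = carr M s"
    using Ex.prems assms(3) by (auto simp: Aut_def)
  have "sat M (g \<circ> e) (map g \<beta>) (Ex s \<phi>) \<longleftrightarrow>
      (\<exists>y\<in>g ` carr M s. sat M (g \<circ> e) (y # map g \<beta>) \<phi>)"
    by (simp only: sat.simps gs)
  then have "sat M (g \<circ> e) (map g \<beta>) (Ex s \<phi>) \<longleftrightarrow>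
      (\<exists>x\<in>carr M s. sat M (g \<circ> e) (map g (x # \<beta>)) \<phi>)"
    by (simp only: bex_simps list.map)
  moreover have "sat M (g \<circ> e) (map g (x # \<beta>)) \<phi> \<longleftrightarrow> sat M e (x # \<beta>) \<phi>" if "x \<in> carr M s" for x
    using Ex.prems that by (intro Ex.IH[of "s # \<Gamma>"]) (auto simp: tups_Cons)
  ultimately show ?case
    by (simp only: sat.simps cong: bex_cong)
qed auto

lemma sat_Aut0:
  assumes "is_struct L M" "lang_ok L" "g \<in> Aut L M" "\<phi> \<in> okf L V" "wfa M V e"
  shows "sat M (g \<circ> e) [] \<phi> \<longleftrightarrow> sat M e [] \<phi>"
  using sat_Aut[OF assms(1-3), of "[]" \<phi> "[]" e] assms(4,5)
  by (auto simp: okf_def wfa_def tups_def)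

section \<open>The automorphism group of a monster model\<close>

lemma tups_univ: "set ss \<subseteq> sorts L \<Longrightarrow> xs \<in> tups M ss \<Longrightarrow> set xs \<subseteq> univ L M"
  by (force simp: tups_def univ_def list_all2_conv_all_nth in_set_conv_nth)

lemma Aut_map_tups:
  "f \<in> Aut L M \<Longrightarrow> set ss \<subseteq> sorts L \<Longrightarrow> xs \<in> tups M ss \<Longrightarrow> map f xs \<in> tups M ss"
  by (auto simp: tups_def list_all2_conv_all_nth) (metis Aut_carr nth_mem subsetD)

lemma Aut_fun: "f \<in> Aut L M \<Longrightarrow> h \<in> funs L \<Longrightarrow> xs \<in> tups M (fargs L h) \<Longrightarrow>
    f (fint M h xs) = fint M h (map f xs)"
  and Aut_rel: "f \<in> Aut L M \<Longrightarrow> r \<in> rels L \<Longrightarrow> xs \<in> tups M (rargs L r) \<Longrightarrow>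
    map f xs \<in> rint M r \<longleftrightarrow> xs \<in> rint M r"
  by (simp_all add: Aut_def)

lemma carr_univ: "s \<in> sorts L \<Longrightarrow> x \<in> carr M s \<Longrightarrow> x \<in> univ L M"
  by (auto simp: univ_def)

lemma Aut_univ: "f \<in> Aut L M \<Longrightarrow> x \<in> univ L M \<Longrightarrow> f x \<in> univ L M"
  using Aut_carr[of f L M] by (auto simp: univ_def)

lemma fint_univ:
  assumes "lang_ok L" "is_struct L M" "h \<in> funs L" "xs \<in> tups M (fargs L h)"
  shows "fint M h xs \<in> univ L M"
proof (rule carr_univ)
  show "fres L h \<in> sorts L" "fint M h xs \<in> carr M (fres L h)"
    using assms by (auto simp: is_struct_def lang_ok_def)
qed

lemma Aut_id: "lang_ok L \<Longrightarrow> is_struct L M \<Longrightarrow> (\<lambda>x\<in>univ L M. x) \<in> Aut L M"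
proof -
  assume L: "lang_ok L" "is_struct L M"
  have *: "map (\<lambda>x\<in>univ L M. x) xs = xs" if "xs \<in> tups M ss" "set ss \<subseteq> sorts L" for xs ss
    using tups_univ[OF that(2,1)] by (intro map_idI) auto
  have "(\<lambda>x\<in>univ L M. x) ` carr M s = carr M s" if "s \<in> sorts L" for s
    using that by (auto simp: image_def univ_def)
  moreover have "fint M h xs \<in> univ L M" if "h \<in> funs L" "xs \<in> tups M (fargs L h)" for h xs
    using L that by (rule fint_univ)
  ultimately show ?thesis
    using L * by (auto simp: Aut_def id_Bij lang_ok_def)
qed

lemma Aut_compose:
  assumes "lang_ok L" "is_struct L M" "f \<in> Aut L M" "g \<in> Aut L M"
  shows "compose (univ L M) f g \<in> Aut L M"
proof -
  have *: "map (compose (univ L M) f g) xs = map f (map g xs)"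
    if "xs \<in> tups M ss" "set ss \<subseteq> sorts L" for xs ss
    using tups_univ[OF that(2,1)] by (auto simp: compose_def)
  have "compose (univ L M) f g ` carr M s = carr M s" if s: "s \<in> sorts L" for s
  proof -
    have "compose (univ L M) f g ` carr M s = f ` (g ` carr M s)"
      using s unfolding image_image by (intro image_cong) (auto simp: compose_def univ_def)
    then show ?thesis
      using s assms by (simp add: Aut_def)
  qed
  moreover have "fint M h xs \<in> univ L M" if "h \<in> funs L" "xs \<in> tups M (fargs L h)" for h xs
    using assms(1,2) that by (rule fint_univ)
  moreover have "compose (univ L M) f g (fint M h xs) = fint M h (map (compose (univ L M) f g) xs)"
    if h: "h \<in> funs L" "xs \<in> tups M (fargs L h)" for h xs
  proof -
    have ss: "set (fargs L h) \<subseteq> sorts L"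
      using assms h by (auto simp: lang_ok_def)
    have "map g xs \<in> tups M (fargs L h)"
      by (rule Aut_map_tups[OF assms(4) ss h(2)])
    then have "f (g (fint M h xs)) = fint M h (map f (map g xs))"
      by (simp only: Aut_fun[OF assms(3) h(1)] Aut_fun[OF assms(4) h])
    then show ?thesis
      unfolding *[OF h(2) ss] compose_eq[OF fint_univ[OF assms(1,2) h]] .
  qed
  moreover have "map (compose (univ L M) f g) xs \<in> rint M r \<longleftrightarrow> xs \<in> rint M r"
    if r: "r \<in> rels L" "xs \<in> tups M (rargs L r)" for r xs
  proof -
    have ss: "set (rargs L r) \<subseteq> sorts L"
      using assms r by (auto simp: lang_ok_def)
    have "map g xs \<in> tups M (rargs L r)"
      by (rule Aut_map_tups[OF assms(4) ss r(2)])
    then have "map f (map g xs) \<in> rint M r \<longleftrightarrow> xs \<in> rint M r"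
      by (simp only: Aut_rel[OF assms(3) r(1)] Aut_rel[OF assms(4) r])
    then show ?thesis
      unfolding *[OF r(2) ss] .
  qed
  moreover have "compose (univ L M) f g \<in> Bij (univ L M)"
    using assms by (auto simp: Aut_def intro: compose_Bij)
  ultimately show ?thesis
    by (simp add: Aut_def)
qed

lemma Aut_inv_into:
  assumes "lang_ok L" "is_struct L M" "f \<in> Aut L M"
  shows "(\<lambda>x\<in>univ L M. inv_into (univ L M) f x) \<in> Aut L M"
proof -
  define g where "g = (\<lambda>x\<in>univ L M. inv_into (univ L M) f x)"
  have bij: "bij_betw f (univ L M) (univ L M)"
    using assms by (simp add: Aut_def Bij_def)
  have gf: "g (f x) = x" if "x \<in> univ L M" for x
    using that bij Aut_univ[OF assms(3)] by (auto simp: g_def bij_betw_def)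
  have fg: "f (g x) = x" "g x \<in> univ L M" if "x \<in> univ L M" for x
    using that bij by (auto simp: g_def bij_betw_def f_inv_into_f inv_into_into)
  have carr: "g ` carr M s = carr M s" if s: "s \<in> sorts L" for s
  proof -
    have "carr M s = f ` carr M s"
      using s assms by (simp add: Aut_def)
    then have "g ` carr M s = (\<lambda>x. g (f x)) ` carr M s"
      by (metis image_image)
    also have "\<dots> = (\<lambda>x. x) ` carr M s"
      using s gf by (intro image_cong) (auto intro: carr_univ)
    also have "\<dots> = carr M s"
      by simp
    finally show ?thesis .
  qed
  have tups: "map g xs \<in> tups M ss" "map f (map g xs) = xs"
    if "xs \<in> tups M ss" "set ss \<subseteq> sorts L" for xs ss
  proof -
    show "map g xs \<in> tups M ss"
      using that carr by (auto simp: tups_def list_all2_conv_all_nth) (metis imageI nth_mem subsetD)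
    show "map f (map g xs) = xs"
      using tups_univ[OF that(2,1)] fg by (auto intro!: map_idI)
  qed
  have "g (fint M h xs) = fint M h (map g xs)"
    if h: "h \<in> funs L" "xs \<in> tups M (fargs L h)" for h xs
  proof -
    have ss: "set (fargs L h) \<subseteq> sorts L"
      using assms h by (auto simp: lang_ok_def)
    have "f (fint M h (map g xs)) = fint M h xs"
      using Aut_fun[OF assms(3) h(1) tups(1)[OF h(2) ss]] unfolding tups(2)[OF h(2) ss] .
    moreover have "fint M h (map g xs) \<in> univ L M"
      by (rule fint_univ[OF assms(1,2) h(1) tups(1)[OF h(2) ss]])
    ultimately show ?thesis
      using gf by metis
  qed
  moreover have "map g xs \<in> rint M r \<longleftrightarrow> xs \<in> rint M r"
    if r: "r \<in> rels L" "xs \<in> tups M (rargs L r)" for r xs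
  proof -
    have ss: "set (rargs L r) \<subseteq> sorts L"
      using assms r by (auto simp: lang_ok_def)
    show ?thesis
      using Aut_rel[OF assms(3) r(1) tups(1)[OF r(2) ss]] unfolding tups(2)[OF r(2) ss] by simp
  qed
  moreover have "g \<in> Bij (univ L M)"
    using assms unfolding g_def by (auto simp: Aut_def intro: restrict_inv_into_Bij)
  ultimately show ?thesis
    using carr by (simp add: Aut_def g_def[symmetric])
qed

lemma subgroup_Aut:
  assumes "lang_ok L" "is_struct L M"
  shows "subgroup (Aut L M) (BijGroup (univ L M))"
proof -
  interpret B: group "BijGroup (univ L M)"
    by (rule group_BijGroup)
  have Bij: "f \<in> Bij (univ L M)" if "f \<in> Aut L M" for f
    using that by (simp add: Aut_def)
  show ?thesis
  proof (rule B.subgroupI)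
    show "Aut L M \<subseteq> carrier (BijGroup (univ L M))"
      using Bij by (auto simp: BijGroup_def)
    show "Aut L M \<noteq> {}"
      using Aut_id[OF assms] by blast
    show "inv\<^bsub>BijGroup (univ L M)\<^esub> f \<in> Aut L M" if "f \<in> Aut L M" for f
      using Aut_inv_into[OF assms that] Bij[OF that] by (simp add: inv_BijGroup)
    show "f \<otimes>\<^bsub>BijGroup (univ L M)\<^esub> g \<in> Aut L M" if "f \<in> Aut L M" "g \<in> Aut L M" for f g
      using Aut_compose[OF assms that] Bij that by (simp add: BijGroup_def)
  qed
qed

lemma param_fms_iff:
  "\<phi> \<in> param_fms L M V B \<longleftrightarrow> fm_ok L [] \<phi> \<and>
     (\<forall>s x. (s, Inl x) \<in> fvs \<phi> \<longrightarrow> (s, x) \<in> V) \<and>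
     (\<forall>s m. (s, Inr m) \<in> fvs \<phi> \<longrightarrow> m \<in> B \<and> m \<in> carr M s)"
proof -
  have "fvs \<phi> \<subseteq> {(s, Inl v) |s v. (s, v) \<in> V} \<union> {(s, Inr m) |s m. m \<in> B \<inter> carr M s} \<longleftrightarrow>
     (\<forall>s y. (s, y) \<in> fvs \<phi> \<longrightarrow> (\<exists>x. y = Inl x \<and> (s, x) \<in> V) \<or> (\<exists>m. y = Inr m \<and> m \<in> B \<and> m \<in> carr M s))"
    by (simp add: subset_iff Int_iff) 
  also have "\<dots> \<longleftrightarrow> (\<forall>s x. (s, Inl x) \<in> fvs \<phi> \<longrightarrow> (s, x) \<in> V) \<and>
     (\<forall>s m. (s, Inr m) \<in> fvs \<phi> \<longrightarrow> m \<in> B \<and> m \<in> carr M s)"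
    by (simp add: split_sum_all all_conj_distrib)
  finally show ?thesis
    by (simp add: param_fms_def)
qed

lemma small_subset: "small \<kappa> B \<Longrightarrow> A \<subseteq> B \<Longrightarrow> small \<kappa> A"
  unfolding small_def by (meson card_of_mono1 ordLeq_ordLess_trans)

lemma small_image: "small \<kappa> A \<Longrightarrow> small \<kappa> (f ` A)"
  unfolding small_def by (meson card_of_image ordLeq_ordLess_trans)

section \<open>Smallness and the group of automorphisms of a monster model\<close>

locale monster_model =
  fixes L :: "('s, 'f, 'r) lang" and \<kappa> :: "'k rel" and M :: "('s, 'f, 'r, 'a) struct"
  assumes mon: "monster L \<kappa> M"
begin

abbreviation "U \<equiv> univ L M"
abbreviation "G \<equiv> AutG L M"

lemma lok: "lang_ok L" and str: "is_struct L M" and Card_\<kappa>: "Card_order \<kappa>"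
  using mon by (auto simp: monster_def)

lemma infinite_\<kappa>: "\<not> finite (Field \<kappa>)"
proof
  assume "finite (Field \<kappa>)"
  moreover have "\<not> finite (Field natLeq)"
    by (simp add: Field_natLeq)
  ultimately have "(\<kappa>, natLeq) \<in> ordLess"
    using Card_\<kappa> natLeq_Well_order
    by (intro finite_ordLess_infinite) (auto intro: card_order_on_well_order_on)
  moreover have "(natLeq, \<kappa>) \<in> ordLess"
    using mon by (simp add: monster_def)
  ultimately show False
    using ordLess_transitive ordLess_irreflexive by blast
qed

lemma small_finite: "finite A \<Longrightarrow> small \<kappa> A"
  using finite_ordLess_infinite[OF card_of_Well_order card_order_on_well_order_on[OF Card_\<kappa>] _ infinite_\<kappa>, of A]
  by (simp add: small_def Field_card_of)

lemma small_Un: "small \<kappa> A \<Longrightarrow> small \<kappa> B \<Longrightarrow> small \<kappa> (A \<union> B)"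
  unfolding small_def using card_of_Un_ordLess_infinite_Field[OF infinite_\<kappa> Card_\<kappa>] by blast

lemma small_UN: "finite I \<Longrightarrow> (\<And>i. i \<in> I \<Longrightarrow> small \<kappa> (A i)) \<Longrightarrow> small \<kappa> (\<Union>i\<in>I. A i)"
  by (induction I rule: finite_induct) (auto intro: small_Un small_finite)

lemma group_G: "group G"
  unfolding AutG_def
  by (rule subgroup.subgroup_is_group[OF subgroup_Aut[OF lok str] group_BijGroup])

sublocale G: group G
  by (rule group_G)

lemma carrier_G [simp]: "carrier G = Aut L M"
  by (simp add: AutG_def)

lemma mult_closed [simp]: "f \<in> Aut L M \<Longrightarrow> g \<in> Aut L M \<Longrightarrow> f \<otimes>\<^bsub>G\<^esub> g \<in> Aut L M"
  using G.m_closed by simp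

lemma inv_closed [simp]: "f \<in> Aut L M \<Longrightarrow> inv\<^bsub>G\<^esub> f \<in> Aut L M"
  using G.inv_closed by simp

lemma one_closed [simp]: "\<one>\<^bsub>G\<^esub> \<in> Aut L M"
  using G.one_closed by simp

lemma mult_eq: "f \<in> Aut L M \<Longrightarrow> g \<in> Aut L M \<Longrightarrow> f \<otimes>\<^bsub>G\<^esub> g = compose U f g"
  by (simp add: AutG_def BijGroup_def Aut_def)

lemma mult_apply [simp]:
  "f \<in> Aut L M \<Longrightarrow> g \<in> Aut L M \<Longrightarrow> x \<in> U \<Longrightarrow> (f \<otimes>\<^bsub>G\<^esub> g) x = f (g x)"
  by (simp add: mult_eq compose_def)

lemma one_apply [simp]: "x \<in> U \<Longrightarrow> \<one>\<^bsub>G\<^esub> x = x"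
  by (simp add: AutG_def BijGroup_def)

lemma inv_apply_left [simp]: "f \<in> Aut L M \<Longrightarrow> x \<in> U \<Longrightarrow> (inv\<^bsub>G\<^esub> f) (f x) = x"
  using mult_apply[of "inv\<^bsub>G\<^esub> f" f x] by simp

lemma inv_apply_right [simp]: "f \<in> Aut L M \<Longrightarrow> x \<in> U \<Longrightarrow> f ((inv\<^bsub>G\<^esub> f) x) = x"
  using mult_apply[of f "inv\<^bsub>G\<^esub> f" x] by simp

lemma Aut_U [simp]: "f \<in> Aut L M \<Longrightarrow> x \<in> U \<Longrightarrow> f x \<in> U"
  by (rule Aut_univ)

lemma Aut_carr_iff:
  assumes "f \<in> Aut L M" "s \<in> sorts L" "x \<in> U"
  shows "f x \<in> carr M s \<longleftrightarrow> x \<in> carr M s"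
  using Aut_carr[OF assms(1,2)] Aut_carr[OF inv_closed[OF assms(1)] assms(2), of "f x"] assms
  by auto

lemma sort_unique: "s \<in> sorts L \<Longrightarrow> t \<in> sorts L \<Longrightarrow> x \<in> carr M s \<Longrightarrow> x \<in> carr M t \<Longrightarrow> s = t"
  using str by (auto simp: is_struct_def)

lemma okf_refl: "(s, v) \<in> V \<Longrightarrow> varset L V \<Longrightarrow> Eq (FV s v) (FV s v) \<in> okf L V"
  by (force simp: okf_def tm_ok_iff varset_def)

section \<open>Homogeneity and compactness for small tuples\<close>

text \<open>Strong homogeneity speaks of a map on a set of elements, whereas \<open>e\<close> may
  give several variables the same value. The map sends \<open>x\<close> to the
  \<open>e'\<close>-value of a chosen variable with \<open>e\<close>-value \<open>x\<close>;
  equations between variables, preserved by \<open>imp\<close>, show that the choice does not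
  matter. An implication suffices, as it also applies to negations.\<close>

lemma homogeneity:
  assumes V: "varset L V" "small \<kappa> V" and e: "wfa M V e" and e': "wfa M V e'"
    and imp: "\<And>\<phi>. \<phi> \<in> okf L V \<Longrightarrow> sat M e [] \<phi> \<Longrightarrow> sat M e' [] \<phi>"
  shows "\<exists>g\<in>Aut L M. \<forall>(s, v)\<in>V. g (e v) = e' v"
proof -
  have iff: "sat M e [] \<phi> \<longleftrightarrow> sat M e' [] \<phi>" if "\<phi> \<in> okf L V" for \<phi>
    using imp[of \<phi>] imp[of "Neg \<phi>"] that by auto
  have Vs: "s \<in> sorts L" if "(s, v) \<in> V" for s v
    using V(1) that by (force simp: varset_def)
  define A where "A = e ` snd ` V"
  have AU: "A \<subseteq> U"
    using e Vs by (force simp: A_def wfa_def univ_def)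
  define p where "p x = (SOME q. q \<in> V \<and> e (snd q) = x)" for x
  have p: "p x \<in> V" "e (snd (p x)) = x" if "x \<in> A" for x
  proof -
    have "\<exists>q. q \<in> V \<and> e (snd q) = x"
      using that by (force simp: A_def)
    then have "p x \<in> V \<and> e (snd (p x)) = x"
      unfolding p_def by (rule someI_ex)
    then show "p x \<in> V" "e (snd (p x)) = x"
      by auto
  qed
  define f where "f x = e' (snd (p x))" for x
  have p': "fst (p x) \<in> sorts L" "x \<in> carr M (fst (p x))" "f x \<in> carr M (fst (p x))" if "x \<in> A" for x
  proof -
    obtain s v where q: "p x = (s, v)"
      by (cases "p x")
    show "fst (p x) \<in> sorts L"
      using p(1)[OF that] q Vs by auto
    show "x \<in> carr M (fst (p x))" "f x \<in> carr M (fst (p x))"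
      using p[OF that] q e e' by (auto simp: wfa_def f_def)
  qed
  have sorts_eq: "(f x \<in> carr M s) = (s = fst (p x))" "(x \<in> carr M s) = (s = fst (p x))"
    if "x \<in> A" "s \<in> sorts L" for x s
    using p'[OF that(1)] that(2) sort_unique by metis+
  have fU: "f x \<in> U" if "x \<in> A" for x
    using p'[OF that] by (auto simp: univ_def)
  \<comment> \<open>A type over the empty set has no names \<open>Inr\<close>, so their image is
    arbitrary.\<close>
  define \<rho> where "\<rho> = case_sum (\<lambda>x. snd (p x)) (\<lambda>_ :: 'a. undefined)"
  have tp_iff: "\<phi> \<in> tp L M A f {} \<longleftrightarrow> \<phi> \<in> tp L M A (\<lambda>x. x) {}" for \<phi>
  proof -
    have params: "\<phi> \<in> param_fms L M {(s, i). i \<in> A \<and> f i \<in> carr M s} {} \<longleftrightarrow>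
        \<phi> \<in> param_fms L M {(s, i). i \<in> A \<and> i \<in> carr M s} {}"
      using sorts_eq fm_ok_sorts[of L "[]" \<phi>] by (simp add: param_fms_iff) metis
    have "psat M f \<phi> \<longleftrightarrow> psat M (\<lambda>x. x) \<phi>"
      if \<phi>: "\<phi> \<in> param_fms L M {(s, i). i \<in> A \<and> i \<in> carr M s} {}"
    proof -
      have ok: "\<phi> \<in> okf L (fvs \<phi>)"
        using \<phi> by (simp add: param_fms_def okf_def)
      have fv: "\<exists>x. y = Inl x \<and> x \<in> A \<and> s = fst (p x)" if "(s, y) \<in> fvs \<phi>" for s y
      proof -
        have "fm_ok L [] \<phi>"
          using \<phi> by (simp add: param_fms_iff)
        then have "s \<in> sorts L"
          using that by (rule fm_ok_sorts)
        then show ?thesis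
          using \<phi> that sorts_eq(2) by (cases y) (auto simp: param_fms_iff)
      qed
      have "map_prod id \<rho> ` fvs \<phi> \<subseteq> V"
      proof (rule image_subsetI)
        fix q assume "q \<in> fvs \<phi>"
        then obtain x where "snd q = Inl x" "x \<in> A" "fst q = fst (p x)"
          using fv[of "fst q" "snd q"] by auto
        then show "map_prod id \<rho> q \<in> V"
          using p(1)[of x] by (cases q) (simp add: \<rho>_def)
      qed
      then have "fm_rename \<rho> \<phi> \<in> okf L V"
        by (rule rename_okf[OF ok])
      then have "sat M (e \<circ> \<rho>) [] \<phi> \<longleftrightarrow> sat M (e' \<circ> \<rho>) [] \<phi>"
        using iff sat_rename[OF ok] by metis
      moreover have "sat M (e \<circ> \<rho>) [] \<phi> \<longleftrightarrow> psat M (\<lambda>x. x) \<phi>"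
      proof -
        have "(e \<circ> \<rho>) y = case_sum (\<lambda>x. x) (\<lambda>m. m) y" if "(s, y) \<in> fvs \<phi>" for s y
          using fv[OF that] p by (auto simp: \<rho>_def)
        then show ?thesis
          unfolding psat_def by (rule sat_cong)
      qed
      moreover have "sat M (e' \<circ> \<rho>) [] \<phi> \<longleftrightarrow> psat M f \<phi>"
      proof -
        have "(e' \<circ> \<rho>) y = case_sum f (\<lambda>m. m) y" if "(s, y) \<in> fvs \<phi>" for s y
          using fv[OF that] by (auto simp: \<rho>_def f_def)
        then show ?thesis
          unfolding psat_def by (rule sat_cong)
      qed
      ultimately show ?thesis
        by simp
    qed
    with params show ?thesis
      by (auto simp: tp_def)
  qed
  have "small \<kappa> A"
    unfolding A_def by (intro small_image V)
  moreover have "f \<in> A \<rightarrow> U"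
    using fU by auto
  moreover have "tp L M A f {} = tp L M A (\<lambda>x. x) {}"
    using tp_iff by blast
  ultimately obtain g where g: "g \<in> Aut L M" "\<forall>x\<in>A. g x = f x"
    using mon AU unfolding monster_def strongly_homogeneous_def by blast
  have "g (e v) = e' v" if sv: "(s, v) \<in> V" for s v
  proof -
    have A: "e v \<in> A"
      using sv by (force simp: A_def)
    obtain s' v' where q: "p (e v) = (s', v')"
      by (cases "p (e v)")
    have v': "(s', v') \<in> V" "e v' = e v"
      using p[OF A] q by auto
    have "s' = s"
    proof (rule sort_unique)
      show "s' \<in> sorts L" "s \<in> sorts L"
        using v' sv Vs by auto
      show "e v \<in> carr M s'" "e v \<in> carr M s"
        using v' sv e by (force simp: wfa_def)+
    qed
    then have "Eq (FV s v) (FV s v') \<in> okf L V"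
      using v' sv Vs by (auto simp: okf_def tm_ok_iff)
    then have "e' v = e' v'"
      using imp v' by fastforce
    then show ?thesis
      using g A q by (simp add: f_def)
  qed
  then show ?thesis
    using g(1) by auto
qed


text \<open>The variables of \<open>\<phi>\<close> left unassigned by \<open>H\<close>, other than
  \<open>v\<close>, are quantified away; those assigned by \<open>H\<close> become parameters from
  \<open>A\<close>, and \<open>v\<close> becomes the only variable. So the possible values of
  \<open>v\<close> form a set to which saturation in one variable applies. The assignment
  \<open>e1\<close> witnesses that the values prescribed by \<open>H\<close> have the right sorts
  and do not conflict.\<close>

lemma extension_definable:
  assumes V: "varset L V" "(s, v) \<in> V" and \<phi>: "\<phi> \<in> okf L V"
    and H: "finite H" "fst ` H \<subseteq> V" "(s, v) \<notin> fst ` H" "snd ` H \<subseteq> A"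
    and e1: "wfa M V e1" "\<And>s v x. ((s, v), x) \<in> H \<Longrightarrow> e1 v = x"
  shows "\<exists>\<eta>\<in>param_fms L M {(s, ())} A. \<forall>x\<in>carr M s. x \<in> solutions M s \<eta> \<longleftrightarrow>
    (\<exists>e. wfa M V e \<and> e v = x \<and> (\<forall>((s, w), y)\<in>H. e w = y) \<and> sat M e [] \<phi>)"
proof -
  define F where "F = fvs \<phi> - fst ` H - {(s, v)}"
  have uniq: "t = t'" if "(t, w) \<in> V" "(t', w) \<in> V" for t t' w
    using V(1) that by (force simp: varset_def inj_on_def)
  have \<phi>': "\<phi> \<in> okf L (fvs \<phi>)" "varset L (fvs \<phi>)" "fvs \<phi> \<subseteq> V"
    using \<phi> V(1) by (auto simp: okf_def varset_def inj_on_def)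
  have "finite F" "F \<subseteq> fvs \<phi>"
    by (auto simp: F_def finite_fvs)
  from ex_closure[OF this \<phi>'(1,2), of M] obtain \<psi> where \<psi>: "\<psi> \<in> okf L (fvs \<phi> - F)"
    and sat_\<psi>: "\<And>e. sat M e [] \<psi> \<longleftrightarrow>
      (\<exists>e'. (\<forall>w. w \<notin> snd ` F \<longrightarrow> e' w = e w) \<and> wfa M F e' \<and> sat M e' [] \<phi>)"
    by (elim bexE) (rule that, auto)
  define \<rho> where "\<rho> w = (if w = v then Inl () else Inr (e1 w))" for w
  define \<eta> where "\<eta> = fm_rename \<rho> \<psi>"
  have fvs_\<psi>: "(t, w) = (s, v) \<or> (w \<noteq> v \<and> ((t, w), e1 w) \<in> H)" if "(t, w) \<in> fvs \<psi>" for t w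
  proof (cases "(t, w) = (s, v)")
    case False
    then have "(t, w) \<in> fst ` H" "(t, w) \<in> V"
      using that \<psi> \<phi>'(3) by (auto simp: okf_def F_def)
    moreover from this obtain y where "((t, w), y) \<in> H"
      by force
    ultimately show ?thesis
      using e1(2)[of t w y] uniq[of t w s] V(2) False by auto
  qed simp
  have "\<eta> \<in> param_fms L M {(s, ())} A"
  proof -
    have "map_prod id \<rho> ` fvs \<psi> \<subseteq> {(s, Inl ())} \<union> {(t, Inr y) |t y. y \<in> A \<and> y \<in> carr M t}"
    proof (rule image_subsetI)
      fix q assume "q \<in> fvs \<psi>"
      then consider "q = (s, v)" | "snd q \<noteq> v" "(q, e1 (snd q)) \<in> H"
        using fvs_\<psi>[of "fst q" "snd q"] by auto
      then show "map_prod id \<rho> q \<in> {(s, Inl ())} \<union> {(t, Inr y) |t y. y \<in> A \<and> y \<in> carr M t}"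
      proof cases
        case 1
        then show ?thesis
          by (simp add: \<rho>_def)
      next
        case 2
        have "e1 (snd q) \<in> A" "q \<in> V"
          using 2(2) H(2,4) by force+
        then show ?thesis
          using e1(1) 2(1) by (auto simp: \<rho>_def wfa_def map_prod_def)
      qed
    qed
    then have "\<eta> \<in> okf L ({(s, Inl ())} \<union> {(t, Inr y) |t y. y \<in> A \<and> y \<in> carr M t})"
      unfolding \<eta>_def using \<psi> by (intro rename_okf[where V = "fvs \<psi>"]) (auto simp: okf_def)
    then show ?thesis
      by (auto simp: param_fms_def okf_def)
  qed
  moreover have "x \<in> solutions M s \<eta> \<longleftrightarrow>
    (\<exists>e. wfa M V e \<and> e v = x \<and> (\<forall>((s, w), y)\<in>H. e w = y) \<and> sat M e [] \<phi>)"
    if x: "x \<in> carr M s" for x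
  proof -
    have "x \<in> solutions M s \<eta> \<longleftrightarrow> sat M (case_sum (\<lambda>_. x) (\<lambda>m. m) \<circ> \<rho>) [] \<psi>"
      using x sat_rename[OF \<psi>] by (simp add: solutions_def psat_def \<eta>_def)
    also have "case_sum (\<lambda>_. x) (\<lambda>m. m) \<circ> \<rho> = e1(v := x)"
      by (auto simp: \<rho>_def)
    finally have sol: "x \<in> solutions M s \<eta> \<longleftrightarrow> sat M (e1(v := x)) [] \<psi>" .
    have F: "q \<in> V" "q \<noteq> (s, v)" "q \<notin> fst ` H" if "q \<in> F" for q
      using that \<phi>'(3) by (auto simp: F_def)
    have vF: "v \<notin> snd ` F"
    proof
      assume "v \<in> snd ` F"
      then obtain t where "(t, v) \<in> F"
        by auto
      then show False
        using F[of "(t, v)"] uniq[OF _ V(2)] by auto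
    qed
    have HF: "w \<notin> snd ` F \<and> w \<noteq> v" if "((t, w), y) \<in> H" for t w y
    proof -
      have tw: "(t, w) \<in> fst ` H" "(t, w) \<in> V"
        using that H(2) by force+
      have "w \<notin> snd ` F"
      proof
        assume "w \<in> snd ` F"
        then obtain t' where "(t', w) \<in> F"
          by auto
        then show False
          using F[of "(t', w)"] uniq[OF _ tw(2)] tw(1) by auto
      qed
      moreover have "w \<noteq> v"
        using uniq[of t w s] tw V(2) H(3) by auto
      ultimately show ?thesis
        by simp
    qed
    show ?thesis
      unfolding sol
    proof
      assume "sat M (e1(v := x)) [] \<psi>"
      then obtain e' where e': "\<forall>w. w \<notin> snd ` F \<longrightarrow> e' w = (e1(v := x)) w" "wfa M F e'" "sat M e' [] \<phi>"
        using sat_\<psi> by blast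
      have "e' w \<in> carr M t" if tw: "(t, w) \<in> V" for t w
      proof (cases "w \<in> snd ` F")
        case True
        then obtain t' where "(t', w) \<in> F"
          by auto
        then show ?thesis
          using e'(2) uniq[OF tw, of t'] \<phi>'(3) by (auto simp: wfa_def F_def)
      next
        case False
        then show ?thesis
          using e'(1) e1(1) x uniq[OF tw, of s] V(2) tw by (auto simp: wfa_def)
      qed
      moreover have "e' w = y" if "((t, w), y) \<in> H" for t w y
        using HF[OF that] e'(1) e1(2)[OF that] by simp
      ultimately show "\<exists>e. wfa M V e \<and> e v = x \<and> (\<forall>((s, w), y)\<in>H. e w = y) \<and> sat M e [] \<phi>"
        using e' vF by (intro exI[of _ e']) (auto simp: wfa_def)
    next
      assume "\<exists>e. wfa M V e \<and> e v = x \<and> (\<forall>((s, w), y)\<in>H. e w = y) \<and> sat M e [] \<phi>"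
      then obtain e where e: "wfa M V e" "e v = x" "\<forall>((s, w), y)\<in>H. e w = y" "sat M e [] \<phi>"
        by blast
      define e' where "e' w = (if w \<in> snd ` F then e w else (e1(v := x)) w)" for w
      have "e' w = e w" if "(t, w) \<in> fvs \<phi>" for t w
      proof (cases "(t, w) \<in> F")
        case True
        then have "w \<in> snd ` F"
          by force
        then show ?thesis
          by (simp add: e'_def)
      next
        case False
        then have "(t, w) = (s, v) \<or> (t, w) \<in> fst ` H"
          using that unfolding F_def by blast
        then consider "w = v" | y where "((t, w), y) \<in> H"
          by auto
        then show ?thesis
        proof cases
          case 1
          then show ?thesis
            using e(2) vF by (simp add: e'_def)
        next
          case 2
          then show ?thesis
            using HF[OF 2] e(3) e1(2)[OF 2] by (auto simp: e'_def)
        qed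
      qed
      then have "sat M e' [] \<phi>"
        using e(4) sat_cong[of \<phi> e' e] by blast
      moreover have "e' w \<in> carr M t" if "(t, w) \<in> F" for t w
      proof -
        have "w \<in> snd ` F"
          using that by force
        then show ?thesis
          using e(1) F(1)[OF that] by (auto simp: wfa_def e'_def)
      qed
      then have "wfa M F e'"
        by (auto simp: wfa_def)
      ultimately show "sat M (e1(v := x)) [] \<psi>"
        unfolding sat_\<psi> by (intro exI[of _ e']) (auto simp: e'_def)
    qed
  qed
  ultimately show ?thesis
    by blast
qed

text \<open>The filter plays the role of a finitely satisfiable type: the
  conclusion realizes all formulas which hold eventually. By Zorn's lemma, a maximal set \<open>H\<close> of assignments of
  single variables, every finite part of which is compatible with each eventually true formula,
  assigns a value to every variable.\<close>

lemma compactness: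
  fixes E :: "'t \<Rightarrow> 'v \<Rightarrow> 'a" and F :: "'t filter"
  assumes V: "varset L V" "small \<kappa> V" and F: "F \<noteq> bot" and E: "\<And>t. wfa M V (E t)"
    and D: "D \<subseteq> V" "\<And>s v t. (s, v) \<in> D \<Longrightarrow> E t v = c v"
  obtains e where "wfa M V e" "\<And>s v. (s, v) \<in> D \<Longrightarrow> e v = c v"
    "\<And>\<phi>. \<phi> \<in> okf L V \<Longrightarrow> (\<forall>\<^sub>F t in F. sat M (E t) [] \<phi>) \<Longrightarrow> sat M e [] \<phi>"
proof -
  define ev where "ev \<phi> \<longleftrightarrow> \<phi> \<in> okf L V \<and> (\<forall>\<^sub>F t in F. sat M (E t) [] \<phi>)" for \<phi>
  define fits where "fits H e \<longleftrightarrow> (\<forall>((s, w), y)\<in>H. e w = y)"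
    for H :: "(('s \<times> 'v) \<times> 'a) set" and e
  define good where "good H \<longleftrightarrow>
    (\<forall>\<phi> H0. ev \<phi> \<longrightarrow> finite H0 \<longrightarrow> H0 \<subseteq> H \<longrightarrow> (\<exists>e. wfa M V e \<and> fits H0 e \<and> sat M e [] \<phi>))" for H
  define C where "C = (\<lambda>(s, v). ((s, v), c v)) ` D"
  have ev_refl: "ev (Eq (FV s v) (FV s v))" if "(s, v) \<in> V" for s v
    using okf_refl[OF that V(1)] by (simp add: ev_def)
  have uniq: "t = t'" if "(t, w) \<in> V" "(t', w) \<in> V" for t t' w
    using V(1) that by (force simp: varset_def inj_on_def)
  have good_C: "good C"
    unfolding good_def
  proof (intro allI impI)
    fix \<phi> H0 assume "ev \<phi>" "H0 \<subseteq> C"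
    then obtain t where "sat M (E t) [] \<phi>"
      using F eventually_happens' unfolding ev_def by blast
    moreover have "fits H0 (E t)"
      using D(2) \<open>H0 \<subseteq> C\<close> unfolding fits_def C_def by fastforce
    ultimately show "\<exists>e. wfa M V e \<and> fits H0 e \<and> sat M e [] \<phi>"
      using E by blast
  qed
  \<comment> \<open>\<open>C\<close> is added to every member instead of being required in it, so
    that the empty set belongs to \<open>\<A>\<close> and the empty chain has its union
    there.\<close>
  define \<A> where "\<A> = {H. H \<subseteq> V \<times> UNIV \<and> good (C \<union> H)}"
  have chain: "\<Union>\<C> \<in> \<A>" if \<C>: "subset.chain \<A> \<C>" for \<C>
  proof (cases "\<C> = {}")
    case True
    then show ?thesis
      using good_C by (simp add: \<A>_def)
  next
    case False
    have sub: "\<C> \<subseteq> \<A>"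
      using \<C> by (simp add: subset.chain_def)
    have "good (C \<union> \<Union>\<C>)"
      unfolding good_def
    proof (intro allI impI)
      fix \<phi> H0 assume *: "ev \<phi>" "finite H0" "H0 \<subseteq> C \<union> \<Union>\<C>"
      then have "finite (H0 - C)" "H0 - C \<subseteq> \<Union>\<C>"
        by auto
      then obtain H where "H \<in> \<C>" "H0 - C \<subseteq> H"
        using finite_subset_Union_chain[OF _ _ False \<C>] by blast
      then have "good (C \<union> H)" "H0 \<subseteq> C \<union> H"
        using sub by (auto simp: \<A>_def)
      then show "\<exists>e. wfa M V e \<and> fits H0 e \<and> sat M e [] \<phi>"
        using * unfolding good_def by blast
    qed
    then show ?thesis
      using sub by (auto simp: \<A>_def)
  qed
  obtain H' where H': "H' \<in> \<A>" "\<And>X. X \<in> \<A> \<Longrightarrow> H' \<subseteq> X \<Longrightarrow> X = H'"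
    using subset_Zorn'[of \<A>] chain by metis
  define H where "H = C \<union> H'"
  have H: "good H" "H \<subseteq> V \<times> UNIV"
    using H'(1) D(1) by (auto simp: H_def \<A>_def C_def)
  have H_max: "q \<in> H" if "good (insert q H)" "fst q \<in> V" for q
  proof -
    have "insert q H' \<in> \<A>"
      using that H'(1) by (cases q) (auto simp: \<A>_def H_def)
    then show ?thesis
      using H'(2)[of "insert q H'"] by (auto simp: H_def)
  qed
  have H_fun: "x = y \<and> x \<in> carr M s" if "((s, v), x) \<in> H" "((s, v), y) \<in> H" for s v x y
  proof -
    have sv: "(s, v) \<in> V"
      using that H(2) by auto
    \<comment> \<open>A trivial equation serves as the formula when only the compatibility of the
      two values is asked for.\<close>
    have "\<exists>e. wfa M V e \<and> fits {((s, v), x), ((s, v), y)} e \<and> sat M e [] (Eq (FV s v) (FV s v))"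
      using H(1) that ev_refl[OF sv] unfolding good_def by (metis empty_subsetI finite.emptyI finite_insert insert_subset)
    then show ?thesis
      using sv by (auto simp: fits_def wfa_def)
  qed
  have total: "\<exists>x. ((s, v), x) \<in> H" if sv: "(s, v) \<in> V" for s v
  proof (rule ccontr)
    assume no: "\<nexists>x. ((s, v), x) \<in> H"
    define A where "A = snd ` H"
    have s: "s \<in> sorts L"
      using sv V(1) by (force simp: varset_def)
    have AU: "A \<subseteq> U"
    proof
      fix x assume "x \<in> A"
      then obtain t w where tw: "((t, w), x) \<in> H"
        by (auto simp: A_def)
      then have "x \<in> carr M t" "t \<in> sorts L"
        using H_fun[OF tw tw] H(2) V(1) by (force simp: varset_def)+
      then show "x \<in> U"
        by (rule carr_univ[rotated])
    qed
    have "A \<subseteq> (\<lambda>p. SOME x. (p, x) \<in> H) ` V"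
    proof
      fix x assume "x \<in> A"
      then obtain t w where tw: "((t, w), x) \<in> H"
        by (auto simp: A_def)
      then have "(SOME x. ((t, w), x) \<in> H) = x"
        using H_fun by (intro some_equality) auto
      moreover have "(t, w) \<in> V"
        using tw H(2) by auto
      ultimately show "x \<in> (\<lambda>p. SOME x. (p, x) \<in> H) ` V"
        by force
    qed
    then have A: "small \<kappa> A"
      by (rule small_subset[OF small_image[OF V(2)]])
    define P where "P \<phi> H0 x \<longleftrightarrow> (\<exists>e. wfa M V e \<and> e v = x \<and> fits H0 e \<and> sat M e [] \<phi>)" for \<phi> H0 x
    define R where "R \<eta> \<phi> H0 \<longleftrightarrow> ev \<phi> \<and> finite H0 \<and> H0 \<subseteq> H \<and>
      (\<forall>x\<in>carr M s. x \<in> solutions M s \<eta> \<longleftrightarrow> P \<phi> H0 x)" for \<eta> \<phi> H0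
    \<comment> \<open>Each member of \<open>\<Sigma>\<close> defines the values of \<open>v\<close>
      allowed by one eventually true formula and one finite part of \<open>H\<close>. Goodness of
      \<open>H\<close> makes \<open>\<Sigma>\<close> finitely satisfiable, and a realization can be
      added to \<open>H\<close> as the value of \<open>v\<close>.\<close>
    define \<Sigma> where "\<Sigma> = {\<eta> \<in> param_fms L M {(s, ())} A. \<exists>\<phi> H0. R \<eta> \<phi> H0}"
    have fin: "\<exists>x\<in>carr M s. \<forall>\<eta>\<in>\<Sigma>0. x \<in> solutions M s \<eta>" if \<Sigma>0: "\<Sigma>0 \<subseteq> \<Sigma>" "finite \<Sigma>0" for \<Sigma>0
    proof -
      have "\<forall>\<eta>\<in>\<Sigma>0. \<exists>q. R \<eta> (fst q) (snd q)"
        using \<Sigma>0 by (force simp: \<Sigma>_def)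
      then obtain q where q: "\<And>\<eta>. \<eta> \<in> \<Sigma>0 \<Longrightarrow> R \<eta> (fst (q \<eta>)) (snd (q \<eta>))"
        by metis
      define \<Phi> where "\<Phi> = (\<lambda>\<eta>. fst (q \<eta>)) ` \<Sigma>0"
      define H0 where "H0 = (\<Union>\<eta>\<in>\<Sigma>0. snd (q \<eta>))"
      have \<Phi>: "finite \<Phi>" "\<Phi> \<subseteq> okf L V" "\<And>\<phi>. \<phi> \<in> \<Phi> \<Longrightarrow> \<forall>\<^sub>F t in F. sat M (E t) [] \<phi>"
        using q \<Sigma>0(2) by (auto simp: \<Phi>_def R_def ev_def)
      obtain \<phi> where \<phi>: "\<phi> \<in> okf L V" "\<And>e. sat M e [] \<phi> \<longleftrightarrow> (\<forall>\<delta>\<in>\<Phi>. sat M e [] \<delta>)"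
        using finite_conj[OF \<Phi>(1,2) okf_refl[OF sv V(1)], of M] by metis
      have "\<forall>\<^sub>F t in F. \<forall>\<delta>\<in>\<Phi>. sat M (E t) [] \<delta>"
        using \<Phi> by (intro eventually_ball_finite) auto
      then have "ev \<phi>"
        using \<phi> by (simp add: ev_def)
      moreover have "finite H0" "H0 \<subseteq> H"
        using q \<Sigma>0(2) by (auto simp: H0_def R_def)
      ultimately obtain e where e: "wfa M V e" "fits H0 e" "sat M e [] \<phi>"
        using H(1) unfolding good_def by blast
      have ec: "e v \<in> carr M s"
        using e(1) sv by (auto simp: wfa_def)
      have "e v \<in> solutions M s \<eta>" if \<eta>: "\<eta> \<in> \<Sigma>0" for \<eta>
      proof -
        have "fits (snd (q \<eta>)) e" "sat M e [] (fst (q \<eta>))"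
          using e \<phi>(2) \<eta> by (auto simp: fits_def H0_def \<Phi>_def)
        then have "P (fst (q \<eta>)) (snd (q \<eta>)) (e v)"
          using e(1) by (auto simp: P_def)
        then show ?thesis
          using q[OF \<eta>] ec by (auto simp: R_def)
      qed
      then show ?thesis
        using ec by blast
    qed
    have "\<Sigma> \<subseteq> param_fms L M {(s, ())} A"
      by (auto simp: \<Sigma>_def)
    moreover have "saturated L \<kappa> M"
      using mon by (simp add: monster_def)
    ultimately have "\<exists>x\<in>carr M s. \<forall>\<eta>\<in>\<Sigma>. x \<in> solutions M s \<eta>"
      using AU A s fin unfolding saturated_def by (elim allE[of _ A] allE[of _ s] allE[of _ \<Sigma>] mp) simp
    then obtain x where x: "x \<in> carr M s" "\<forall>\<eta>\<in>\<Sigma>. x \<in> solutions M s \<eta>"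
      by blast
    have "good (insert ((s, v), x) H)"
      unfolding good_def
    proof (intro allI impI)
      fix \<phi> H0 assume *: "ev \<phi>" "finite H0" "H0 \<subseteq> insert ((s, v), x) H"
      define H1 where "H1 = H0 - {((s, v), x)}"
      have H1: "finite H1" "H1 \<subseteq> H"
        using * by (auto simp: H1_def)
      obtain e1 where e1: "wfa M V e1" "fits H1 e1" "sat M e1 [] \<phi>"
        using H(1) * H1 unfolding good_def by blast
      have "\<exists>\<eta>\<in>param_fms L M {(s, ())} A. \<forall>x\<in>carr M s. x \<in> solutions M s \<eta> \<longleftrightarrow>
         (\<exists>e. wfa M V e \<and> e v = x \<and> (\<forall>((s, w), y)\<in>H1. e w = y) \<and> sat M e [] \<phi>)"
      proof (rule extension_definable[OF V(1) sv _ H1(1) _ _ _ e1(1)])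
        show "\<phi> \<in> okf L V"
          using * by (simp add: ev_def)
        show "fst ` H1 \<subseteq> V" "(s, v) \<notin> fst ` H1" "snd ` H1 \<subseteq> A"
          using H1 H(2) no by (auto simp: A_def)
        show "e1 v = x" if "((s, v), x) \<in> H1" for s v x
          using e1(2) that by (auto simp: fits_def)
      qed
      then obtain \<eta> where \<eta>: "\<eta> \<in> param_fms L M {(s, ())} A"
        "\<forall>x\<in>carr M s. x \<in> solutions M s \<eta> \<longleftrightarrow> P \<phi> H1 x"
        unfolding P_def fits_def by blast
      then have "\<eta> \<in> \<Sigma>"
        using * H1 by (auto simp: \<Sigma>_def R_def)
      then have "P \<phi> H1 x"
        using x \<eta> by blast
      then obtain e where "wfa M V e" "e v = x" "fits H1 e" "sat M e [] \<phi>"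
        unfolding P_def by metis
      moreover have "fits H0 e"
      proof -
        have "fits (insert ((s, v), x) H1) e"
          using \<open>e v = x\<close> \<open>fits H1 e\<close> by (simp add: fits_def)
        moreover have "H0 \<subseteq> insert ((s, v), x) H1"
          by (auto simp: H1_def)
        ultimately show ?thesis
          unfolding fits_def by (meson subsetD)
      qed
      ultimately show "\<exists>e. wfa M V e \<and> fits H0 e \<and> sat M e [] \<phi>"
        by blast
    qed
    then show False
      using H_max[of "((s, v), x)"] sv no by auto
  qed
  define e where "e v = (SOME x. \<exists>s. ((s, v), x) \<in> H)" for v
  have e: "((s, v), e v) \<in> H" if "(s, v) \<in> V" for s v
  proof -
    have "\<exists>x s. ((s, v), x) \<in> H"
      using total[OF that] by blast
    then have "\<exists>s. ((s, v), e v) \<in> H"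
      unfolding e_def by (rule someI_ex)
    then obtain s' where "((s', v), e v) \<in> H"
      by blast
    then show ?thesis
      using uniq[OF that, of s'] H(2) by auto
  qed
  show thesis
  proof (rule that)
    show "wfa M V e"
      using e H_fun by (force simp: wfa_def)
    show "e v = c v" if "(s, v) \<in> D" for s v
    proof -
      have "((s, v), c v) \<in> H"
        using that by (force simp: H_def C_def)
      then show ?thesis
        using e[of s v] H_fun[of s v "e v" "c v"] D(1) that by auto
    qed
    show "sat M e [] \<phi>" if \<phi>: "\<phi> \<in> okf L V" "\<forall>\<^sub>F t in F. sat M (E t) [] \<phi>" for \<phi>
    proof -
      \<comment> \<open>The part of \<open>e\<close> on the finitely many free variables of
        \<open>\<phi>\<close> decides \<open>\<phi>\<close>, and goodness applies to it.\<close>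
      define H0 where "H0 = (\<lambda>(s, v). ((s, v), e v)) ` fvs \<phi>"
      have "finite H0" "H0 \<subseteq> H"
        using e \<phi> finite_fvs by (auto simp: H0_def okf_def)
      then obtain e' where e': "fits H0 e'" "sat M e' [] \<phi>"
        using H(1) \<phi> unfolding good_def ev_def by blast
      have "e' v = e v" if "(s, v) \<in> fvs \<phi>" for s v
        using e'(1) that by (force simp: fits_def H0_def)
      then show ?thesis
        using e'(2) sat_cong[of \<phi> e' e] by blast
    qed
  qed
qed

end

section \<open>The Lascar group\<close>

declare one_FactGroup [simp del] mult_FactGroup [simp del]

text \<open>The reference valuation \<open>val\<close> only assigns sorts: a name gets the sort of
  its reference value, which is unique in a structure with disjoint carriers. Automorphic images of
  the reference values keep these sorts, so the same variables serve for all of them.\<close>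

definition nvars ::
  "('s, 'f, 'r) lang \<Rightarrow> ('s, 'f, 'r, 'a) struct \<Rightarrow> 'v set \<Rightarrow> ('v \<Rightarrow> 'a) \<Rightarrow> ('s \<times> 'v) set" where
  "nvars L M N val = {(s, v). s \<in> sorts L \<and> v \<in> N \<and> val v \<in> carr M s}"

lemma nvars_rename:
  assumes "\<phi> \<in> okf L (nvars L M N val)" "\<And>v. v \<in> N \<Longrightarrow> \<rho> v \<in> N' \<and> val' (\<rho> v) = val v"
  shows "fm_rename \<rho> \<phi> \<in> okf L (nvars L M N' val')"
  by (rule rename_okf[OF assms(1)]) (use assms(2) in \<open>auto simp: nvars_def\<close>)

context monster_model
begin

lemma varset_nvars: "varset L (nvars L M N val)"
  using sort_unique by (auto simp: varset_def nvars_def inj_on_def)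

lemma small_nvars:
  assumes "small \<kappa> N"
  shows "small \<kappa> (nvars L M N val)"
proof -
  let ?V = "nvars L M N val"
  have "?V = inv_into ?V snd ` (snd ` ?V)"
    using varset_nvars[of N val] by (simp add: varset_def image_image)
  moreover have "small \<kappa> (snd ` ?V)"
    by (rule small_subset[OF assms]) (auto simp: nvars_def)
  ultimately show ?thesis
    using small_image by metis
qed

lemma wfa_nvars:
  assumes "\<And>v. v \<in> N \<Longrightarrow> \<exists>g\<in>Aut L M. e v = g (val v)"
  shows "wfa M (nvars L M N val) e"
proof -
  have "e v \<in> carr M s" if "s \<in> sorts L" "v \<in> N" "val v \<in> carr M s" for s v
    using assms[OF that(2)] that Aut_carr by metis
  then show ?thesis
    by (auto simp: wfa_def nvars_def)
qed

text \<open>Every name carries some sort, since its reference value lies in the universe; the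
  conclusion can therefore speak of names alone.\<close>

lemma homogeneity_nvars:
  assumes N: "small \<kappa> N" "\<And>v. v \<in> N \<Longrightarrow> val v \<in> U"
    and e: "wfa M (nvars L M N val) e" "wfa M (nvars L M N val) e'"
    and imp: "\<And>\<phi>. \<phi> \<in> okf L (nvars L M N val) \<Longrightarrow> sat M e [] \<phi> \<Longrightarrow> sat M e' [] \<phi>"
  obtains g where "g \<in> Aut L M" "\<And>v. v \<in> N \<Longrightarrow> g (e v) = e' v"
proof -
  obtain g where g: "g \<in> Aut L M" "\<And>s v. (s, v) \<in> nvars L M N val \<Longrightarrow> g (e v) = e' v"
    using homogeneity[OF varset_nvars small_nvars[OF N(1)] e imp] by auto
  have "g (e v) = e' v" if v: "v \<in> N" for v
  proof -
    obtain s where "s \<in> sorts L" "val v \<in> carr M s"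
      using N(2)[OF v] by (auto simp: univ_def)
    then show ?thesis
      using g(2)[of s v] v by (simp add: nvars_def)
  qed
  then show thesis
    using g(1) that by blast
qed

section \<open>The subgroup \<open>Autf\<close> and its cosets\<close>

lemma Autf_normal: "Autf L \<kappa> M \<lhd> G"
proof -
  let ?S = "{H. H \<lhd> G \<and>
    {f \<in> Aut L M. \<exists>X. elem_submodel L M X \<and> small \<kappa> X \<and> (\<forall>x\<in>X. f x = x)} \<subseteq> H}"
  have "carrier G \<lhd> G"
    by (rule G.normal_invI[OF G.subgroup_self]) (auto simp del: carrier_G)
  then have "carrier G \<in> ?S"
    by auto
  then have "subgroup (\<Inter>?S) G"
    by (intro G.subgroups_Inter) (auto dest: normal_imp_subgroup)
  then have "\<Inter>?S \<lhd> G"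
  proof (rule G.normal_invI)
    fix x h assume x: "x \<in> carrier G" and h: "h \<in> \<Inter>?S"
    have "x \<otimes>\<^bsub>G\<^esub> h \<otimes>\<^bsub>G\<^esub> inv\<^bsub>G\<^esub> x \<in> H" if "H \<in> ?S" for H
    proof (rule G.normal_invE(2))
      show "H \<lhd> G" "h \<in> H"
        using that h by auto
    qed (rule x)
    then show "x \<otimes>\<^bsub>G\<^esub> h \<otimes>\<^bsub>G\<^esub> inv\<^bsub>G\<^esub> x \<in> \<Inter>?S"
      by blast
  qed
  then show ?thesis
    by (simp add: Autf_def)
qed

sublocale Autf: normal "Autf L \<kappa> M" G
  by (rule Autf_normal)

lemma Autf_Aut: "f \<in> Autf L \<kappa> M \<Longrightarrow> f \<in> Aut L M"
  using Autf.subset by auto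

lemma Autf_fixing:
  assumes "f \<in> Aut L M" "elem_submodel L M X" "small \<kappa> X" "\<And>x. x \<in> X \<Longrightarrow> f x = x"
  shows "f \<in> Autf L \<kappa> M"
  using assms unfolding Autf_def by blast

abbreviation "Q \<equiv> G Mod Autf L \<kappa> M"

definition cls :: "('a \<Rightarrow> 'a) \<Rightarrow> ('a \<Rightarrow> 'a) set" where
  "cls f = Autf L \<kappa> M #>\<^bsub>G\<^esub> f"

sublocale Q: group Q
  by (rule Autf.factorgroup_is_group)

sublocale cls: group_hom G Q cls
  unfolding cls_def by unfold_locales (rule Autf.r_coset_hom_Mod)

lemma cls_closed [simp]: "f \<in> Aut L M \<Longrightarrow> cls f \<in> carrier Q"
  using cls.hom_closed by simp

lemma cls_mult [simp]: "f \<in> Aut L M \<Longrightarrow> g \<in> Aut L M \<Longrightarrow> cls (f \<otimes>\<^bsub>G\<^esub> g) = cls f \<otimes>\<^bsub>Q\<^esub> cls g"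
  using cls.hom_mult by simp

lemma cls_inv [simp]: "f \<in> Aut L M \<Longrightarrow> cls (inv\<^bsub>G\<^esub> f) = inv\<^bsub>Q\<^esub> cls f"
  using cls.hom_inv by simp

lemma cls_one_iff: "f \<in> Aut L M \<Longrightarrow> cls f = \<one>\<^bsub>Q\<^esub> \<longleftrightarrow> f \<in> Autf L \<kappa> M"
proof -
  assume "f \<in> Aut L M"
  moreover have "\<one>\<^bsub>Q\<^esub> = Autf L \<kappa> M"
    by (simp add: FactGroup_def)
  ultimately show ?thesis
    unfolding cls_def
    using G.coset_join1[OF _ _ Autf.subgroup_axioms] G.coset_join2[OF _ Autf.subgroup_axioms] by auto
qed

lemma cls_eq_iff: "f \<in> Aut L M \<Longrightarrow> g \<in> Aut L M \<Longrightarrow> cls f = cls g \<longleftrightarrow> inv\<^bsub>G\<^esub> f \<otimes>\<^bsub>G\<^esub> g \<in> Autf L \<kappa> M"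
  using cls_one_iff[of "inv\<^bsub>G\<^esub> f \<otimes>\<^bsub>G\<^esub> g"] Q.inv_solve_left[of "\<one>\<^bsub>Q\<^esub>" "cls f" "cls g"]
  by (simp del: one_FactGroup mult_FactGroup) metis

text \<open>The inverse of \<open>f\<close> times \<open>g\<close> fixes \<open>X\<close> pointwise
  and so lies in \<open>Autf\<close>. This is why a limit of automorphisms, though known only on a
  small set, has a definite class once that set contains a small elementary submodel.\<close>

lemma cls_eqI:
  assumes "elem_submodel L M X" "small \<kappa> X" "f \<in> Aut L M" "g \<in> Aut L M" "\<And>x. x \<in> X \<Longrightarrow> f x = g x"
  shows "cls f = cls g"
proof -
  have "X \<subseteq> U"
    using assms(1) by (simp add: elem_submodel_def)
  then have "(inv\<^bsub>G\<^esub> f \<otimes>\<^bsub>G\<^esub> g) x = x" if "x \<in> X" for x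
    using that assms(3,4) assms(5)[OF that, symmetric] by auto
  then show ?thesis
    using assms Autf_fixing[of "inv\<^bsub>G\<^esub> f \<otimes>\<^bsub>G\<^esub> g" X] by (simp add: cls_eq_iff)
qed

text \<open>\<open>Inl x\<close> is meant to be interpreted by \<open>f x\<close>, for an automorphism \<open>f\<close>, and \<open>Inr x\<close> by \<open>x\<close> itself.\<close>

abbreviation "dvars A \<equiv> nvars L M (Inl ` A \<union> Inr ` A) (case_sum id id)"

lemma wfa_dvars: "f \<in> Aut L M \<Longrightarrow> A \<subseteq> U \<Longrightarrow> wfa M (dvars A) (case_sum f (\<lambda>x. x))"
proof (rule wfa_nvars)
  fix v assume *: "f \<in> Aut L M" "A \<subseteq> U" "v \<in> Inl ` A \<union> Inr ` A"
  then consider x where "v = Inl x" | x where "v = Inr x" "x \<in> U"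
    by auto
  then show "\<exists>g\<in>Aut L M. case_sum f (\<lambda>x. x) v = g (case_sum id id v)"
  proof cases
    case 1
    then show ?thesis
      using *(1) by auto
  next
    case 2
    then show ?thesis
      by (intro bexI[of _ "\<one>\<^bsub>G\<^esub>"]) simp_all
  qed
qed

section \<open>Types over a small model and the topology of the Lascar group\<close>

lemma tp_dvars_iff:
  assumes "f \<in> Aut L M" "X \<subseteq> U"
  shows "\<phi> \<in> tp L M X f X \<longleftrightarrow> \<phi> \<in> okf L (dvars X) \<and> sat M (case_sum f (\<lambda>x. x)) [] \<phi>"
proof -
  have "\<phi> \<in> param_fms L M {(s, i). i \<in> X \<and> f i \<in> carr M s} X \<longleftrightarrow> \<phi> \<in> okf L (dvars X)"
  proof (cases "fm_ok L [] \<phi>")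
    case True
    have s: "s \<in> sorts L" if "(s, v) \<in> fvs \<phi>" for s v
      using fm_ok_sorts[OF True that] .
    have "fvs \<phi> \<subseteq> dvars X \<longleftrightarrow> (\<forall>s x. (s, Inl x) \<in> fvs \<phi> \<longrightarrow> x \<in> X \<and> x \<in> carr M s) \<and>
        (\<forall>s x. (s, Inr x) \<in> fvs \<phi> \<longrightarrow> x \<in> X \<and> x \<in> carr M s)"
      using s by (auto simp: nvars_def subset_iff split_sum_all all_conj_distrib)
    moreover have "f x \<in> carr M s \<longleftrightarrow> x \<in> carr M s" if "x \<in> X" "(s, v) \<in> fvs \<phi>" for s x v
      using Aut_carr_iff[OF assms(1) s[OF that(2)]] that(1) assms(2) by auto
    ultimately show ?thesis
      using True unfolding param_fms_iff okf_def by (simp, metis)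
  qed (simp add: param_fms_iff okf_def)
  then show ?thesis
    by (simp add: tp_def psat_def)
qed

text \<open>By homogeneity some \<open>g\<close> fixes \<open>X\<close> pointwise and carries the
  values of \<open>f\<close> on \<open>X\<close> to those of \<open>f'\<close>. Then
  \<open>g\<close> is trivial in the Lascar group, and \<open>g\<close> times \<open>f\<close> has
  the class of \<open>f'\<close>.\<close>

lemma cls_eq_if_tp_eq:
  assumes X: "elem_submodel L M X" "small \<kappa> X" and f: "f \<in> Aut L M" "f' \<in> Aut L M"
    and eq: "tp L M X f X = tp L M X f' X"
  shows "cls f = cls f'"
proof -
  have XU: "X \<subseteq> U"
    using X(1) by (simp add: elem_submodel_def)
  obtain g where g: "g \<in> Aut L M"
    "\<And>v. v \<in> Inl ` X \<union> Inr ` X \<Longrightarrow> g (case_sum f (\<lambda>x. x) v) = case_sum f' (\<lambda>x. x) v"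
  proof (rule homogeneity_nvars)
    show "small \<kappa> (Inl ` X \<union> Inr ` X)"
      by (intro small_Un small_image X)
    show "wfa M (dvars X) (case_sum f (\<lambda>x. x))" "wfa M (dvars X) (case_sum f' (\<lambda>x. x))"
      using wfa_dvars f XU by auto
    show "case_sum id id v \<in> U" if "v \<in> Inl ` X \<union> Inr ` X" for v
      using that XU by auto
    show "sat M (case_sum f' (\<lambda>x. x)) [] \<phi>"
      if "\<phi> \<in> okf L (dvars X)" "sat M (case_sum f (\<lambda>x. x)) [] \<phi>" for \<phi>
      using that eq tp_dvars_iff[OF f(1) XU] tp_dvars_iff[OF f(2) XU] by blast
  qed (rule that)
  have g1: "g x = x" and gf: "g (f x) = f' x" if "x \<in> X" for x
    using g(2)[of "Inr x"] g(2)[of "Inl x"] that by auto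
  have "cls g = cls \<one>\<^bsub>G\<^esub>"
    using g g1 XU by (intro cls_eqI[OF X]) auto
  moreover have "cls (g \<otimes>\<^bsub>G\<^esub> f) = cls f'"
    using f g gf XU by (intro cls_eqI[OF X]) auto
  ultimately show ?thesis
    using f g by simp
qed

lemma type_to_Gal_eq:
  assumes "elem_submodel L M X" "small \<kappa> X" "f \<in> Aut L M"
  shows "type_to_Gal L \<kappa> M X (tp L M X f X) = cls f"
  unfolding type_to_Gal_def cls_def[symmetric]
  using assms cls_eq_if_tp_eq by (intro the_equality) blast+

lemma basic_open_type:
  assumes "openin (type_space L M X) W" "p \<in> W"
  shows "\<exists>\<Phi>. finite \<Phi> \<and> \<Phi> \<subseteq> p \<and> {q \<in> image_types L M X. \<Phi> \<subseteq> q} \<subseteq> W"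
proof -
  have "generate_topology_on
      (insert (image_types L M X) (range (\<lambda>\<phi>. {q \<in> image_types L M X. \<phi> \<in> q}))) W"
    using assms(1) unfolding type_space_def by (rule openin_topology_generated_by)
  then show ?thesis
    using assms(2)
  proof (induction rule: generate_topology_on.induct)
    case (Int a b)
    then obtain \<Phi> \<Psi> where "finite \<Phi>" "\<Phi> \<subseteq> p" "{q \<in> image_types L M X. \<Phi> \<subseteq> q} \<subseteq> a"
      "finite \<Psi>" "\<Psi> \<subseteq> p" "{q \<in> image_types L M X. \<Psi> \<subseteq> q} \<subseteq> b"
      by auto
    then show ?case
      by (intro exI[of _ "\<Phi> \<union> \<Psi>"]) auto
  next
    case (UN K)
    then show ?case
      by (meson Union_iff Union_upper order_trans)
  next
    case (Basis s)
    then consider "s = image_types L M X" | \<phi> where "s = {q \<in> image_types L M X. \<phi> \<in> q}"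
      by auto
    then show ?case
    proof cases
      case 1
      then show ?thesis
        by (intro exI[of _ "{}"]) auto
    next
      case 2
      then show ?thesis
        using Basis.prems by (intro exI[of _ "{\<phi>}"]) auto
    qed
  qed auto
qed

text \<open>In a Hausdorff quotient the trivial class is a closed point, so the types of
  automorphisms outside \<open>Autf\<close> form an open set. A basic neighbourhood of the type of
  \<open>f\<close> inside it is given by finitely many formulas, and \<open>\<psi>\<close> is their
  conjunction.\<close>

lemma Autf_closed:
  assumes X: "elem_submodel L M X" "small \<kappa> X" and H: "Hausdorff_space (Gal_topology L \<kappa> M X)"
    and f: "f \<in> Aut L M" "f \<notin> Autf L \<kappa> M"
  shows "\<exists>\<psi>\<in>okf L (dvars X). sat M (case_sum f (\<lambda>x. x)) [] \<psi> \<and>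
    (\<forall>h\<in>Autf L \<kappa> M. \<not> sat M (case_sum h (\<lambda>x. x)) [] \<psi>)"
proof -
  let ?T = "type_space L M X"
  define t where "t = type_to_Gal L \<kappa> M X"
  have XU: "X \<subseteq> U"
    using X(1) by (simp add: elem_submodel_def)
  have T: "topspace ?T = image_types L M X"
    by (auto simp: type_space_def)
  have t: "t (tp L M X g X) = cls g" if "g \<in> Aut L M" for g
    unfolding t_def by (rule type_to_Gal_eq[OF X that])
  have carrier_Gal: "carrier (Gal_L L \<kappa> M) = cls ` Aut L M"
    by (auto simp: Gal_L_def FactGroup_def RCOSETS_def cls_def)
  define P where "P W \<longleftrightarrow> W \<subseteq> carrier (Gal_L L \<kappa> M) \<and> openin ?T {q \<in> topspace ?T. t q \<in> W}" for W
  \<comment> \<open>\<open>topology\<close> and \<open>openin\<close> are inverse to each other only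
    on predicates that satisfy the axioms of a topology.\<close>
  have "istopology P"
    unfolding istopology_def
  proof (intro conjI allI impI)
    fix S W assume "P S" "P W"
    moreover have "{q \<in> topspace ?T. t q \<in> S \<inter> W} =
        {q \<in> topspace ?T. t q \<in> S} \<inter> {q \<in> topspace ?T. t q \<in> W}"
      by auto
    ultimately show "P (S \<inter> W)"
      by (auto simp: P_def)
  next
    fix \<K> assume *: "\<forall>W\<in>\<K>. P W"
    have "{q \<in> topspace ?T. t q \<in> \<Union>\<K>} = \<Union>((\<lambda>W. {q \<in> topspace ?T. t q \<in> W}) ` \<K>)"
      by auto
    moreover have "openin ?T (\<Union>((\<lambda>W. {q \<in> topspace ?T. t q \<in> W}) ` \<K>))"
      using * by (intro openin_Union) (auto simp: P_def)
    ultimately have "openin ?T {q \<in> topspace ?T. t q \<in> \<Union>\<K>}"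
      by simp
    then show "P (\<Union>\<K>)"
      using * by (auto simp: P_def)
  qed
  then have open_iff: "openin (Gal_topology L \<kappa> M X) = P"
    unfolding Gal_topology_def P_def t_def by (rule topology_inverse')
  have "P (carrier (Gal_L L \<kappa> M))"
  proof -
    have "{q \<in> topspace ?T. t q \<in> carrier (Gal_L L \<kappa> M)} = topspace ?T"
      using t by (auto simp: T image_types_def carrier_Gal)
    then show ?thesis
      by (simp add: P_def)
  qed
  then have top: "topspace (Gal_topology L \<kappa> M X) = carrier (Gal_L L \<kappa> M)"
    unfolding topspace_def open_iff by (auto simp: P_def)
  have "closedin (Gal_topology L \<kappa> M X) {cls \<one>\<^bsub>G\<^esub>}"
    using Hausdorff_imp_t1_space[OF H] by (rule closedin_t1_singleton)
      (unfold top carrier_Gal, rule imageI, simp)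
  then have "P (carrier (Gal_L L \<kappa> M) - {cls \<one>\<^bsub>G\<^esub>})"
    unfolding closedin_def top open_iff by simp
  then have "openin ?T {q \<in> topspace ?T. t q \<in> carrier (Gal_L L \<kappa> M) - {cls \<one>\<^bsub>G\<^esub>}}"
    by (simp add: P_def)
  moreover have "tp L M X f X \<in> {q \<in> topspace ?T. t q \<in> carrier (Gal_L L \<kappa> M) - {cls \<one>\<^bsub>G\<^esub>}}"
    using f t[OF f(1)] cls_one_iff[OF f(1)] by (simp add: T image_types_def carrier_Gal)
  ultimately obtain \<Phi> where \<Phi>: "finite \<Phi>" "\<Phi> \<subseteq> tp L M X f X"
    "{q \<in> image_types L M X. \<Phi> \<subseteq> q} \<subseteq> {q \<in> topspace ?T. t q \<in> carrier (Gal_L L \<kappa> M) - {cls \<one>\<^bsub>G\<^esub>}}"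
    using basic_open_type by meson
  have no: "\<not> \<Phi> \<subseteq> tp L M X h X" if h: "h \<in> Autf L \<kappa> M" for h
  proof
    assume "\<Phi> \<subseteq> tp L M X h X"
    moreover have "tp L M X h X \<in> image_types L M X"
      using Autf_Aut[OF h] by (simp add: image_types_def)
    ultimately have "t (tp L M X h X) \<noteq> cls \<one>\<^bsub>G\<^esub>"
      using \<Phi>(3) by blast
    then show False
      using t[OF Autf_Aut[OF h]] cls_one_iff[OF Autf_Aut[OF h]] h by simp
  qed
  have ok: "\<Phi> \<subseteq> okf L (dvars X)"
    using \<Phi>(2) tp_dvars_iff[OF f(1) XU] by blast
  \<comment> \<open>The empty set of formulas would not exclude the identity, which lies in
    \<open>Autf\<close>.\<close>
  have "\<Phi> \<noteq> {}"
    using no[OF Autf.one_closed] by auto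
  then obtain \<phi>0 where "\<phi>0 \<in> okf L (dvars X)"
    using ok by auto
  from finite_conj[OF \<Phi>(1) ok this, of M] obtain \<psi> where \<psi>: "\<psi> \<in> okf L (dvars X)"
    "\<And>e. sat M e [] \<psi> \<longleftrightarrow> (\<forall>\<delta>\<in>\<Phi>. sat M e [] \<delta>)"
    by metis
  have "sat M (case_sum f (\<lambda>x. x)) [] \<psi>"
    using \<psi>(2) \<Phi>(2) tp_dvars_iff[OF f(1) XU] by blast
  moreover have "\<not> sat M (case_sum h (\<lambda>x. x)) [] \<psi>" if "h \<in> Autf L \<kappa> M" for h
    using no[OF that] \<psi>(2) ok tp_dvars_iff[OF Autf_Aut[OF that] XU] by blast
  ultimately show ?thesis
    using \<psi>(1) by blast
qed

end

section \<open>Elimination of imaginary sorts\<close>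

text \<open>An element of sort \<open>t\<close> is represented by a tuple of the home sorts \<open>ar t\<close>. Accordingly a variable \<open>v\<close>
  of sort \<open>t\<close> turns into a block of variables \<open>nm v i\<close>, and a bound variable into a block of bound
  variables, the lengths of the blocks before it giving the offset.\<close>

fun ar :: "('s, 'f, 'r) eqsort \<Rightarrow> 's list" where
  "ar (Home s) = [s]"
| "ar (Imag ss E) = ss"

fun cl :: "('s, 'f, 'r, 'a) struct \<Rightarrow> ('s, 'f, 'r) eqsort \<Rightarrow> 'a list \<Rightarrow> ('s, 'f, 'r, 'a) eqelt" where
  "cl N (Home s) zs = Real (hd zs)"
| "cl N (Imag ss E) zs = Class ss E (eq_rel N ss E `` {zs})"

definition off :: "('s, 'f, 'r) eqsort list \<Rightarrow> nat \<Rightarrow> nat" where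
  "off \<Gamma> k = length (concat (map ar (take k \<Gamma>)))"

definition reps :: "('s, 'f, 'r, 'a) struct \<Rightarrow> 'a list list \<Rightarrow> ('s, 'f, 'r) eqsort list \<Rightarrow> bool" where
  "reps N zss ts \<longleftrightarrow> list_all2 (\<lambda>zs t. zs \<in> tups N (ar t)) zss ts"

lemma carr_eq_struct: "carr (eq_struct N) t = cl N t ` tups N (ar t)"
proof (cases t)
  case (Home s)
  have "tups N [s] = (\<lambda>z. [z]) ` carr N s"
    by (auto simp: tups_def list_all2_Cons2 image_def)
  then show ?thesis
    using Home by (simp add: eq_struct_def image_image)
next
  case (Imag ss E)
  then show ?thesis
    by (auto simp: eq_struct_def quotient_def)
qed

lemma length_tups: "zs \<in> tups N ss \<Longrightarrow> length zs = length ss"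
  by (auto simp: tups_def list_all2_lengthD)

lemma nth_concat:
  assumes "k < length xss" "i < length (xss ! k)"
  shows "concat xss ! (length (concat (take k xss)) + i) = xss ! k ! i"
    and "length (concat (take k xss)) + i < length (concat xss)"
proof -
  have "concat xss = concat (take k xss) @ xss ! k @ concat (drop (Suc k) xss)"
    using id_take_nth_drop[OF assms(1)] by (metis concat.simps(2) concat_append)
  then show "concat xss ! (length (concat (take k xss)) + i) = xss ! k ! i"
    "length (concat (take k xss)) + i < length (concat xss)"
    using assms(2) by (simp_all add: nth_append)
qed

lemma off_reps:
  assumes "reps N zss ts"
  shows "off ts k = length (concat (take k zss))"
proof -
  have "map length zss = map (length \<circ> ar) ts"
    using assms by (auto simp: reps_def list_all2_conv_all_nth list_eq_iff_nth_eq length_tups)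
  then have "map length (take k zss) = map (length \<circ> ar) (take k ts)"
    by (metis take_map)
  then show ?thesis
    by (simp add: off_def length_concat)
qed

lemma nth_reps:
  assumes "reps N zss ts" "k < length ts" "i < length (ar (ts ! k))"
  shows "concat zss ! (off ts k + i) = zss ! k ! i"
proof -
  have "k < length zss" "i < length (zss ! k)"
    using assms by (auto simp: reps_def list_all2_conv_all_nth length_tups)
  then show ?thesis
    using nth_concat(1) off_reps[OF assms(1)] by metis
qed

lemma nth_sorts:
  assumes "k < length ts" "i < length (ar (ts ! k))"
  shows "concat (map ar ts) ! (off ts k + i) = ar (ts ! k) ! i"
    and "off ts k + i < length (concat (map ar ts))"
  using nth_concat[of k "map ar ts" i] assms by (simp_all add: off_def take_map)

lemma tups_concat: "reps N zss ts \<Longrightarrow> concat zss \<in> tups N (concat (map ar ts))"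
proof (induction ts arbitrary: zss)
  case (Cons t ts)
  then show ?case
    by (auto simp: reps_def list_all2_Cons2 tups_def intro!: list_all2_appendI)
qed (simp add: reps_def tups_def)

text \<open>Sorts differ in their number of home coordinates, so the list of sorts is what tells
  where a block of a flat tuple ends.\<close>

fun uncat :: "('s, 'f, 'r) eqsort list \<Rightarrow> 'a list \<Rightarrow> 'a list list" where
  "uncat [] zs = []"
| "uncat (t # ts) zs = take (length (ar t)) zs # uncat ts (drop (length (ar t)) zs)"

lemma uncat_reps:
  assumes "zs \<in> tups N (concat (map ar ts))"
  shows "reps N (uncat ts zs) ts \<and> concat (uncat ts zs) = zs"
  using assms
proof (induction ts arbitrary: zs)
  case (Cons t ts)
  then obtain us vs where "zs = us @ vs" "us \<in> tups N (ar t)" "vs \<in> tups N (concat (map ar ts))"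
    by (auto simp: tups_def list_all2_append2)
  then show ?case
    using Cons.IH[of vs] length_tups[of us N "ar t"] by (auto simp: reps_def)
qed (simp add: reps_def tups_def)

lemma uncat_concat: "reps N zss ts \<Longrightarrow> uncat ts (concat zss) = zss"
  by (induction ts arbitrary: zss) (auto simp: reps_def list_all2_Cons2 length_tups)

text \<open>A term becomes the list of terms for the coordinates of a representative. A projection
  disappears, since the tuple it is applied to already represents its value.\<close>

primrec ttm :: "('v \<Rightarrow> nat \<Rightarrow> 'w) \<Rightarrow> ('s, 'f, 'r) eqsort list
    \<Rightarrow> (('s, 'f, 'r) eqsort, ('s, 'f, 'r) eqfun, 'v) tm \<Rightarrow> ('s, 'f, 'w) tm list" where
  "ttm nm \<Gamma> (FV t v) = map (\<lambda>i. FV (ar t ! i) (nm v i)) [0..<length (ar t)]"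
| "ttm nm \<Gamma> (BV k) = map (\<lambda>i. BV (off \<Gamma> k + i)) [0..<length (ar (\<Gamma> ! k))]"
| "ttm nm \<Gamma> (Fn h us) = (case h of
      OldF f \<Rightarrow> [Fn f (concat (map (ttm nm \<Gamma>) us))]
    | Proj ss E \<Rightarrow> concat (map (ttm nm \<Gamma>) us))"

text \<open>The syntax of \<open>Eq\<close> does not record the sort of its two sides, on which the
  translation of an equation depends.\<close>

fun tsort :: "('s, 'f, 'r) lang \<Rightarrow> ('s, 'f, 'r) eqsort list
    \<Rightarrow> (('s, 'f, 'r) eqsort, ('s, 'f, 'r) eqfun, 'v) tm \<Rightarrow> ('s, 'f, 'r) eqsort" where
  "tsort L \<Gamma> (FV t v) = t"
| "tsort L \<Gamma> (BV k) = \<Gamma> ! k"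
| "tsort L \<Gamma> (Fn (OldF f) us) = Home (fres L f)"
| "tsort L \<Gamma> (Fn (Proj ss E) us) = Imag ss E"

text \<open>Two tuples represent the same imaginary element iff they satisfy the defining relation
  \<open>E\<close> of its sort.\<close>

fun eqt :: "('s, 'f, 'r) eqsort \<Rightarrow> ('s, 'f, 'w) tm list \<Rightarrow> ('s, 'f, 'w) tm list \<Rightarrow> ('s, 'f, 'r, 'w) fm" where
  "eqt (Home s) us vs = Eq (hd us) (hd vs)"
| "eqt (Imag ss E) us vs = fm_subst 0 (\<lambda>s. case_sum (nth us) (nth vs)) E"

text \<open>The first sort is quantified innermost, so that a tuple of witnesses precedes the context in order.\<close>

primrec exs :: "'s list \<Rightarrow> ('s, 'f, 'r, 'v) fm \<Rightarrow> ('s, 'f, 'r, 'v) fm" where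
  "exs [] \<phi> = \<phi>"
| "exs (s # ss) \<phi> = exs ss (Ex s \<phi>)"

primrec tfm :: "('s, 'f, 'r) lang \<Rightarrow> ('v \<Rightarrow> nat \<Rightarrow> 'w) \<Rightarrow> ('s, 'f, 'r) eqsort list
    \<Rightarrow> (('s, 'f, 'r) eqsort, ('s, 'f, 'r) eqfun, 'r, 'v) fm \<Rightarrow> ('s, 'f, 'r, 'w) fm" where
  "tfm L nm \<Gamma> (Eq t u) = eqt (tsort L \<Gamma> t) (ttm nm \<Gamma> t) (ttm nm \<Gamma> u)"
| "tfm L nm \<Gamma> (Rel r ts) = Rel r (concat (map (ttm nm \<Gamma>) ts))"
| "tfm L nm \<Gamma> (Neg \<phi>) = Neg (tfm L nm \<Gamma> \<phi>)"
| "tfm L nm \<Gamma> (And \<phi> \<psi>) = And (tfm L nm \<Gamma> \<phi>) (tfm L nm \<Gamma> \<psi>)"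
| "tfm L nm \<Gamma> (Ex t \<phi>) = exs (ar t) (tfm L nm (t # \<Gamma>) \<phi>)"

section \<open>Correctness of the translation\<close>

lemma sat_exs: "sat N e \<beta> (exs ss \<phi>) \<longleftrightarrow> (\<exists>zs\<in>tups N ss. sat N e (zs @ \<beta>) \<phi>)"
proof (induction ss arbitrary: \<phi>)
  case (Cons s ss)
  have "tups N (s # ss) = (\<lambda>(z, zs). z # zs) ` (carr N s \<times> tups N ss)"
    by (auto simp: tups_def list_all2_Cons2 image_def)
  then show ?case
    using Cons by auto
qed (simp add: tups_def)

lemma fm_ok_exs: "set ss \<subseteq> sorts L \<Longrightarrow> fm_ok L (ss @ \<Gamma>) \<phi> \<Longrightarrow> fm_ok L \<Gamma> (exs ss \<phi>)"
  by (induction ss arbitrary: \<phi>) auto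

lemma fvs_exs: "fvs (exs ss \<phi>) = fvs \<phi>"
  by (induction ss arbitrary: \<phi>) auto

lemma ar_sorts: "t \<in> sorts (eq_lang L N) \<Longrightarrow> set (ar t) \<subseteq> sorts L \<and> ar t \<noteq> []"
  by (auto simp: eq_lang_def eq_fm_def)

lemma lang_ok_eq:
  assumes "lang_ok L"
  shows "lang_ok (eq_lang L N)"
  using assms by (auto simp: lang_ok_def eq_lang_def eq_fm_def intro!: imageI) blast

lemma list_all2_concat:
  "list_all2 (\<lambda>x y. list_all2 P (f x) (g y)) xs ys \<Longrightarrow> list_all2 P (concat (map f xs)) (concat (map g ys))"
  by (induction rule: list_all2_induct) (auto intro: list_all2_appendI)

context
  fixes L :: "('s, 'f, 'r) lang" and N :: "('s, 'f, 'r, 'a) struct"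
  assumes L: "lang_ok L" and N: "is_struct L N"
begin

abbreviation "Leq \<equiv> eq_lang L N"
abbreviation "Meq \<equiv> eq_struct N"

lemma tsort_eq: "tm_ok Leq \<Gamma> u t \<Longrightarrow> tsort L \<Gamma> u = t"
proof (cases u)
  case (Fn h us)
  then show "tm_ok Leq \<Gamma> u t \<Longrightarrow> tsort L \<Gamma> u = t"
    by (cases h) (auto simp: tm_ok_iff eq_lang_def)
qed (auto simp: tm_ok_iff)

lemma tm_ok_ttm: "tm_ok Leq \<Gamma> u t \<Longrightarrow> list_all2 (tm_ok L (concat (map ar \<Gamma>))) (ttm nm \<Gamma> u) (ar t)"
proof (induction u arbitrary: t)
  case (FV s v)
  then show ?case
    using ar_sorts[of t L N] by (auto simp: tm_ok_iff list_all2_conv_all_nth)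
next
  case (BV k)
  then show ?case
    by (auto simp: tm_ok_iff list_all2_conv_all_nth nth_sorts)
next
  case (Fn h us)
  define ts where "ts = fargs Leq h"
  have h: "h \<in> funs Leq" "list_all2 (tm_ok Leq \<Gamma>) us ts" "t = fres Leq h"
    using Fn.prems by (auto simp: tm_ok_iff ts_def)
  have "list_all2 (\<lambda>u t. list_all2 (tm_ok L (concat (map ar \<Gamma>))) (ttm nm \<Gamma> u) (ar t)) us ts"
    using h(2) Fn.IH by (auto simp: list_all2_conv_all_nth)
  then have *: "list_all2 (tm_ok L (concat (map ar \<Gamma>))) (concat (map (ttm nm \<Gamma>) us)) (concat (map ar ts))"
    by (rule list_all2_concat)
  show ?case
  proof (cases h)
    case (OldF f)
    then have "concat (map ar ts) = fargs L f" "f \<in> funs L" "t = Home (fres L f)"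
      using h by (auto simp: ts_def eq_lang_def o_def)
    then show ?thesis
      using * OldF by (auto simp: tm_ok_iff)
  next
    case (Proj ss E)
    then have "concat (map ar ts) = ss" "t = Imag ss E"
      using h by (auto simp: ts_def eq_lang_def o_def)
    then show ?thesis
      using * Proj by simp
  qed
qed

text \<open>A relation between assignments and not a map: an imaginary element has many
  representatives, and \<open>e'\<close> may use any of them.\<close>

definition enc :: "('v \<Rightarrow> nat \<Rightarrow> 'w) \<Rightarrow> (('s, 'f, 'r) eqsort \<times> 'v) set
    \<Rightarrow> ('v \<Rightarrow> ('s, 'f, 'r, 'a) eqelt) \<Rightarrow> ('w \<Rightarrow> 'a) \<Rightarrow> bool" where
  "enc nm V e e' \<longleftrightarrow> (\<forall>(t, v)\<in>V. \<exists>zs\<in>tups N (ar t). e v = cl N t zs \<and>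
     (\<forall>i<length (ar t). e' (nm v i) = zs ! i))"

lemma enc_subset: "enc nm W e e' \<Longrightarrow> V \<subseteq> W \<Longrightarrow> enc nm V e e'"
  unfolding enc_def by (meson subsetD)

text \<open>Arguments of function symbols, projections included, have home sorts. Each is therefore
  a single coordinate, and together they form the argument tuple in the original structure.\<close>

lemma eval_ttm:
  assumes \<Gamma>: "reps N \<beta>s \<Gamma>"
  shows "tm_ok Leq \<Gamma> u t \<Longrightarrow> enc nm (tm_fvs u) e e' \<Longrightarrow>
    map (eval N e' (concat \<beta>s)) (ttm nm \<Gamma> u) \<in> tups N (ar t) \<and>
    eval Meq e (map2 (cl N) \<Gamma> \<beta>s) u = cl N t (map (eval N e' (concat \<beta>s)) (ttm nm \<Gamma> u))"
proof (induction u arbitrary: t)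
  case (FV s v)
  have st: "s = t"
    using FV.prems(1) by (simp add: tm_ok_iff)
  have "\<exists>zs\<in>tups N (ar t). e v = cl N t zs \<and> (\<forall>i<length (ar t). e' (nm v i) = zs ! i)"
    using FV.prems(2) st by (simp add: enc_def)
  then obtain zs where zs: "zs \<in> tups N (ar t)" "e v = cl N t zs"
    "\<forall>i<length (ar t). e' (nm v i) = zs ! i"
    by blast
  have "map (eval N e' (concat \<beta>s)) (ttm nm \<Gamma> (FV s v)) = zs"
    using zs(3) st length_tups[OF zs(1)] by (intro nth_equalityI) simp_all
  then show ?case
    using zs by simp
next
  case (BV k)
  then have k: "k < length \<Gamma>" "t = \<Gamma> ! k"
    by (simp_all add: tm_ok_iff)
  then have z: "\<beta>s ! k \<in> tups N (ar t)" "k < length \<beta>s"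
    using \<Gamma> by (simp_all add: reps_def list_all2_conv_all_nth)
  have "map (eval N e' (concat \<beta>s)) (ttm nm \<Gamma> (BV k)) = \<beta>s ! k"
    using k nth_reps[OF \<Gamma> k(1)] length_tups[OF z(1)] by (intro nth_equalityI) simp_all
  then show ?case
    using k z by simp
next
  case (Fn h us)
  define ts where "ts = fargs Leq h"
  let ?ev = "\<lambda>u. map (eval N e' (concat \<beta>s)) (ttm nm \<Gamma> u)"
  let ?EV = "eval Meq e (map2 (cl N) \<Gamma> \<beta>s)"
  have h: "h \<in> funs Leq" "list_all2 (tm_ok Leq \<Gamma>) us ts" "t = fres Leq h"
    using Fn.prems by (auto simp: tm_ok_iff ts_def)
  have IH: "?ev u \<in> tups N (ar t) \<and> ?EV u = cl N t (?ev u)" if "u \<in> set us" "tm_ok Leq \<Gamma> u t" for u t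
    using that Fn.prems(2) by (intro Fn.IH) (auto elim: enc_subset)
  have home: "map the_real (map ?EV us) = concat (map ?ev us) \<and> concat (map ?ev us) \<in> tups N ss"
    if "ts = map Home ss" for ss
    using h(2) IH unfolding that
  proof (induction us arbitrary: ss)
    case (Cons u us)
    then obtain s ss' where ss: "ss = s # ss'" "tm_ok Leq \<Gamma> u (Home s)"
      "list_all2 (tm_ok Leq \<Gamma>) us (map Home ss')"
      by (cases ss) auto
    have "map the_real (map ?EV us) = concat (map ?ev us) \<and> concat (map ?ev us) \<in> tups N ss'"
      using Cons.prems ss(3) by (intro Cons.IH) auto
    moreover obtain z where "?ev u = [z]" "z \<in> carr N s" "?EV u = Real z"
      using Cons.prems(2)[OF _ ss(2)] by (auto simp: tups_def list_all2_Cons2)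
    ultimately show ?case
      by (simp add: ss tups_Cons)
  qed (simp add: tups_def)
  have cc: "map (eval N e' (concat \<beta>s)) (concat (map (ttm nm \<Gamma>) us)) = concat (map ?ev us)"
    by (simp add: map_concat o_def)
  show ?case
  proof (cases h)
    case (OldF f)
    then have ts: "ts = map Home (fargs L f)" and f: "f \<in> funs L" "t = Home (fres L f)"
      using h by (auto simp: ts_def eq_lang_def)
    note home' = home[OF ts]
    have "fint N f (concat (map ?ev us)) \<in> carr N (fres L f)"
      using f home' N by (simp add: is_struct_def)
    moreover have "?EV (Fn h us) = Real (fint N f (map the_real (map ?EV us)))"
      by (simp add: OldF eq_struct_def)
    moreover have "?ev (Fn h us) = [fint N f (concat (map ?ev us))]"
      using cc by (simp add: OldF)
    ultimately show ?thesis
      using f home' by (simp add: tups_def)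
  next
    case (Proj ss E)
    then have ts: "ts = map Home ss" and f: "t = Imag ss E"
      using h by (auto simp: ts_def eq_lang_def)
    note home' = home[OF ts]
    have "?EV (Fn h us) = Class ss E (eq_rel N ss E `` {map the_real (map ?EV us)})"
      by (simp add: Proj eq_struct_def)
    moreover have "?ev (Fn h us) = concat (map ?ev us)"
      using cc by (simp add: Proj)
    ultimately show ?thesis
      using f home' by simp
  qed
qed

lemma fm_ok_tfm: "fm_ok Leq \<Gamma> \<phi> \<Longrightarrow> set \<Gamma> \<subseteq> sorts Leq \<Longrightarrow> fm_ok L (concat (map ar \<Gamma>)) (tfm L nm \<Gamma> \<phi>)"
proof (induction \<phi> arbitrary: \<Gamma>)
  case (Eq u v)
  then obtain t where t: "tm_ok Leq \<Gamma> u t" "tm_ok Leq \<Gamma> v t"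
    by auto
  have l: "list_all2 (tm_ok L (concat (map ar \<Gamma>))) (ttm nm \<Gamma> u) (ar t)"
    "list_all2 (tm_ok L (concat (map ar \<Gamma>))) (ttm nm \<Gamma> v) (ar t)"
    using t tm_ok_ttm by auto
  have "lang_ok Leq"
    by (rule lang_ok_eq[OF L])
  then have ts: "t \<in> sorts Leq"
    by (rule tm_ok_sort[OF _ Eq.prems(2) t(1)])
  show ?case
  proof (cases t)
    case (Home s)
    then show ?thesis
      using l by (auto simp: tsort_eq[OF t(1)] list_all2_Cons2)
  next
    case (Imag ss E)
    then have E: "fm_ok L [] E"
      "fvs E \<subseteq> {(ss ! i, Inl i) |i. i < length ss} \<union> {(ss ! i, Inr i) |i. i < length ss}"
      using ts by (auto simp: eq_lang_def eq_fm_def)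
    have "fm_ok L ([] @ concat (map ar \<Gamma>))
        (fm_subst (length ([] :: 's list)) (\<lambda>s. case_sum (nth (ttm nm \<Gamma> u)) (nth (ttm nm \<Gamma> v))) E)"
    proof (rule fm_ok_subst[OF E(1)])
      fix s w assume "(s, w) \<in> fvs E"
      then show "tm_ok L (concat (map ar \<Gamma>)) (case_sum (nth (ttm nm \<Gamma> u)) (nth (ttm nm \<Gamma> v)) w) s"
        using E(2) l Imag by (auto simp: list_all2_conv_all_nth)
    qed
    then show ?thesis
      by (simp add: tsort_eq[OF t(1)] Imag)
  qed
next
  case (Rel r us)
  have l: "list_all2 (tm_ok Leq \<Gamma>) us (rargs Leq r)" and r: "r \<in> rels L"
    using Rel.prems(1) by (simp_all add: eq_lang_def)
  from l have "list_all2 (\<lambda>u t. list_all2 (tm_ok L (concat (map ar \<Gamma>))) (ttm nm \<Gamma> u) (ar t)) us (rargs Leq r)"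
    by (rule list_all2_mono) (rule tm_ok_ttm)
  then have "list_all2 (tm_ok L (concat (map ar \<Gamma>))) (concat (map (ttm nm \<Gamma>) us)) (concat (map ar (rargs Leq r)))"
    by (rule list_all2_concat)
  moreover have "concat (map ar (rargs Leq r)) = rargs L r"
    by (simp add: eq_lang_def o_def)
  ultimately show ?case
    using r by simp
next
  case (Ex t \<phi>)
  then have "fm_ok L (concat (map ar (t # \<Gamma>))) (tfm L nm (t # \<Gamma>) \<phi>)"
    by (intro Ex.IH) auto
  then show ?case
    using ar_sorts[of t L N] Ex.prems by (auto intro: fm_ok_exs)
qed auto

lemma fvs_tfm:
  assumes "fm_ok Leq \<Gamma> \<phi>"
  shows "set \<Gamma> \<subseteq> sorts Leq \<Longrightarrow> (s, w) \<in> fvs (tfm L nm \<Gamma> \<phi>) \<Longrightarrow> \<exists>t v i. (t, v) \<in> fvs \<phi> \<and> i < length (ar t) \<and> s = ar t ! i \<and> w = nm v i"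
  using assms
proof (induction \<phi> arbitrary: \<Gamma>)
  have t: "\<exists>t v i. (t, v) \<in> tm_fvs u \<and> i < length (ar t) \<and> s = ar t ! i \<and> w = nm v i"
    if "x \<in> set (ttm nm \<Gamma> u)" "(s, w) \<in> tm_fvs x" for x u \<Gamma>
    using that
  proof (induction u arbitrary: x)
    case (Fn h us)
    then obtain u y where "u \<in> set us" "y \<in> set (ttm nm \<Gamma> u)" "(s, w) \<in> tm_fvs y"
      by (cases h) auto
    then show ?case
      using Fn.IH by fastforce
  qed auto
  {
    case (Eq u v)
    then obtain t where t': "tm_ok Leq \<Gamma> u t" "tm_ok Leq \<Gamma> v t"
      by auto
    have len: "length (ttm nm \<Gamma> u) = length (ar t)" "length (ttm nm \<Gamma> v) = length (ar t)"
      using tm_ok_ttm t' list_all2_lengthD by blast+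
    have "lang_ok Leq"
      by (rule lang_ok_eq[OF L])
    then have ts: "t \<in> sorts Leq"
      by (rule tm_ok_sort[OF _ Eq.prems(1) t'(1)])
    have "\<exists>x\<in>set (ttm nm \<Gamma> u) \<union> set (ttm nm \<Gamma> v). (s, w) \<in> tm_fvs x"
    proof (cases t)
      case (Home s)
      then show ?thesis
        using Eq.prems(2) len by (auto simp: tsort_eq[OF t'(1)] length_Suc_conv)
    next
      case (Imag ss E)
      then have E: "fvs E \<subseteq> {(ss ! i, Inl i) |i. i < length ss} \<union> {(ss ! i, Inr i) |i. i < length ss}"
        using ts by (auto simp: eq_lang_def eq_fm_def)
      have "(s, w) \<in> (\<Union>(s', z)\<in>fvs E. tm_fvs (case_sum (nth (ttm nm \<Gamma> u)) (nth (ttm nm \<Gamma> v)) z))"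
        using Eq.prems(2) by (simp add: tsort_eq[OF t'(1)] Imag fvs_subst)
      then obtain s' z where z: "(s', z) \<in> fvs E" "(s, w) \<in> tm_fvs (case_sum (nth (ttm nm \<Gamma> u)) (nth (ttm nm \<Gamma> v)) z)"
        by auto
      then obtain i where "i < length ss" "z = Inl i \<or> z = Inr i"
        using E by auto
      then have "case_sum (nth (ttm nm \<Gamma> u)) (nth (ttm nm \<Gamma> v)) z \<in> set (ttm nm \<Gamma> u) \<union> set (ttm nm \<Gamma> v)"
        using len Imag by auto
      then show ?thesis
        using z(2) by blast
    qed
    then show ?case
      using t[of _ \<Gamma> u] t[of _ \<Gamma> v] by fastforce
  next
    case (Rel r us)
    then show ?case
      using t by fastforce
  next
    case (And \<phi> \<psi>)
    then show ?case
      by fastforce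
  next
    case (Ex t \<phi>)
    then show ?case
      using Ex.IH[of "t # \<Gamma>"] by (auto simp: fvs_exs)
  }
qed auto

lemma eq_rel_Class:
  assumes "eq_fm L N ss E" "zs \<in> tups N ss" "ws \<in> tups N ss"
  shows "cl N (Imag ss E) zs = cl N (Imag ss E) ws \<longleftrightarrow> (zs, ws) \<in> eq_rel N ss E"
  using assms eq_equiv_class_iff[of "tups N ss" "eq_rel N ss E" zs ws] by (simp add: eq_fm_def)

text \<open>Every element of a sort is \<open>cl\<close> of some tuple, so a quantifier over the
  sort may range over representatives instead. Equations between imaginary elements are settled by
  \<open>E\<close> being an equivalence relation, and relation symbols involve home sorts
  only.\<close>

lemma sat_tfm:
  "fm_ok Leq \<Gamma> \<phi> \<Longrightarrow> set \<Gamma> \<subseteq> sorts Leq \<Longrightarrow> reps N \<beta>s \<Gamma> \<Longrightarrow> enc nm (fvs \<phi>) e e' \<Longrightarrow>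
    sat Meq e (map2 (cl N) \<Gamma> \<beta>s) \<phi> \<longleftrightarrow> sat N e' (concat \<beta>s) (tfm L nm \<Gamma> \<phi>)"
proof (induction \<phi> arbitrary: \<Gamma> \<beta>s)
  case (Eq u v)
  then obtain t where t: "tm_ok Leq \<Gamma> u t" "tm_ok Leq \<Gamma> v t"
    by auto
  have "lang_ok Leq"
    by (rule lang_ok_eq[OF L])
  then have ts: "t \<in> sorts Leq"
    by (rule tm_ok_sort[OF _ Eq.prems(2) t(1)])
  define zs ws where "zs = map (eval N e' (concat \<beta>s)) (ttm nm \<Gamma> u)"
    and "ws = map (eval N e' (concat \<beta>s)) (ttm nm \<Gamma> v)"
  have z: "zs \<in> tups N (ar t)" "eval Meq e (map2 (cl N) \<Gamma> \<beta>s) u = cl N t zs"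
    using eval_ttm[OF Eq.prems(3) t(1) enc_subset[OF Eq.prems(4)]] by (simp_all add: zs_def)
  have w: "ws \<in> tups N (ar t)" "eval Meq e (map2 (cl N) \<Gamma> \<beta>s) v = cl N t ws"
    using eval_ttm[OF Eq.prems(3) t(2) enc_subset[OF Eq.prems(4)]] by (simp_all add: ws_def)
  have "cl N t zs = cl N t ws \<longleftrightarrow> sat N e' (concat \<beta>s) (eqt t (ttm nm \<Gamma> u) (ttm nm \<Gamma> v))"
  proof (cases t)
    case (Home s)
    have "length (ttm nm \<Gamma> u) = 1" "length (ttm nm \<Gamma> v) = 1"
      using z(1) w(1) Home length_tups by (fastforce simp: zs_def ws_def)+
    then show ?thesis
      by (auto simp: Home zs_def ws_def length_Suc_conv)
  next
    case (Imag ss E)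
    then have eqfm: "eq_fm L N ss E"
      using ts by (auto simp: eq_lang_def)
    then have E: "fm_ok L [] E"
      "fvs E \<subseteq> {(ss ! i, Inl i) |i. i < length ss} \<union> {(ss ! i, Inr i) |i. i < length ss}"
      by (auto simp: eq_fm_def)
    have len: "length (ttm nm \<Gamma> u) = length ss" "length (ttm nm \<Gamma> v) = length ss"
      using z(1) w(1) Imag length_tups by (fastforce simp: zs_def ws_def)+
    have "sat N e' ([] @ concat \<beta>s) (fm_subst (length ([] :: 'a list))
        (\<lambda>s. case_sum (nth (ttm nm \<Gamma> u)) (nth (ttm nm \<Gamma> v))) E) \<longleftrightarrow>
        sat N (case_sum (nth zs) (nth ws)) [] E"
    proof (rule sat_subst[OF E(1)])
      fix s x assume "(s, x) \<in> fvs E"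
      then obtain i where "i < length ss" "x = Inl i \<or> x = Inr i"
        using E(2) by auto
      then show "case_sum (nth zs) (nth ws) x
          = eval N e' (concat \<beta>s) (case_sum (nth (ttm nm \<Gamma> u)) (nth (ttm nm \<Gamma> v)) x)"
        using len by (auto simp: zs_def ws_def)
    qed simp
    also have "\<dots> \<longleftrightarrow> (zs, ws) \<in> eq_rel N ss E"
      using z(1) w(1) Imag by (simp add: eq_rel_def)
    also have "\<dots> \<longleftrightarrow> cl N t zs = cl N t ws"
      using eq_rel_Class[OF eqfm] z(1) w(1) Imag by simp
    finally show ?thesis
      by (simp add: Imag)
  qed
  then show ?case
    using z(2) w(2) by (simp add: tsort_eq[OF t(1)])
next
  case (Rel r us)
  let ?ev = "\<lambda>u. map (eval N e' (concat \<beta>s)) (ttm nm \<Gamma> u)"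
  let ?EV = "eval Meq e (map2 (cl N) \<Gamma> \<beta>s)"
  have "map ?EV us = map Real (concat (map ?ev us))"
  proof -
    have "?EV u = Real (hd (?ev u)) \<and> length (?ev u) = 1" if u: "u \<in> set us" for u
    proof -
      obtain s where "tm_ok Leq \<Gamma> u (Home s)"
        using Rel.prems(1) u by (auto simp: eq_lang_def list_all2_conv_all_nth in_set_conv_nth)
      moreover have "enc nm (tm_fvs u) e e'"
        using Rel.prems(4) u by (auto elim!: enc_subset)
      ultimately show ?thesis
        using eval_ttm[OF Rel.prems(3), of u "Home s" nm e e'] length_tups by fastforce
    qed
    then show ?thesis
    proof (induction us)
      case (Cons u us)
      then have "map ?EV us = map Real (concat (map ?ev us))"
        by auto
      moreover obtain z where "?ev u = [z]" "?EV u = Real z"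
        using Cons.prems[of u] by (auto simp: length_Suc_conv)
      ultimately show ?case
        by simp
    qed simp
  qed
  moreover have "map Real zs \<in> rint Meq r \<longleftrightarrow> zs \<in> rint N r" for zs
    by (auto simp: eq_struct_def image_iff inj_map_eq_map inj_def)
  moreover have "map (eval N e' (concat \<beta>s)) (concat (map (ttm nm \<Gamma>) us)) = concat (map ?ev us)"
    by (simp add: map_concat o_def)
  ultimately show ?case
    by (simp only: sat.simps tfm.simps)
next
  case (And \<phi> \<psi>)
  then have "enc nm (fvs \<phi>) e e'" "enc nm (fvs \<psi>) e e'"
    by (auto elim!: enc_subset)
  then show ?case
    using And by simp
next
  case (Ex t \<phi>)
  have "sat Meq e (cl N t zs # map2 (cl N) \<Gamma> \<beta>s) \<phi> \<longleftrightarrow> sat N e' (zs @ concat \<beta>s) (tfm L nm (t # \<Gamma>) \<phi>)"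
    if "zs \<in> tups N (ar t)" for zs
    using Ex.IH[of "t # \<Gamma>" "zs # \<beta>s"] Ex.prems that by (simp add: reps_def)
  then show ?case
    by (simp add: sat_exs carr_eq_struct)
qed auto

end

section \<open>Equivalence relations of the expansion on tuples of representatives\<close>

definition dec :: "('s, 'f, 'r, 'a) struct \<Rightarrow> ('s, 'f, 'r) eqsort list \<Rightarrow> 'a list
    \<Rightarrow> ('s, 'f, 'r, 'a) eqelt list" where
  "dec N ts zs = map2 (cl N) ts (uncat ts zs)"

lemma dec_tups:
  assumes "zs \<in> tups N (concat (map ar ts))"
  shows "dec N ts zs \<in> tups (eq_struct N) ts"
  using uncat_reps[OF assms]
  by (auto simp: dec_def reps_def tups_def list_all2_conv_all_nth carr_eq_struct)

lemma dec_surj: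
  assumes "xs \<in> tups (eq_struct N) ts"
  obtains zs where "zs \<in> tups N (concat (map ar ts))" "dec N ts zs = xs"
proof -
  have len: "length xs = length ts"
    using assms by (rule length_tups)
  have "\<forall>k<length ts. \<exists>zs. zs \<in> tups N (ar (ts ! k)) \<and> xs ! k = cl N (ts ! k) zs"
    using assms by (auto simp: tups_def list_all2_conv_all_nth carr_eq_struct)
  then obtain z where z: "\<And>k. k < length ts \<Longrightarrow> z k \<in> tups N (ar (ts ! k)) \<and> xs ! k = cl N (ts ! k) (z k)"
    by metis
  define zss where "zss = map z [0..<length ts]"
  have r: "reps N zss ts"
    using z by (auto simp: reps_def zss_def list_all2_conv_all_nth)
  have "dec N ts (concat zss) = xs"
    using z len unfolding dec_def uncat_concat[OF r] by (intro nth_equalityI) (auto simp: zss_def)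
  then show thesis
    using that tups_concat[OF r] by blast
qed

text \<open>In an equivalence formula \<open>Inl j\<close> and \<open>Inr j\<close> name coordinate
  \<open>j\<close> of the first and of the second argument. Each becomes a block starting at
  \<open>off ts j\<close>, and keeping the summand keeps the two arguments apart.\<close>

definition dnm :: "('s, 'f, 'r) eqsort list \<Rightarrow> nat + nat \<Rightarrow> nat \<Rightarrow> nat + nat" where
  "dnm ts v i = map_sum (\<lambda>j. off ts j + i) (\<lambda>j. off ts j + i) v"

text \<open>The flat tuples, cut into blocks, encode their decodings in the sense of
  \<open>enc\<close>, so the translated formula expresses \<open>E\<close> for the decoded
  tuples.\<close>

lemma eq_rel_dec:
  assumes L: "lang_ok L" and N: "is_struct L N" and E: "eq_fm (eq_lang L N) (eq_struct N) ts E"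
    and zs: "zs \<in> tups N (concat (map ar ts))" and ws: "ws \<in> tups N (concat (map ar ts))"
  shows "(zs, ws) \<in> eq_rel N (concat (map ar ts)) (tfm L (dnm ts) [] E) \<longleftrightarrow>
    (dec N ts zs, dec N ts ws) \<in> eq_rel (eq_struct N) ts E"
proof -
  let ?e = "case_sum (nth (dec N ts zs)) (nth (dec N ts ws))" and ?e' = "case_sum (nth zs) (nth ws)"
  have ok: "fm_ok (eq_lang L N) [] E" and fv: "fvs E \<subseteq>
      {(ts ! i, Inl i) |i. i < length ts} \<union> {(ts ! i, Inr i) |i. i < length ts}"
    using E by (auto simp: eq_fm_def)
  have block: "uncat ts us ! k \<in> tups N (ar (ts ! k)) \<and> dec N ts us ! k = cl N (ts ! k) (uncat ts us ! k) \<and>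
      (\<forall>i<length (ar (ts ! k)). us ! (off ts k + i) = uncat ts us ! k ! i)"
    if us: "us \<in> tups N (concat (map ar ts))" and k: "k < length ts" for us k
  proof -
    have r: "reps N (uncat ts us) ts" "concat (uncat ts us) = us"
      using uncat_reps[OF us] by auto
    then have "length (uncat ts us) = length ts" "uncat ts us ! k \<in> tups N (ar (ts ! k))"
      using k by (auto simp: reps_def list_all2_conv_all_nth)
    then show ?thesis
      using nth_reps[OF r(1) k] r(2) k by (simp add: dec_def)
  qed
  have "enc N (dnm ts) (fvs E) ?e ?e'"
    unfolding enc_def[OF L N]
  proof (clarify)
    fix t v assume "(t, v) \<in> fvs E"
    then consider k where "k < length ts" "t = ts ! k" "v = Inl k" | k where "k < length ts" "t = ts ! k" "v = Inr k"
      using fv by auto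
    then show "\<exists>us\<in>tups N (ar t). ?e v = cl N t us \<and> (\<forall>i<length (ar t). ?e' (dnm ts v i) = us ! i)"
    proof cases
      case 1
      then show ?thesis
        using block[OF zs, of k] by (intro bexI[of _ "uncat ts zs ! k"]) (auto simp: dnm_def)
    next
      case 2
      then show ?thesis
        using block[OF ws, of k] by (intro bexI[of _ "uncat ts ws ! k"]) (auto simp: dnm_def)
    qed
  qed
  then have "sat (eq_struct N) ?e [] E \<longleftrightarrow> sat N ?e' [] (tfm L (dnm ts) [] E)"
    using sat_tfm[OF L N ok, of "[]" "dnm ts" ?e ?e'] by (simp add: reps_def)
  then show ?thesis
    using zs ws dec_tups by (auto simp: eq_rel_def)
qed

text \<open>An imaginary element is the value of a projection at any of its representatives, and
  automorphisms commute with functions. Hence an automorphism of the expansion is determined by its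
  action on the home sorts.\<close>

lemma Aut_cl:
  assumes L: "lang_ok L" and g: "g \<in> Aut (eq_lang L N) (eq_struct N)"
    and t: "t \<in> sorts (eq_lang L N)" and zs: "zs \<in> tups N (ar t)"
  shows "map (\<lambda>z. the_real (g (Real z))) zs \<in> tups N (ar t) \<and>
    g (cl N t zs) = cl N t (map (\<lambda>z. the_real (g (Real z))) zs)"
proof -
  have *: "the_real (g (Real z)) \<in> carr N s \<and> Real (the_real (g (Real z))) = g (Real z)"
    if "z \<in> carr N s" "s \<in> sorts L" for s z
  proof -
    have "g ` carr (eq_struct N) (Home s) = carr (eq_struct N) (Home s)"
      using g that by (simp add: Aut_def eq_lang_def)
    then have "g ` Real ` carr N s = Real ` carr N s"
      by (simp add: eq_struct_def)
    then have "g (Real z) \<in> Real ` carr N s"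
      using that by blast
    then show ?thesis
      by auto
  qed
  have **: "map (\<lambda>z. the_real (g (Real z))) zs \<in> tups N (ar t)"
    using zs ar_sorts[OF t] * by (auto simp: tups_def list_all2_conv_all_nth subset_iff)
  moreover have "g (cl N t zs) = cl N t (map (\<lambda>z. the_real (g (Real z))) zs)"
  proof (cases t)
    case (Home s)
    then obtain z where "zs = [z]" "z \<in> carr N s" "s \<in> sorts L"
      using zs t by (auto simp: tups_def list_all2_Cons2 eq_lang_def)
    then show ?thesis
      using * Home by simp
  next
    case (Imag ss E)
    then have "Proj ss E \<in> funs (eq_lang L N)"
      using t by (auto simp: eq_lang_def)
    moreover have "map Real zs \<in> tups (eq_struct N) (fargs (eq_lang L N) (Proj ss E))"
      using zs Imag by (auto simp: tups_def list_all2_conv_all_nth eq_lang_def eq_struct_def)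
    ultimately have "g (fint (eq_struct N) (Proj ss E) (map Real zs)) =
        fint (eq_struct N) (Proj ss E) (map g (map Real zs))"
      by (rule Aut_fun[OF g])
    then show ?thesis
      using Imag by (simp add: eq_struct_def o_def)
  qed
  ultimately show ?thesis
    by blast
qed

lemma dcl_empty_fixed:
  assumes "is_struct L M" "lang_ok L" "g \<in> Aut L M" "x \<in> dcl L M {}"
  shows "g x = x"
proof -
  obtain s \<phi> where s: "s \<in> sorts L" and \<phi>: "\<phi> \<in> param_fms L M {(s, ())} {}" "solutions M s \<phi> = {x}"
    using assms(4) by (auto simp: dcl_def)
  have x: "x \<in> carr M s" "sat M (case_sum (\<lambda>_. x) (\<lambda>m. m)) [] \<phi>"
    using \<phi>(2) by (auto simp: solutions_def psat_def)
  have ok: "\<phi> \<in> okf L {(s, Inl ())}"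
    using \<phi>(1) by (auto simp: param_fms_def okf_def)
  have "sat M (g \<circ> case_sum (\<lambda>_. x) (\<lambda>m. m)) [] \<phi>"
    using sat_Aut0[OF assms(1-3) ok] x by (auto simp: wfa_def)
  moreover have "sat M (g \<circ> case_sum (\<lambda>_. x) (\<lambda>m. m)) [] \<phi> \<longleftrightarrow> sat M (case_sum (\<lambda>_. g x) (\<lambda>m. m)) [] \<phi>"
    using ok by (intro sat_cong) (auto simp: okf_def)
  ultimately have "g x \<in> solutions M s \<phi>"
    using Aut_carr[OF assms(3) s x(1)] by (auto simp: solutions_def psat_def)
  then show ?thesis
    using \<phi>(2) by simp
qed

text \<open>A finite definable equivalence relation on a product of sorts of the expansion is, after
  translation to the home sorts, given by a formula \<open>E'\<close> of \<open>L\<close>, so its classes are the elements of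
  the finite imaginary sort of \<open>E'\<close> and thus algebraic over the empty set.\<close>

lemma finite_equivalence_invariant:
  assumes L: "lang_ok L" and N: "is_struct L N" and M: "is_struct (eq_lang L N) (eq_struct N)"
    and acl: "acl (eq_lang L N) (eq_struct N) {} = dcl (eq_lang L N) (eq_struct N) {}"
    and E: "eq_fm (eq_lang L N) (eq_struct N) ts E"
    and fin: "finite (tups (eq_struct N) ts // eq_rel (eq_struct N) ts E)"
    and g: "g \<in> Aut (eq_lang L N) (eq_struct N)" and xs: "xs \<in> tups (eq_struct N) ts"
  shows "(xs, map g xs) \<in> eq_rel (eq_struct N) ts E"
proof -
  let ?Leq = "eq_lang L N" and ?Meq = "eq_struct N"
  define ss where "ss = concat (map ar ts)"
  define E' where "E' = tfm L (dnm ts) [] E"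
  define R where "R = eq_rel ?Meq ts E"
  define R' where "R' = eq_rel N ss E'"
  have ts: "ts \<noteq> []" "set ts \<subseteq> sorts ?Leq" "fm_ok ?Leq [] E" and fv: "fvs E \<subseteq>
      {(ts ! i, Inl i) |i. i < length ts} \<union> {(ts ! i, Inr i) |i. i < length ts}"
    and R: "equiv (tups ?Meq ts) R"
    using E by (auto simp: eq_fm_def R_def)
  have R'_iff: "(zs, ws) \<in> R' \<longleftrightarrow> zs \<in> tups N ss \<and> ws \<in> tups N ss \<and> (dec N ts zs, dec N ts ws) \<in> R" for zs ws
  proof (cases "zs \<in> tups N ss \<and> ws \<in> tups N ss")
    case True
    then show ?thesis
      using eq_rel_dec[OF L N E, of zs ws] by (simp add: R'_def R_def ss_def E'_def)
  qed (auto simp: R'_def eq_rel_def)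
  have dec: "dec N ts zs \<in> tups ?Meq ts" if "zs \<in> tups N ss" for zs
    using that dec_tups unfolding ss_def by blast
  have R': "equiv (tups N ss) R'"
  proof (rule equivI)
    show "R' \<subseteq> tups N ss \<times> tups N ss"
      using R'_iff by auto
    show "refl_on (tups N ss) R'"
      using R dec by (auto simp: refl_on_def R'_iff equiv_def)
    show "sym R'"
      using R by (auto simp: sym_def R'_iff equiv_def)
    show "trans R'"
      using R unfolding trans_def R'_iff equiv_def by blast
  qed
  have eqfm: "eq_fm L N ss E'"
  proof -
    have "ss \<noteq> []"
      using ts ar_sorts[of "hd ts" L N] by (cases ts) (auto simp: ss_def)
    moreover have "set ss \<subseteq> sorts L"
      using ts(2) ar_sorts by (fastforce simp: ss_def)
    moreover have "fm_ok L [] E'"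
      using fm_ok_tfm[OF L N ts(3), of "dnm ts"] by (simp add: E'_def)
    moreover have "fvs E' \<subseteq> {(ss ! i, Inl i) |i. i < length ss} \<union> {(ss ! i, Inr i) |i. i < length ss}"
    proof
      fix q assume "q \<in> fvs E'"
      then obtain t v i where *: "(t, v) \<in> fvs E" "i < length (ar t)" "q = (ar t ! i, dnm ts v i)"
        using fvs_tfm[OF L N ts(3), of "fst q" "snd q" "dnm ts"] by (cases q) (auto simp: E'_def)
      then obtain k where "k < length ts" "t = ts ! k" "v = Inl k \<or> v = Inr k"
        using fv by auto
      then show "q \<in> {(ss ! i, Inl i) |i. i < length ss} \<union> {(ss ! i, Inr i) |i. i < length ss}"
        using * nth_sorts[of k ts i] by (auto simp: ss_def dnm_def)
    qed
    ultimately show ?thesis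
      using R' by (simp add: eq_fm_def R'_def)
  qed
  \<comment> \<open>Every class of \<open>R'\<close> is the preimage under decoding of a class of
    \<open>R\<close>.\<close>
  have fin': "finite (tups N ss // R')"
  proof (rule finite_subset)
    show "tups N ss // R' \<subseteq> (\<lambda>C. {zs \<in> tups N ss. dec N ts zs \<in> C}) ` (tups ?Meq ts // R)"
    proof
      fix D assume "D \<in> tups N ss // R'"
      then obtain zs where zs: "zs \<in> tups N ss" "D = R' `` {zs}"
        by (auto simp: quotient_def)
      then have "D = {ws \<in> tups N ss. dec N ts ws \<in> R `` {dec N ts zs}}"
        using R'_iff by auto
      then show "D \<in> (\<lambda>C. {zs \<in> tups N ss. dec N ts zs \<in> C}) ` (tups ?Meq ts // R)"
        using dec[OF zs(1)] by (auto intro: quotientI)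
    qed
  qed (use fin in \<open>simp add: R_def\<close>)
  let ?t = "Imag ss E' :: ('a, 'b, 'c) eqsort"
  have t: "?t \<in> sorts ?Leq"
    using eqfm by (simp add: eq_lang_def)
  have carr_t: "finite (carr ?Meq ?t)"
    using fin' by (simp add: eq_struct_def R'_def)
  obtain zs where zs: "zs \<in> tups N ss" "dec N ts zs = xs"
    using dec_surj[OF xs] unfolding ss_def by blast
  define x where "x = cl N ?t zs"
  have x: "x \<in> carr ?Meq ?t"
    using zs by (simp add: carr_eq_struct x_def)
  \<comment> \<open>The trivial equation defines the whole sort.\<close>
  define \<phi> :: "(('a, 'b, 'c) eqsort, ('a, 'b, 'c) eqfun, 'c, unit + ('a, 'b, 'c, 'd) eqelt) fm" where
    "\<phi> = Eq (FV ?t (Inl ())) (FV ?t (Inl ()))"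
  have "\<phi> \<in> param_fms ?Leq ?Meq {(?t, ())} {}" "solutions ?Meq ?t \<phi> = carr ?Meq ?t"
    using t by (auto simp: \<phi>_def param_fms_def tm_ok_iff solutions_def psat_def)
  then have "x \<in> acl ?Leq ?Meq {}"
    using t x carr_t unfolding acl_def mem_Collect_eq by (intro bexI[of _ ?t] bexI[of _ \<phi>]) simp_all
  then have gx: "g x = x"
    using dcl_empty_fixed[OF M lang_ok_eq[OF L] g] acl by simp
  \<comment> \<open>\<open>h\<close> is the action of \<open>g\<close> on representatives. As
    \<open>g\<close> fixes the element represented by \<open>zs\<close>, the tuple \<open>zs\<close>
    and its image under \<open>h\<close> are related by \<open>R'\<close>.\<close>
  define h where "h = (\<lambda>z. the_real (g (Real z)))"
  have hz: "map h zs \<in> tups N ss" "g x = cl N ?t (map h zs)"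
    using Aut_cl[OF L g t, of zs] zs by (simp_all add: h_def x_def)
  then have "(zs, map h zs) \<in> R'"
    using gx eq_rel_Class[OF L N eqfm zs(1) hz(1)] by (simp add: x_def R'_def)
  then have "(xs, dec N ts (map h zs)) \<in> R"
    using R'_iff zs by simp
  moreover have "dec N ts (map h zs) = map g xs"
  proof -
    have r: "reps N (uncat ts zs) ts" "concat (uncat ts zs) = zs"
      using uncat_reps zs(1) unfolding ss_def by blast+
    have len: "length (uncat ts zs) = length ts"
      using r(1) by (simp add: reps_def list_all2_lengthD)
    have Aut: "map h (uncat ts zs ! k) \<in> tups N (ar (ts ! k)) \<and>
        g (cl N (ts ! k) (uncat ts zs ! k)) = cl N (ts ! k) (map h (uncat ts zs ! k))"
      if "k < length ts" for k
      unfolding h_def using that ts(2) r(1)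
      by (intro Aut_cl[OF L g]) (auto simp: reps_def list_all2_conv_all_nth)
    have "reps N (map (map h) (uncat ts zs)) ts"
      using Aut len by (simp add: reps_def list_all2_conv_all_nth)
    then have "uncat ts (concat (map (map h) (uncat ts zs))) = map (map h) (uncat ts zs)"
      by (rule uncat_concat)
    moreover have "concat (map (map h) (uncat ts zs)) = map h zs"
      using r(2) by (metis map_concat)
    ultimately have "dec N ts (map h zs) = map2 (cl N) ts (map (map h) (uncat ts zs))"
      by (simp add: dec_def)
    also have "\<dots> = map g (dec N ts zs)"
      using Aut len by (intro nth_equalityI) (simp_all add: dec_def)
    finally show ?thesis
      using zs by simp
  qed
  ultimately show ?thesis
    by (simp add: R_def)
qed

section \<open>Connectedness of the Lascar group\<close>

text \<open>Splitting \<open>S\<close> by the truth value of \<open>\<delta>\<close> leaves two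
  parts that the remaining formulas need not decide, so the induction hypothesis is applied to their
  saturations \<open>S'\<close>. Where \<open>\<delta>\<close> has the matching truth value, these
  agree with \<open>S\<close>.\<close>

lemma boolean_definable:
  assumes "finite \<Delta>" "\<Delta> \<subseteq> okf L V" "\<phi>0 \<in> okf L V"
    and "\<And>g g'. g \<in> D \<Longrightarrow> g' \<in> D \<Longrightarrow> (\<forall>\<delta>\<in>\<Delta>. sat M (E g) [] \<delta> \<longleftrightarrow> sat M (E g') [] \<delta>) \<Longrightarrow> g \<in> S \<longleftrightarrow> g' \<in> S"
  shows "\<exists>\<phi>\<in>okf L V. \<forall>g\<in>D. g \<in> S \<longleftrightarrow> sat M (E g) [] \<phi>"
  using assms(1,2,4)
proof (induction arbitrary: S rule: finite_induct)
  case empty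
  let ?T = "Neg (And \<phi>0 (Neg \<phi>0))"
  show ?case
  proof (cases "D \<subseteq> S")
    case True
    then show ?thesis
      using assms(3) by (intro bexI[of _ ?T]) auto
  next
    case False
    then have "g \<notin> S" if "g \<in> D" for g
      using empty.prems(2) that by blast
    then show ?thesis
      using assms(3) by (intro bexI[of _ "Neg ?T"]) auto
  qed
next
  case (insert \<delta> \<Delta>)
  define S' where "S' c = {g \<in> D. \<exists>g'\<in>D \<inter> S. (sat M (E g') [] \<delta> \<longleftrightarrow> c) \<and>
    (\<forall>\<delta>\<in>\<Delta>. sat M (E g) [] \<delta> \<longleftrightarrow> sat M (E g') [] \<delta>)}" for c
  have "\<exists>\<phi>\<in>okf L V. \<forall>g\<in>D. g \<in> S' c \<longleftrightarrow> sat M (E g) [] \<phi>" for c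
    using insert.prems(1) by (intro insert.IH) (auto simp: S'_def)
  then obtain \<phi> where \<phi>: "\<And>c. \<phi> c \<in> okf L V" "\<And>c g. g \<in> D \<Longrightarrow> g \<in> S' c \<longleftrightarrow> sat M (E g) [] (\<phi> c)"
    by metis
  have "g \<in> S \<longleftrightarrow> g \<in> S' (sat M (E g) [] \<delta>)" if g: "g \<in> D" for g
  proof
    assume "g \<in> S' (sat M (E g) [] \<delta>)"
    then obtain g' where "g' \<in> D \<inter> S" "\<forall>\<delta>\<in>insert \<delta> \<Delta>. sat M (E g) [] \<delta> \<longleftrightarrow> sat M (E g') [] \<delta>"
      unfolding S'_def by blast
    then show "g \<in> S"
      using insert.prems(2)[of g g'] g by blast
  qed (use g in \<open>auto simp: S'_def\<close>)
  then have "g \<in> S \<longleftrightarrow> sat M (E g) [] (Neg (And (Neg (And \<delta> (\<phi> True))) (Neg (And (Neg \<delta>) (\<phi> False)))))"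
    if "g \<in> D" for g
    using \<phi>(2) that by (cases "sat M (E g) [] \<delta>") simp_all
  moreover have "Neg (And (Neg (And \<delta> (\<phi> True))) (Neg (And (Neg \<delta>) (\<phi> False)))) \<in> okf L V"
    using \<phi>(1) insert.prems(1) by simp
  ultimately show ?case
    by blast
qed

lemma wfaD: "wfa M V e \<Longrightarrow> (s, v) \<in> V \<Longrightarrow> e v \<in> carr M s"
  by (auto simp: wfa_def)

lemma wfa_rename:
  assumes "wfa M V e" "\<And>s v. (s, v) \<in> W \<Longrightarrow> (s, \<rho> v) \<in> V"
  shows "wfa M W (e \<circ> \<rho>)"
  using wfaD[OF assms(1) assms(2)] by (auto simp: wfa_def)

lemma finite_quotientI:
  assumes R: "equiv A R" and "finite B" "f ` A \<subseteq> B"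
    and "\<And>x y. x \<in> A \<Longrightarrow> y \<in> A \<Longrightarrow> f x = f y \<Longrightarrow> (x, y) \<in> R"
  shows "finite (A // R)"
proof (rule finite_subset)
  show "A // R \<subseteq> (\<lambda>D. R `` {SOME y. y \<in> A \<and> f y = D}) ` B"
  proof
    fix C assume "C \<in> A // R"
    then obtain x where x: "x \<in> A" "C = R `` {x}"
      by (auto simp: quotient_def)
    define y where "y = (SOME y. y \<in> A \<and> f y = f x)"
    have "y \<in> A \<and> f y = f x"
      unfolding y_def by (rule someI[of _ x]) (use x in simp)
    then have "(x, y) \<in> R"
      using assms(4)[of x y] x(1) by simp
    then have "C = R `` {y}"
      using x(2) equiv_class_eq[OF R] by blast
    then show "C \<in> (\<lambda>D. R `` {SOME y. y \<in> A \<and> f y = D}) ` B"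
      using x(1) assms(3) unfolding y_def by blast
  qed
qed (use assms(2) in simp)

text \<open>The names follow the convention for formulas defining imaginary sorts, so a formula over
  \<open>pvars ts\<close> can serve directly as an equivalence formula.\<close>

definition pvars :: "'s list \<Rightarrow> ('s \<times> (nat + nat)) set" where
  "pvars ts = {(ts ! i, Inl i) |i. i < length ts} \<union> {(ts ! i, Inr i) |i. i < length ts}"

abbreviation pasg :: "'a list \<Rightarrow> 'a list \<Rightarrow> nat + nat \<Rightarrow> 'a" where
  "pasg xs ys \<equiv> case_sum (nth xs) (nth ys)"

lemma sat_pasg_rename:
  assumes "\<phi> \<in> okf L (pvars ts)"
    "\<And>i. i < length ts \<Longrightarrow> e (\<rho> (Inl i)) = xs ! i" "\<And>i. i < length ts \<Longrightarrow> e (\<rho> (Inr i)) = ys ! i"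
  shows "sat M e [] (fm_rename \<rho> \<phi>) \<longleftrightarrow> sat M (pasg xs ys) [] \<phi>"
  unfolding sat_rename[OF assms(1)]
proof (rule sat_cong)
  fix s v assume "(s, v) \<in> fvs \<phi>"
  then have "(s, v) \<in> pvars ts"
    using assms(1) by (auto simp: okf_def)
  then show "(e \<circ> \<rho>) v = pasg xs ys v"
    using assms(2,3) by (auto simp: pvars_def)
qed

context monster_model
begin

lemma tups_Aut: "set ts \<subseteq> sorts L \<Longrightarrow> xs \<in> tups M ts \<Longrightarrow> g \<in> Aut L M \<Longrightarrow> map g xs \<in> tups M ts"
  by (rule Aut_map_tups)

lemma sat_pasg_Aut:
  assumes "\<phi> \<in> okf L (pvars ts)" "xs \<in> tups M ts" "ys \<in> tups M ts" "g \<in> Aut L M"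
  shows "sat M (pasg (map g xs) (map g ys)) [] \<phi> \<longleftrightarrow> sat M (pasg xs ys) [] \<phi>"
proof -
  have len: "length xs = length ts" "length ys = length ts"
    using assms(2,3) length_tups by blast+
  have "wfa M (pvars ts) (pasg xs ys)"
    using assms(2,3) by (auto simp: wfa_def pvars_def tups_def list_all2_conv_all_nth)
  then have "sat M (g \<circ> pasg xs ys) [] \<phi> \<longleftrightarrow> sat M (pasg xs ys) [] \<phi>"
    by (rule sat_Aut0[OF str lok assms(4,1)])
  moreover have "sat M (g \<circ> pasg xs ys) [] \<phi> \<longleftrightarrow> sat M (pasg (map g xs) (map g ys)) [] \<phi>"
  proof (rule sat_cong)
    fix s v assume "(s, v) \<in> fvs \<phi>"
    then have "(s, v) \<in> pvars ts"
      using assms(1) by (auto simp: okf_def)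
    then show "(g \<circ> pasg xs ys) v = pasg (map g xs) (map g ys) v"
      using len by (auto simp: pvars_def)
  qed
  ultimately show ?thesis
    by simp
qed

text \<open>In \<open>avars\<close> the names \<open>Inl x\<close> are parameters from
  \<open>X\<close>, and \<open>Inr j\<close> is coordinate \<open>j\<close> of a tuple sorted like
  \<open>ms\<close>. Formulas over \<open>mvars\<close> have no parameters.\<close>

abbreviation "avars X ms \<equiv> nvars L M (Inl ` X \<union> Inr ` {..<length ms}) (case_sum id (nth ms))"
abbreviation "mvars ms \<equiv> nvars L M (Inr ` {..<length ms} :: ('a + nat) set) (case_sum id (nth ms))"
abbreviation "aasg \<equiv> \<lambda>ys. case_sum id (nth ys) :: 'a + nat \<Rightarrow> 'a"

text \<open>Otherwise compactness yields images of \<open>ms\<close> under \<open>g 0\<close>,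
  \<open>g 1\<close>, \<open>g 2\<close>, the last two of the same type over \<open>X\<close>, with
  \<open>\<phi>\<close> relating the first to exactly one of them. Some \<open>h\<close> fixing
  \<open>X\<close> carries the second to the third. But whether \<open>\<phi>\<close> relates the
  first to the image of \<open>ms\<close> under \<open>f\<close> depends only on the class of the
  inverse of \<open>f\<close> times \<open>g 0\<close>, and this class is the same for
  \<open>g 1\<close> and for \<open>h\<close> times \<open>g 1\<close>. The formulas of
  \<open>\<Delta>\<close> over \<open>mvars ms\<close> that hold in \<open>ms\<close> are the part
  of its type that is used.\<close>

lemma finitely_many_traces:
  assumes X: "elem_submodel L M X" "small \<kappa> X"
    and ts: "set ts \<subseteq> sorts L" and ms: "ms \<in> tups M ts" and \<phi>: "\<phi> \<in> okf L (pvars ts)"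
    and S: "\<And>f g. f \<in> Aut L M \<Longrightarrow> g \<in> Aut L M \<Longrightarrow> cls f = cls g \<Longrightarrow>
      sat M (pasg (map f ms) ms) [] \<phi> \<longleftrightarrow> sat M (pasg (map g ms) ms) [] \<phi>"
  shows "\<exists>\<Delta>. finite \<Delta> \<and> \<Delta> \<subseteq> okf L (avars X ms) \<and> (\<forall>xs\<in>tups M ts. \<forall>ys\<in>tups M ts. \<forall>zs\<in>tups M ts.
       (\<forall>us\<in>{xs, ys, zs}. \<forall>\<delta>\<in>\<Delta> \<inter> okf L (mvars ms). sat M (aasg ms) [] \<delta> \<longrightarrow> sat M (aasg us) [] \<delta>) \<longrightarrow>
       (\<forall>\<delta>\<in>\<Delta>. sat M (aasg ys) [] \<delta> \<longleftrightarrow> sat M (aasg zs) [] \<delta>) \<longrightarrow>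
       (sat M (pasg xs ys) [] \<phi> \<longleftrightarrow> sat M (pasg xs zs) [] \<phi>))"
    (is "\<exists>\<Delta>. finite \<Delta> \<and> \<Delta> \<subseteq> _ \<and> ?P \<Delta>")
proof (rule ccontr)
  let ?n = "length ms"
  have n: "length ts = ?n"
    using length_tups[OF ms] by simp
  have XU: "X \<subseteq> U"
    using X(1) by (simp add: elem_submodel_def)
  have msU: "ms ! j \<in> U" if "j < ?n" for j
    using tups_univ[OF ts ms] that by auto
  \<comment> \<open>\<open>W 0\<close>, \<open>W 1\<close>, \<open>W 2\<close> play the roles of
    \<open>xs\<close>, \<open>ys\<close>, \<open>zs\<close> in a failure of the claim for
    \<open>\<Delta>\<close>.\<close>
  define good where "good \<Delta> W \<longleftrightarrow>
       (\<forall>k<3. W k \<in> tups M ts) \<and>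
       (\<forall>k<3. \<forall>\<delta>\<in>\<Delta> \<inter> okf L (mvars ms). sat M (aasg ms) [] \<delta> \<longrightarrow> sat M (aasg (W k)) [] \<delta>) \<and>
       (\<forall>\<delta>\<in>\<Delta>. sat M (aasg (W 1)) [] \<delta> \<longleftrightarrow> sat M (aasg (W 2)) [] \<delta>) \<and>
       \<not> (sat M (pasg (W 0) (W 1)) [] \<phi> \<longleftrightarrow> sat M (pasg (W 0) (W 2)) [] \<phi>)" for \<Delta> and W :: "nat \<Rightarrow> 'a list"
  assume no: "\<not> ?thesis"
  have ex: "\<exists>W. good \<Delta> W" if "finite \<Delta>" "\<Delta> \<subseteq> okf L (avars X ms)" for \<Delta>
  proof (rule ccontr)
    assume none: "\<nexists>W. good \<Delta> W"
    have "?P \<Delta>"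
    proof (intro ballI impI)
      fix xs ys zs assume *: "xs \<in> tups M ts" "ys \<in> tups M ts" "zs \<in> tups M ts"
       "\<forall>us\<in>{xs, ys, zs}. \<forall>\<delta>\<in>\<Delta> \<inter> okf L (mvars ms). sat M (aasg ms) [] \<delta> \<longrightarrow> sat M (aasg us) [] \<delta>"
       "\<forall>\<delta>\<in>\<Delta>. sat M (aasg ys) [] \<delta> \<longleftrightarrow> sat M (aasg zs) [] \<delta>"
      have "\<not> good \<Delta> (\<lambda>k. if k = 0 then xs else if k = 1 then ys else zs)"
        using none by blast
      then show "sat M (pasg xs ys) [] \<phi> \<longleftrightarrow> sat M (pasg xs zs) [] \<phi>"
        unfolding good_def using * by (simp split: if_splits)
    qed
    with no that show False
      by blast
  qed
  define \<D> where "\<D> = okf L (avars X ms)"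
  define F where "F = finite_subsets_at_top \<D>"
  \<comment> \<open>Indices that are not finite subsets of \<open>\<D>\<close> get a failure for the
    empty set. This makes \<open>W\<close> total, and the filter disregards them.\<close>
  have "\<exists>W. good (if finite \<Delta> \<and> \<Delta> \<subseteq> \<D> then \<Delta> else {}) W" for \<Delta>
    by (rule ex) (auto simp: \<D>_def)
  then obtain W where W: "\<And>\<Delta>. good (if finite \<Delta> \<and> \<Delta> \<subseteq> \<D> then \<Delta> else {}) (W \<Delta>)"
    by metis
  have ev_W: "\<forall>\<^sub>F \<Delta> in F. \<delta> \<in> \<Delta> \<and> good \<Delta> (W \<Delta>)" if "\<delta> \<in> \<D>" for \<delta>
    unfolding F_def eventually_finite_subsets_at_top
  proof (intro exI[of _ "{\<delta>}"] conjI allI impI)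
    fix \<Delta> assume "finite \<Delta> \<and> {\<delta>} \<subseteq> \<Delta> \<and> \<Delta> \<subseteq> \<D>"
    then show "\<delta> \<in> \<Delta>" "good \<Delta> (W \<Delta>)"
      using W[of \<Delta>] by simp_all
  qed (use that in auto)
  have W_tups: "W \<Delta> k \<in> tups M ts" if "k < 3" for \<Delta> k
    using W[of \<Delta>] that unfolding good_def by blast
  have W_neq: "\<not> (sat M (pasg (W \<Delta> 0) (W \<Delta> 1)) [] \<phi> \<longleftrightarrow> sat M (pasg (W \<Delta> 0) (W \<Delta> 2)) [] \<phi>)" for \<Delta>
    using W[of \<Delta>] unfolding good_def by blast
  \<comment> \<open>The names are the elements of \<open>X\<close>, which are to keep their values,
    and three copies of the coordinates of \<open>ms\<close>.\<close>
  define N where "N = Inl ` X \<union> Inr ` ({..<3 :: nat} \<times> {..<?n})"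
  define val where "val = case_sum id (\<lambda>(k :: nat, j). ms ! j)"
  define V where "V = nvars L M N val"
  define E where "E \<Delta> = case_sum id (\<lambda>(k, j). W \<Delta> k ! j)" for \<Delta>
  have smN: "small \<kappa> N"
    unfolding N_def by (intro small_Un small_image X small_finite) auto
  have sort_ms: "s = ts ! j" if "ms ! j \<in> carr M s" "s \<in> sorts L" "j < ?n" for s j
  proof (rule sort_unique[OF that(2) _ that(1)])
    show "ts ! j \<in> sorts L"
      using ts that(3) n by (metis nth_mem subsetD)
    show "ms ! j \<in> carr M (ts ! j)"
      using ms that(3) n by (auto simp: tups_def list_all2_conv_all_nth)
  qed
  have wfE: "wfa M V (E \<Delta>)" for \<Delta>
  proof -
    have "E \<Delta> v \<in> carr M s" if sv: "(s, v) \<in> V" for s v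
    proof (cases v)
      case (Inl x)
      then show ?thesis
        using sv by (auto simp: V_def nvars_def val_def E_def)
    next
      case (Inr q)
      then obtain k j where q: "v = Inr (k, j)" "k < 3" "j < ?n" "ms ! j \<in> carr M s" "s \<in> sorts L"
        using sv by (cases q) (auto simp: V_def nvars_def val_def N_def)
      then have "s = ts ! j"
        using sort_ms by blast
      then show ?thesis
        using W_tups[OF q(2), of \<Delta>] q n by (auto simp: E_def tups_def list_all2_conv_all_nth)
    qed
    then show ?thesis
      by (auto simp: wfa_def)
  qed
  have F: "F \<noteq> bot"
    by (simp add: F_def)
  have V: "varset L V" "small \<kappa> V"
    unfolding V_def by (rule varset_nvars, rule small_nvars[OF smN])
  define C where "C = {(s, v) \<in> V. v \<in> Inl ` X}"
  have CV: "C \<subseteq> V"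
    by (auto simp: C_def)
  have EC: "E \<Delta> v = case_sum id undefined v" if "(s, v) \<in> C" for s v \<Delta>
    using that by (auto simp: E_def C_def)
  obtain e where e: "wfa M V e" "\<And>s v. (s, v) \<in> C \<Longrightarrow> e v = case_sum id undefined v"
    "\<And>\<phi>. \<phi> \<in> okf L V \<Longrightarrow> (\<forall>\<^sub>F \<Delta> in F. sat M (E \<Delta>) [] \<phi>) \<Longrightarrow> sat M e [] \<phi>"
  proof (rule compactness[where E = E, OF V F wfE CV])
    show "E \<Delta> v = case_sum id undefined v" if "(s, v) \<in> C" for s v \<Delta>
      using that by (rule EC)
  qed (rule that)
  have eX: "e (Inl x) = x" if "x \<in> X" for x
  proof -
    obtain s where "s \<in> sorts L" "x \<in> carr M s"
      using XU \<open>x \<in> X\<close> unfolding univ_def by blast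
    then show ?thesis
      using e(2)[of s "Inl x"] that by (simp add: C_def V_def nvars_def val_def N_def)
  qed
  define \<rho> :: "nat \<Rightarrow> 'a + nat \<Rightarrow> 'a + nat \<times> nat" where "\<rho> k = case_sum Inl (\<lambda>j. Inr (k, j))" for k
  have \<rho>: "fm_rename (\<rho> k) \<delta> \<in> okf L V" if "\<delta> \<in> \<D>" "k < 3" for k \<delta>
    using that(1) unfolding \<D>_def V_def
    by (rule nvars_rename) (use that(2) in \<open>auto simp: \<rho>_def N_def val_def\<close>)
  have E\<rho>: "sat M (E \<Delta>) [] (fm_rename (\<rho> k) \<delta>) \<longleftrightarrow> sat M (aasg (W \<Delta> k)) [] \<delta>" if "\<delta> \<in> \<D>" for k \<delta> \<Delta>
  proof -
    have "E \<Delta> \<circ> \<rho> k = aasg (W \<Delta> k)"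
      by (auto simp: E_def \<rho>_def split: sum.splits)
    then show ?thesis
      using sat_rename[of \<delta> L "avars X ms" M "E \<Delta>" "\<rho> k"] that by (simp only: \<D>_def)
  qed
  have e\<rho>: "sat M e [] (fm_rename (\<rho> k) \<delta>) \<longleftrightarrow> sat M (e \<circ> \<rho> k) [] \<delta>" if "\<delta> \<in> \<D>" for k \<delta>
    using sat_rename[of \<delta> L "avars X ms" M e "\<rho> k"] that by (simp only: \<D>_def)
  have wf\<rho>: "wfa M (avars X ms) (e \<circ> \<rho> k)" if "k < 3" for k
  proof -
    have "(s, \<rho> k v) \<in> V" if "(s, v) \<in> avars X ms" for s v
      using that \<open>k < 3\<close> by (auto simp: V_def nvars_def val_def N_def \<rho>_def)
    then show ?thesis
      by (rule wfa_rename[OF e(1)])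
  qed
  have mv: "mvars ms \<subseteq> avars X ms"
    by (auto simp: nvars_def)
  \<comment> \<open>Each copy realizes the type of \<open>ms\<close> over the empty set, because
    every formula of that type eventually belongs to \<open>\<Delta>\<close>.\<close>
  have "\<exists>g\<in>Aut L M. \<forall>j<?n. g (ms ! j) = e (Inr (k, j))" if k: "k < 3" for k
  proof -
    obtain g where g: "g \<in> Aut L M" "\<And>v. v \<in> Inr ` {..<?n} \<Longrightarrow> g (aasg ms v) = (e \<circ> \<rho> k) v"
    proof (rule homogeneity_nvars)
      show "small \<kappa> (Inr ` {..<?n} :: ('a + nat) set)"
        by (intro small_image small_finite) simp
      show "aasg ms v \<in> U" if "v \<in> Inr ` {..<?n}" for v
        using that msU by auto
      show "wfa M (mvars ms) (aasg ms)"
        by (auto simp: wfa_def nvars_def)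
      show "wfa M (mvars ms) (e \<circ> \<rho> k)"
        using wf\<rho>[OF k] mv by (auto simp: wfa_def)
      show "sat M (e \<circ> \<rho> k) [] \<delta>" if \<delta>: "\<delta> \<in> okf L (mvars ms)" "sat M (aasg ms) [] \<delta>" for \<delta>
      proof -
        have D: "\<delta> \<in> \<D>"
          using okf_mono[OF \<delta>(1) mv] by (simp add: \<D>_def)
        have "\<forall>\<^sub>F \<Delta> in F. sat M (E \<Delta>) [] (fm_rename (\<rho> k) \<delta>)"
          using ev_W[OF D]
        proof (rule eventually_mono)
          fix \<Delta> assume "\<delta> \<in> \<Delta> \<and> good \<Delta> (W \<Delta>)"
          then show "sat M (E \<Delta>) [] (fm_rename (\<rho> k) \<delta>)"
            using \<delta> k E\<rho>[OF D] unfolding good_def by blast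
        qed
        then show ?thesis
          using e(3)[OF \<rho>[OF D k]] e\<rho>[OF D] by blast
      qed
    qed (rule that)
    have "g (ms ! j) = e (Inr (k, j))" if "j < ?n" for j
      using g(2)[of "Inr j"] that by (simp add: \<rho>_def)
    then show ?thesis
      using g(1) by blast
  qed
  then obtain g where g: "\<And>k. k < 3 \<Longrightarrow> g k \<in> Aut L M" "\<And>k j. k < 3 \<Longrightarrow> j < ?n \<Longrightarrow> g k (ms ! j) = e (Inr (k, j))"
    by metis
  \<comment> \<open>Copies 1 and 2 have the same type over \<open>X\<close>: every formula over
    \<open>X\<close> eventually belongs to \<open>\<Delta>\<close>, on which the two agree.\<close>
  obtain h where h: "h \<in> Aut L M" "\<And>v. v \<in> Inl ` X \<union> Inr ` {..<?n} \<Longrightarrow> h ((e \<circ> \<rho> 1) v) = (e \<circ> \<rho> 2) v"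
  proof (rule homogeneity_nvars)
    show "small \<kappa> (Inl ` X \<union> Inr ` {..<?n})"
      by (intro small_Un small_image X small_finite) simp
    show "aasg ms v \<in> U" if "v \<in> Inl ` X \<union> Inr ` {..<?n}" for v
      using that msU XU by auto
    show "wfa M (avars X ms) (e \<circ> \<rho> 1)" "wfa M (avars X ms) (e \<circ> \<rho> 2)"
      by (rule wf\<rho>, simp)+
    show "sat M (e \<circ> \<rho> 2) [] \<delta>" if \<delta>: "\<delta> \<in> okf L (avars X ms)" "sat M (e \<circ> \<rho> 1) [] \<delta>" for \<delta>
    proof -
      have D: "\<delta> \<in> \<D>"
        using \<delta>(1) by (simp add: \<D>_def)
      have "\<forall>\<^sub>F \<Delta> in F. sat M (E \<Delta>) [] (fm_iff (fm_rename (\<rho> 1) \<delta>) (fm_rename (\<rho> 2) \<delta>))"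
        using ev_W[OF D]
      proof (rule eventually_mono)
        fix \<Delta> assume "\<delta> \<in> \<Delta> \<and> good \<Delta> (W \<Delta>)"
        then show "sat M (E \<Delta>) [] (fm_iff (fm_rename (\<rho> 1) \<delta>) (fm_rename (\<rho> 2) \<delta>))"
          using E\<rho>[OF D] unfolding good_def by simp
      qed
      then have "sat M e [] (fm_iff (fm_rename (\<rho> 1) \<delta>) (fm_rename (\<rho> 2) \<delta>))"
        by (rule e(3)[rotated]) (simp add: \<rho>[OF D])
      then show ?thesis
        using \<delta>(2) e\<rho>[OF D] by simp
    qed
  qed (rule that)
  have hX: "h x = x" if "x \<in> X" for x
    using h(2)[of "Inl x"] that eX by (simp add: \<rho>_def)
  have h12: "h (g 1 (ms ! j)) = g 2 (ms ! j)" if "j < ?n" for j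
    using h(2)[of "Inr j"] that g(2) by (simp add: \<rho>_def)
  define \<tau> :: "nat \<Rightarrow> nat + nat \<Rightarrow> 'a + nat \<times> nat" where
    "\<tau> l = case_sum (\<lambda>j. Inr (0, j)) (\<lambda>j. Inr (l, j))" for l
  have \<tau>: "fm_rename (\<tau> l) \<phi> \<in> okf L V" if "l < 3" for l
    using \<phi>
  proof (rule rename_okf)
    show "map_prod id (\<tau> l) ` pvars ts \<subseteq> V"
      using that n ts ms
      by (auto simp: \<tau>_def pvars_def V_def nvars_def N_def val_def tups_def list_all2_conv_all_nth subset_iff)
  qed
  have "sat M e [] (Neg (fm_iff (fm_rename (\<tau> 1) \<phi>) (fm_rename (\<tau> 2) \<phi>)))"
  proof (rule e(3))
    have "sat M (E \<Delta>) [] (fm_rename (\<tau> l) \<phi>) \<longleftrightarrow> sat M (pasg (W \<Delta> 0) (W \<Delta> l)) [] \<phi>" for \<Delta> l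
      by (rule sat_pasg_rename[OF \<phi>]) (simp_all add: E_def \<tau>_def)
    then show "\<forall>\<^sub>F \<Delta> in F. sat M (E \<Delta>) [] (Neg (fm_iff (fm_rename (\<tau> 1) \<phi>) (fm_rename (\<tau> 2) \<phi>)))"
      using W_neq by simp
  qed (simp add: \<tau>)
  moreover have "sat M e [] (fm_rename (\<tau> l) \<phi>) \<longleftrightarrow> sat M (pasg (map (g 0) ms) (map (g l) ms)) [] \<phi>"
    if "l < 3" for l
    by (rule sat_pasg_rename[OF \<phi>]) (use that n g(2) in \<open>simp_all add: \<tau>_def\<close>)
  ultimately have neq: "\<not> (sat M (pasg (map (g 0) ms) (map (g 1) ms)) [] \<phi> \<longleftrightarrow>
      sat M (pasg (map (g 0) ms) (map (g 2) ms)) [] \<phi>)"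
    by simp
  \<comment> \<open>Applying the inverse of \<open>f\<close> moves the second argument back to
    \<open>ms\<close>, the position in which \<open>S\<close> applies.\<close>
  have shift: "sat M (pasg (map (g 0) ms) (map f ms)) [] \<phi> \<longleftrightarrow>
      sat M (pasg (map (inv\<^bsub>G\<^esub> f \<otimes>\<^bsub>G\<^esub> g 0) ms) ms) [] \<phi>" if f: "f \<in> Aut L M" for f
  proof -
    have "map (inv\<^bsub>G\<^esub> f) (map (g 0) ms) = map (inv\<^bsub>G\<^esub> f \<otimes>\<^bsub>G\<^esub> g 0) ms"
      using tups_univ[OF ts ms] f g(1)[of 0] by auto
    moreover have "map (inv\<^bsub>G\<^esub> f) (map f ms) = ms"
      using tups_univ[OF ts ms] f unfolding map_map by (intro map_idI) auto
    ultimately show ?thesis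
      using sat_pasg_Aut[OF \<phi> tups_Aut[OF ts ms g(1)[of 0]] tups_Aut[OF ts ms f] inv_closed[OF f]]
      by (simp only:)
  qed
  have "map (h \<otimes>\<^bsub>G\<^esub> g 1) ms = map (g 2) ms"
    using h12 h(1) g(1)[of 1] msU by (intro nth_equalityI) simp_all
  moreover have "cls h = \<one>\<^bsub>Q\<^esub>"
    using Autf_fixing[OF h(1) X hX] h(1) cls_one_iff by blast
  then have "cls (inv\<^bsub>G\<^esub> (h \<otimes>\<^bsub>G\<^esub> g 1) \<otimes>\<^bsub>G\<^esub> g 0) = cls (inv\<^bsub>G\<^esub> g 1 \<otimes>\<^bsub>G\<^esub> g 0)"
    using h(1) g(1) by simp
  then have "sat M (pasg (map (inv\<^bsub>G\<^esub> (h \<otimes>\<^bsub>G\<^esub> g 1) \<otimes>\<^bsub>G\<^esub> g 0) ms) ms) [] \<phi> \<longleftrightarrow>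
      sat M (pasg (map (inv\<^bsub>G\<^esub> g 1 \<otimes>\<^bsub>G\<^esub> g 0) ms) ms) [] \<phi>"
    using h(1) g(1) by (intro S) simp_all
  ultimately show False
    using neq shift[OF g(1)[of 1]] shift[OF mult_closed[OF h(1) g(1)[of 1]]] by (simp only:)
qed


text \<open>The form in which the equality of \<open>acl\<close> and \<open>dcl\<close> over the
  empty set enters; it keeps the arguments about automorphisms free of imaginary elements.\<close>

definition finite_equivalences_invariant :: bool where
  "finite_equivalences_invariant \<longleftrightarrow>
     (\<forall>ts (E :: ('s, 'f, 'r, nat + nat) fm) g xs. eq_fm L M ts E \<longrightarrow>
        finite (tups M ts // eq_rel M ts E) \<longrightarrow> g \<in> Aut L M \<longrightarrow> xs \<in> tups M ts \<longrightarrow>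
        (xs, map g xs) \<in> eq_rel M ts E)"

text \<open>Call two tuples equivalent if both fail \<open>\<Theta>\<close>, an approximation to the
  type of \<open>ms\<close>, or if both satisfy it and the same tuples satisfying
  \<open>\<Theta>\<close> are related to them by \<open>\<phi>\<close>. This relation is definable
  and, by \<open>finitely_many_traces\<close>, has finitely many classes, so \<open>ms\<close> and
  its image under \<open>f\<close> are equivalent. With the image itself as test tuple,
  \<open>\<phi>\<close> relates the image to \<open>ms\<close> iff it relates the image to itself,
  which by invariance means that it relates \<open>ms\<close> to itself.\<close>

lemma connected_tuple:
  assumes FE: "finite_equivalences_invariant"
    and X: "elem_submodel L M X" "small \<kappa> X"
    and ts: "ts \<noteq> []" "set ts \<subseteq> sorts L" and ms: "ms \<in> tups M ts" and \<phi>: "\<phi> \<in> okf L (pvars ts)"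
    and S: "\<And>f g. f \<in> Aut L M \<Longrightarrow> g \<in> Aut L M \<Longrightarrow> cls f = cls g \<Longrightarrow>
      sat M (pasg (map f ms) ms) [] \<phi> \<longleftrightarrow> sat M (pasg (map g ms) ms) [] \<phi>"
    and f: "f \<in> Aut L M"
  shows "sat M (pasg (map f ms) ms) [] \<phi> \<longleftrightarrow> sat M (pasg ms ms) [] \<phi>"
proof -
  let ?n = "length ms"
  define R where "R xs ys \<longleftrightarrow> sat M (pasg xs ys) [] \<phi>" for xs ys
  have n: "length ts = ?n"
    using length_tups[OF ms] by simp
  have ms_sort: "ms ! j \<in> carr M (ts ! j)" "ts ! j \<in> sorts L" if "j < ?n" for j
    using ms n ts(2) that by (auto simp: tups_def list_all2_conv_all_nth subset_iff)
  have sort_ms: "s = ts ! j" if "ms ! j \<in> carr M s" "s \<in> sorts L" "j < ?n" for s j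
    using sort_unique[OF that(2) _ that(1)] ms_sort[OF that(3)] by blast
  obtain \<Delta> where \<Delta>: "finite \<Delta>" "\<Delta> \<subseteq> okf L (avars X ms)"
    "\<forall>xs\<in>tups M ts. \<forall>ys\<in>tups M ts. \<forall>zs\<in>tups M ts.
       (\<forall>us\<in>{xs, ys, zs}. \<forall>\<delta>\<in>\<Delta> \<inter> okf L (mvars ms). sat M (aasg ms) [] \<delta> \<longrightarrow> sat M (aasg us) [] \<delta>) \<longrightarrow>
       (\<forall>\<delta>\<in>\<Delta>. sat M (aasg ys) [] \<delta> \<longleftrightarrow> sat M (aasg zs) [] \<delta>) \<longrightarrow>
       (sat M (pasg xs ys) [] \<phi> \<longleftrightarrow> sat M (pasg xs zs) [] \<phi>)"
    using finitely_many_traces[OF X ts(2) ms \<phi> S] by blast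
  define \<Delta>0 where "\<Delta>0 = {\<delta> \<in> \<Delta> \<inter> okf L (mvars ms). sat M (aasg ms) [] \<delta>}"
  have "(ts ! 0, Inr 0) \<in> mvars ms"
  proof -
    have "0 < ?n"
      using n ts(1) by (metis length_greater_0_conv)
    then show ?thesis
      using ms_sort[of 0] by (auto simp: nvars_def)
  qed
  then have base: "Eq (FV (ts ! 0) (Inr 0)) (FV (ts ! 0) (Inr 0)) \<in> okf L (mvars ms)"
    by (rule okf_refl[OF _ varset_nvars])
  have "finite \<Delta>0" "\<Delta>0 \<subseteq> okf L (mvars ms)"
    using \<Delta>(1) by (auto simp: \<Delta>0_def)
  from finite_conj[OF this base, of M] obtain \<theta> where \<theta>: "\<theta> \<in> okf L (mvars ms)"
    "\<And>e. sat M e [] \<theta> \<longleftrightarrow> (\<forall>\<delta>\<in>\<Delta>0. sat M e [] \<delta>)"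
    by metis
  define \<Theta> where "\<Theta> ys \<longleftrightarrow> sat M (aasg ys) [] \<theta>" for ys
  have trace: "R xs ys \<longleftrightarrow> R xs zs"
    if "xs \<in> tups M ts" "ys \<in> tups M ts" "zs \<in> tups M ts" "\<Theta> xs" "\<Theta> ys" "\<Theta> zs"
      "\<forall>\<delta>\<in>\<Delta>. sat M (aasg ys) [] \<delta> \<longleftrightarrow> sat M (aasg zs) [] \<delta>" for xs ys zs
  proof -
    have *: "\<forall>us\<in>{xs, ys, zs}. \<forall>\<delta>\<in>\<Delta> \<inter> okf L (mvars ms). sat M (aasg ms) [] \<delta> \<longrightarrow> sat M (aasg us) [] \<delta>"
      using that(4-6) by (auto simp: \<Theta>_def \<theta>(2) \<Delta>0_def)
    show ?thesis
      unfolding R_def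
      by (rule \<Delta>(3)[THEN bspec, OF that(1), THEN bspec, OF that(2), THEN bspec, OF that(3),
            THEN mp, OF *, THEN mp, OF that(7)])
  qed
  define P where "P ys zs \<longleftrightarrow> (\<Theta> ys \<longleftrightarrow> \<Theta> zs) \<and> (\<Theta> ys \<longrightarrow> (\<forall>xs\<in>tups M ts. \<Theta> xs \<longrightarrow> (R xs ys \<longleftrightarrow> R xs zs)))"
    for ys zs
  have "\<exists>E\<in>okf L (pvars ts). \<forall>ys\<in>tups M ts. \<forall>zs\<in>tups M ts. sat M (pasg ys zs) [] E \<longleftrightarrow> P ys zs"
  proof -
    \<comment> \<open>Block 0 is the test tuple, which will be quantified; blocks 1 and 2 hold the
      two tuples to be compared.\<close>
    define V where "V = {(ts ! j, (k :: nat, j)) |k j. k < 3 \<and> j < ?n}"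
    define W where "W = {(ts ! j, (0 :: nat, j)) |j. j < ?n}"
    have V: "varset L V"
      using ms_sort by (auto simp: varset_def V_def inj_on_def)
    have "W = (\<lambda>j. (ts ! j, (0, j))) ` {..<?n}"
      by (auto simp: W_def)
    then have W: "finite W" "W \<subseteq> V"
      by (auto simp: V_def)
    define \<phi>' where "\<phi>' k = fm_rename (case_sum (Pair (0 :: nat)) (Pair (k :: nat))) \<phi>" for k
    \<comment> \<open>\<open>\<theta>\<close> has no parameters, so no name \<open>Inl x\<close>
      occurs in it and their image is arbitrary.\<close>
    define \<theta>' where "\<theta>' k = fm_rename (case_sum undefined (Pair (k :: nat))) \<theta>" for k
    have \<phi>': "\<phi>' k \<in> okf L V" if "k < 3" for k
      unfolding \<phi>'_def by (rule rename_okf[OF \<phi>]) (use that n in \<open>auto simp: pvars_def V_def\<close>)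
    have \<theta>': "\<theta>' k \<in> okf L V" if "k < 3" for k
      unfolding \<theta>'_def
      by (rule rename_okf[OF \<theta>(1)]) (use that sort_ms in \<open>auto simp: nvars_def V_def\<close>)
    have sat_\<phi>': "sat M e [] (\<phi>' k) \<longleftrightarrow> R xs ys"
      if "\<And>j. j < ?n \<Longrightarrow> e (0, j) = xs ! j" "\<And>j. j < ?n \<Longrightarrow> e (k, j) = ys ! j" for e k xs ys
      unfolding \<phi>'_def R_def by (rule sat_pasg_rename[OF \<phi>]) (use that n in auto)
    have sat_\<theta>': "sat M e [] (\<theta>' k) \<longleftrightarrow> \<Theta> ys" if "\<And>j. j < ?n \<Longrightarrow> e (k, j) = ys ! j" for e k ys
      unfolding \<theta>'_def \<Theta>_def sat_rename[OF \<theta>(1)]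
    proof (rule sat_cong)
      fix s v assume "(s, v) \<in> fvs \<theta>"
      then have "(s, v) \<in> mvars ms"
        using \<theta>(1) by (auto simp: okf_def)
      then show "(e \<circ> case_sum undefined (Pair k)) v = aasg ys v"
        using that by (auto simp: nvars_def)
    qed
    have "And (\<theta>' 0) (Neg (fm_iff (\<phi>' 1) (\<phi>' 2))) \<in> okf L V"
      using \<phi>' \<theta>' by simp
    \<comment> \<open>\<open>\<psi>\<close> says that some test tuple satisfying
      \<open>\<Theta>\<close> tells blocks 1 and 2 apart.\<close>
    from ex_closure[OF W this V, of M] obtain \<psi> where \<psi>: "\<psi> \<in> okf L (V - W)" "\<And>e. sat M e [] \<psi> \<longleftrightarrow>
        (\<exists>e'. (\<forall>v. v \<notin> snd ` W \<longrightarrow> e' v = e v) \<and> wfa M W e' \<and>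
          sat M e' [] (And (\<theta>' 0) (Neg (fm_iff (\<phi>' 1) (\<phi>' 2)))))"
      by (elim bexE) (rule that, auto)
    have sat_\<psi>: "sat M e [] \<psi> \<longleftrightarrow> \<not> (\<forall>xs\<in>tups M ts. \<Theta> xs \<longrightarrow> (R xs ys \<longleftrightarrow> R xs zs))"
      if e: "\<And>j. j < ?n \<Longrightarrow> e (1, j) = ys ! j" "\<And>j. j < ?n \<Longrightarrow> e (2, j) = zs ! j" for e ys zs
    proof
      assume "sat M e [] \<psi>"
      then obtain e' where e': "\<forall>v. v \<notin> snd ` W \<longrightarrow> e' v = e v" "wfa M W e'"
        "sat M e' [] (And (\<theta>' 0) (Neg (fm_iff (\<phi>' 1) (\<phi>' 2))))"
        using \<psi>(2) by blast
      define xs where "xs = map (\<lambda>j. e' (0, j)) [0..<?n]"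
      have xs: "xs ! j = e' (0, j)" if "j < ?n" for j
        using that by (simp add: xs_def)
      have "xs \<in> tups M ts"
        using e'(2) n by (auto simp: wfa_def W_def xs_def tups_def list_all2_conv_all_nth)
      moreover have nW: "(k, j) \<notin> snd ` W" if "k \<noteq> 0" for k j
        using that by (auto simp: W_def)
      have "e' (1, j) = ys ! j" "e' (2, j) = zs ! j" if "j < ?n" for j
        using e'(1) e[OF that] nW[of 1 j] nW[of 2 j] by simp_all
      then have "\<Theta> xs" "\<not> (R xs ys \<longleftrightarrow> R xs zs)"
        using e'(3) sat_\<theta>'[of e' 0 xs] sat_\<phi>'[of e' xs 1 ys] sat_\<phi>'[of e' xs 2 zs] xs by auto
      ultimately show "\<not> (\<forall>xs\<in>tups M ts. \<Theta> xs \<longrightarrow> (R xs ys \<longleftrightarrow> R xs zs))"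
        by blast
    next
      assume "\<not> (\<forall>xs\<in>tups M ts. \<Theta> xs \<longrightarrow> (R xs ys \<longleftrightarrow> R xs zs))"
      then obtain xs where xs: "xs \<in> tups M ts" "\<Theta> xs" "\<not> (R xs ys \<longleftrightarrow> R xs zs)"
        by blast
      define e' where "e' v = (if v \<in> snd ` W then xs ! snd v else e v)" for v
      have e'0: "e' (0, j) = xs ! j" if "j < ?n" for j
      proof -
        have "(0, j) \<in> snd ` W"
          using that by (force simp: W_def)
        then show ?thesis
          by (simp add: e'_def)
      qed
      have e'k: "e' (k, j) = e (k, j)" if "k \<noteq> 0" for k j
        using that by (auto simp: e'_def W_def)
      have "wfa M W e'"
        using xs(1) e'0 n by (auto simp: wfa_def W_def tups_def list_all2_conv_all_nth)
      moreover have "sat M e' [] (And (\<theta>' 0) (Neg (fm_iff (\<phi>' 1) (\<phi>' 2))))"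
        using sat_\<theta>'[of e' 0 xs] sat_\<phi>'[of e' xs 1 ys] sat_\<phi>'[of e' xs 2 zs] e'0 e'k e xs by simp
      ultimately show "sat M e [] \<psi>"
        unfolding \<psi>(2) by (intro exI[of _ e']) (auto simp: e'_def)
    qed
    define E' where "E' = And (fm_iff (\<theta>' 1) (\<theta>' 2)) (Neg (And (\<theta>' 1) \<psi>))"
    define \<rho> where "\<rho> = (\<lambda>(k :: nat, j :: nat). if k = 1 then Inl j else Inr j)"
    have E': "E' \<in> okf L V"
      using \<theta>' okf_mono[OF \<psi>(1)] by (simp add: E'_def)
    define E where "E = fm_rename \<rho> E'"
    have "E \<in> okf L (pvars ts)"
      unfolding E_def
    proof (rule rename_okf[OF E'], rule image_subsetI)
      fix q assume "q \<in> V"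
      then obtain k j where "q = (ts ! j, (k, j))" "j < length ts"
        using n by (auto simp: V_def)
      then show "map_prod id \<rho> q \<in> pvars ts"
        by (cases "k = 1") (auto simp: pvars_def \<rho>_def)
    qed
    moreover have "sat M (pasg ys zs) [] E \<longleftrightarrow> P ys zs" for ys zs
    proof -
      define e where "e = pasg ys zs \<circ> \<rho>"
      have e: "e (1, j) = ys ! j" "e (2, j) = zs ! j" for j
        by (simp_all add: \<rho>_def e_def)
      have "sat M (pasg ys zs) [] E \<longleftrightarrow> sat M e [] E'"
        unfolding E_def e_def by (rule sat_rename[OF E'])
      also have "\<dots> \<longleftrightarrow> (\<Theta> ys \<longleftrightarrow> \<Theta> zs) \<and> \<not> (\<Theta> ys \<and> sat M e [] \<psi>)"
        using sat_\<theta>'[of e 1 ys, OF e(1)] sat_\<theta>'[of e 2 zs, OF e(2)] by (simp add: E'_def)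
      also have "\<dots> \<longleftrightarrow> P ys zs"
        unfolding sat_\<psi>[of e ys zs, OF e] P_def by blast
      finally show ?thesis .
    qed
    ultimately show ?thesis
      by blast
  qed
  then obtain E where E: "E \<in> okf L (pvars ts)"
    "\<And>ys zs. ys \<in> tups M ts \<Longrightarrow> zs \<in> tups M ts \<Longrightarrow> sat M (pasg ys zs) [] E \<longleftrightarrow> P ys zs"
    by metis
  have rel: "(ys, zs) \<in> eq_rel M ts E \<longleftrightarrow> ys \<in> tups M ts \<and> zs \<in> tups M ts \<and> P ys zs" for ys zs
    using E(2) by (auto simp: eq_rel_def)
  have equiv: "equiv (tups M ts) (eq_rel M ts E)"
  proof (rule equivI)
    show "eq_rel M ts E \<subseteq> tups M ts \<times> tups M ts"
      by (auto simp: rel)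
    show "refl_on (tups M ts) (eq_rel M ts E)"
      by (auto simp: refl_on_def rel P_def)
    show "sym (eq_rel M ts E)"
      by (auto simp: sym_def rel P_def)
    show "trans (eq_rel M ts E)"
      by (auto simp: trans_def rel P_def)
  qed
  have "eq_fm L M ts E"
    using ts E(1) equiv by (auto simp: eq_fm_def okf_def pvars_def)
  \<comment> \<open>Tuples satisfying the same formulas of \<open>\<Delta>\<close> are equivalent,
    so there are at most as many classes as subsets of \<open>\<Delta>\<close>.\<close>
  moreover have "finite (tups M ts // eq_rel M ts E)"
  proof (rule finite_quotientI[OF equiv])
    show "finite (Pow \<Delta>)"
      using \<Delta>(1) by simp
    show "(\<lambda>ys. {\<delta> \<in> \<Delta>. sat M (aasg ys) [] \<delta>}) ` tups M ts \<subseteq> Pow \<Delta>"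
      by auto
    show "(ys, zs) \<in> eq_rel M ts E" if "ys \<in> tups M ts" "zs \<in> tups M ts"
      "{\<delta> \<in> \<Delta>. sat M (aasg ys) [] \<delta>} = {\<delta> \<in> \<Delta>. sat M (aasg zs) [] \<delta>}" for ys zs
    proof -
      have *: "\<forall>\<delta>\<in>\<Delta>. sat M (aasg ys) [] \<delta> \<longleftrightarrow> sat M (aasg zs) [] \<delta>"
        using that(3) by blast
      then have "\<Theta> ys \<longleftrightarrow> \<Theta> zs"
        by (auto simp: \<Theta>_def \<theta>(2) \<Delta>0_def)
      then have "P ys zs"
        unfolding P_def using trace[OF _ that(1,2) _ _ _ *] by blast
      then show ?thesis
        using that by (simp add: rel)
    qed
  qed
  ultimately have "(ms, map f ms) \<in> eq_rel M ts E"
    using FE f ms unfolding finite_equivalences_invariant_def by blast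
  then have P: "P ms (map f ms)" and fms: "map f ms \<in> tups M ts"
    by (auto simp: rel)
  have "\<Theta> ms"
    by (auto simp: \<Theta>_def \<theta>(2) \<Delta>0_def)
  then have "R (map f ms) ms \<longleftrightarrow> R (map f ms) (map f ms)"
    using P fms unfolding P_def by blast
  also have "\<dots> \<longleftrightarrow> R ms ms"
    unfolding R_def by (rule sat_pasg_Aut[OF \<phi> ms ms f])
  finally show ?thesis
    by (simp add: R_def)
qed

text \<open>\<open>S\<close> stands for a clopen subset of the Lascar group. The single formula
  obtained from \<open>\<Delta>\<close> mentions finitely many elements of \<open>A\<close>; listed
  as one tuple \<open>ms\<close>, they turn it into a relation between the image of
  \<open>ms\<close> and \<open>ms\<close>, and \<open>connected_tuple\<close> applies.\<close>

lemma connected: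
  assumes FE: "finite_equivalences_invariant"
    and X: "elem_submodel L M X" "small \<kappa> X"
    and A: "A \<subseteq> U" and \<Delta>: "finite \<Delta>" "\<Delta> \<subseteq> okf L (dvars A)"
    and S: "\<And>f g. f \<in> Aut L M \<Longrightarrow> g \<in> Aut L M \<Longrightarrow> cls f = cls g \<Longrightarrow> f \<in> S \<longleftrightarrow> g \<in> S"
    and S\<Delta>: "\<And>f g. f \<in> Aut L M \<Longrightarrow> g \<in> Aut L M \<Longrightarrow>
      \<forall>\<delta>\<in>\<Delta>. sat M (case_sum f (\<lambda>x. x)) [] \<delta> \<longleftrightarrow> sat M (case_sum g (\<lambda>x. x)) [] \<delta> \<Longrightarrow> f \<in> S \<longleftrightarrow> g \<in> S"
    and f: "f \<in> Aut L M"
  shows "f \<in> S \<longleftrightarrow> \<one>\<^bsub>G\<^esub> \<in> S"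
proof (cases "\<Delta> = {}")
  case True
  then show ?thesis
    using S\<Delta>[OF f one_closed] by simp
next
  case False
  let ?E = "\<lambda>g. case_sum g (\<lambda>x. x)"
  obtain \<phi>0 where "\<phi>0 \<in> okf L (dvars A)"
    using False \<Delta>(2) by blast
  from boolean_definable[OF \<Delta> this, of "Aut L M" M ?E S] S\<Delta>
  obtain \<phi> where \<phi>: "\<phi> \<in> okf L (dvars A)" "\<And>g. g \<in> Aut L M \<Longrightarrow> g \<in> S \<longleftrightarrow> sat M (?E g) [] \<phi>"
    by blast
  show ?thesis
  \<comment> \<open>Without free variables there is no tuple, and an equivalence formula requires a
    nonempty list of sorts.\<close>
  proof (cases "fvs \<phi> = {}")
    case True
    then have "sat M (?E f) [] \<phi> \<longleftrightarrow> sat M (?E \<one>\<^bsub>G\<^esub>) [] \<phi>"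
      by (intro sat_cong) simp
    then show ?thesis
      using \<phi>(2) f by simp
  next
    case False
    define un where "un = (case_sum id id :: 'a + 'a \<Rightarrow> 'a)"
    define m where "m = (un \<circ> snd) ` fvs \<phi>"
    have "finite m"
      by (simp add: m_def finite_fvs)
    then obtain ms where ms: "set ms = m" "distinct ms"
      using finite_distinct_list by blast
    have sv: "s \<in> sorts L \<and> un v \<in> carr M s \<and> un v \<in> A \<and> un v \<in> m" if "(s, v) \<in> fvs \<phi>" for s v
      using that \<phi>(1) by (force simp: okf_def nvars_def un_def m_def)
    define srt where "srt x = (SOME s. s \<in> sorts L \<and> x \<in> carr M s)" for x
    have srt: "srt x \<in> sorts L \<and> x \<in> carr M (srt x)" if "x \<in> m" for x
    proof -
      have "\<exists>s. s \<in> sorts L \<and> x \<in> carr M s"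
        using that sv by (force simp: m_def)
      then show ?thesis
        unfolding srt_def by (rule someI_ex)
    qed
    define ix where "ix x = (SOME j. j < length ms \<and> ms ! j = x)" for x
    have ix: "ix x < length ms \<and> ms ! ix x = x" if "x \<in> m" for x
    proof -
      have "\<exists>j. j < length ms \<and> ms ! j = x"
        using that ms(1) by (auto simp: in_set_conv_nth)
      then show ?thesis
        unfolding ix_def by (rule someI_ex)
    qed
    define ts where "ts = map srt ms"
    have mA: "m \<subseteq> A"
      using sv by (force simp: m_def)
    have ts: "ts \<noteq> []" "set ts \<subseteq> sorts L"
      using False ms(1) srt by (auto simp: ts_def m_def)
    have mts: "ms \<in> tups M ts"
      using srt ms(1) by (auto simp: ts_def tups_def list_all2_conv_all_nth)
    \<comment> \<open>\<open>Inl x\<close> becomes a coordinate of the moved tuple and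
      \<open>Inr x\<close> the same coordinate of the unmoved one.\<close>
    define \<phi>' where "\<phi>' = fm_rename (map_sum ix ix) \<phi>"
    have ok': "\<phi> \<in> okf L (fvs \<phi>)"
      using \<phi>(1) by (simp add: okf_def)
    have \<phi>'ok: "\<phi>' \<in> okf L (pvars ts)"
      unfolding \<phi>'_def
    proof (rule rename_okf[OF ok'], rule image_subsetI)
      fix q assume q: "q \<in> fvs \<phi>"
      obtain s v where sv': "q = (s, v)"
        by (cases q)
      have *: "s \<in> sorts L" "un v \<in> carr M s" "un v \<in> m"
        using sv[of s v] q sv' by auto
      then have "ts ! ix (un v) = s" "ix (un v) < length ts"
        using ix[OF *(3)] srt[OF *(3)] sort_unique[of "srt (un v)" s "un v"] by (auto simp: ts_def)
      then show "map_prod id (map_sum ix ix) q \<in> pvars ts"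
        using sv' by (cases v) (auto simp: pvars_def un_def)
    qed
    have sat': "sat M (pasg (map g ms) ms) [] \<phi>' \<longleftrightarrow> g \<in> S" if g: "g \<in> Aut L M" for g
    proof -
      have "sat M (pasg (map g ms) ms \<circ> map_sum ix ix) [] \<phi> \<longleftrightarrow> sat M (?E g) [] \<phi>"
      proof (rule sat_cong)
        fix s v assume "(s, v) \<in> fvs \<phi>"
        then have "un v \<in> m"
          using sv by blast
        then show "(pasg (map g ms) ms \<circ> map_sum ix ix) v = ?E g v"
          using ix[of "un v"] by (cases v) (auto simp: un_def)
      qed
      then show ?thesis
        using \<phi>(2)[OF g] sat_rename[OF ok', of M "pasg (map g ms) ms" "map_sum ix ix"] by (simp add: \<phi>'_def)
    qed
    have "sat M (pasg (map f ms) ms) [] \<phi>' \<longleftrightarrow> sat M (pasg ms ms) [] \<phi>'"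
    proof (rule connected_tuple[OF FE X ts mts \<phi>'ok _ f])
      fix g h assume "g \<in> Aut L M" "h \<in> Aut L M" "cls g = cls h"
      then show "sat M (pasg (map g ms) ms) [] \<phi>' \<longleftrightarrow> sat M (pasg (map h ms) ms) [] \<phi>'"
        using S[of g h] sat'[of g] sat'[of h] by simp
    qed
    moreover have "map \<one>\<^bsub>G\<^esub> ms = ms"
      using ms(1) mA A by (intro map_idI) auto
    ultimately show ?thesis
      using sat'[OF f] sat'[OF one_closed] by simp
  qed
qed

end

section \<open>Limits of automorphisms\<close>

context monster_model
begin

text \<open>A limit as in an ultraproduct, but taken inside \<open>M\<close> and controlled on
  \<open>A\<close> only. The indices are treated jointly, since relations between the automorphisms
  have to survive. Index 0 is reserved for the identity, which lets elements of \<open>A\<close>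
  appear as parameters.\<close>

definition is_limit :: "'t filter \<Rightarrow> ('t \<Rightarrow> nat \<Rightarrow> 'a \<Rightarrow> 'a) \<Rightarrow> (nat \<Rightarrow> 'a \<Rightarrow> 'a) \<Rightarrow> nat \<Rightarrow> 'a set \<Rightarrow> bool" where
  "is_limit F as \<sigma> m A \<longleftrightarrow> (\<forall>i<m. \<sigma> i \<in> Aut L M) \<and> (\<forall>x\<in>A. \<sigma> 0 x = x) \<and>
     (\<forall>\<phi>\<in>okf L (nvars L M ({..<m} \<times> A) snd).
        (\<forall>\<^sub>F t in F. sat M (\<lambda>(i, x). as t i x) [] \<phi>) \<longrightarrow> sat M (\<lambda>(i, x). \<sigma> i x) [] \<phi>)"

text \<open>Compactness gives a value for each index and each element of \<open>A\<close>, with row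
  0 kept fixed. Automorphisms preserve all formulas, so each row has the same type as
  \<open>A\<close> itself, and homogeneity extends it to an automorphism.\<close>

lemma exists_limit:
  assumes F: "F \<noteq> bot" and as: "\<And>t i. i < m \<Longrightarrow> as t i \<in> Aut L M" and A: "A \<subseteq> U" "small \<kappa> A"
    and zero: "0 < m" "\<And>t. as t 0 = \<one>\<^bsub>G\<^esub>"
  shows "\<exists>\<sigma>. is_limit F as \<sigma> m A"
proof -
  define N where "N = {..<m} \<times> A"
  define V where "V = nvars L M N snd"
  define E where "E t = (\<lambda>(i, x). as t i x)" for t
  have "N = (\<Union>i\<in>{..<m}. Pair i ` A)"
    by (auto simp: N_def)
  then have N: "small \<kappa> N"
    by (simp only:) (intro small_UN small_image A finite_lessThan)
  have V: "varset L V" "small \<kappa> V"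
    unfolding V_def by (rule varset_nvars, rule small_nvars[OF N])
  have E: "wfa M V (E t)" for t
    unfolding V_def by (rule wfa_nvars) (use as in \<open>auto simp: N_def E_def\<close>)
  define C where "C = {(s, v) \<in> V. fst v = 0}"
  have CV: "C \<subseteq> V"
    by (auto simp: C_def)
  obtain e where e: "wfa M V e" "\<And>s v. (s, v) \<in> C \<Longrightarrow> e v = snd v"
    "\<And>\<phi>. \<phi> \<in> okf L V \<Longrightarrow> (\<forall>\<^sub>F t in F. sat M (E t) [] \<phi>) \<Longrightarrow> sat M e [] \<phi>"
  proof (rule compactness[where E = E, OF V F E CV])
    show "E t v = snd v" if "(s, v) \<in> C" for s v t
      using that A(1) by (auto simp: E_def C_def V_def nvars_def N_def zero)
  qed (rule that)
  have "\<exists>g\<in>Aut L M. \<forall>x\<in>A. g x = e (i, x)" if i: "i < m" for i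
  proof -
    have N0: "map_prod id (Pair i) ` nvars L M A id \<subseteq> V"
      using i by (auto simp: V_def N_def nvars_def)
    obtain g where g: "g \<in> Aut L M" "\<And>x. x \<in> A \<Longrightarrow> g (id x) = (e \<circ> Pair i) x"
    proof (rule homogeneity_nvars[where e = id])
      show "small \<kappa> A" "\<And>x. x \<in> A \<Longrightarrow> id x \<in> U"
        using A by auto
      show "wfa M (nvars L M A id) id"
        by (auto simp: wfa_def nvars_def)
      show "wfa M (nvars L M A id) (e \<circ> Pair i)"
        using N0 by (intro wfa_rename[OF e(1)]) force
      show "sat M (e \<circ> Pair i) [] \<phi>" if \<phi>: "\<phi> \<in> okf L (nvars L M A id)" "sat M id [] \<phi>" for \<phi>
      proof -
        have "sat M (E t) [] (fm_rename (Pair i) \<phi>)" for t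
        proof -
          have "sat M (as t i \<circ> id) [] \<phi>"
            using sat_Aut0[OF str lok as[OF i] \<phi>(1), of id t] \<phi>(2) by (simp add: wfa_def nvars_def)
          moreover have "as t i \<circ> id = E t \<circ> Pair i"
            by (auto simp: E_def)
          ultimately show ?thesis
            unfolding sat_rename[OF \<phi>(1)] by (simp only:)
        qed
        then have "sat M e [] (fm_rename (Pair i) \<phi>)"
          by (intro e(3) rename_okf[OF \<phi>(1) N0]) simp
        then show ?thesis
          unfolding sat_rename[OF \<phi>(1)] .
      qed
    qed (rule that)
    then show ?thesis
      by auto
  qed
  then obtain \<sigma> where \<sigma>: "\<And>i. i < m \<Longrightarrow> \<sigma> i \<in> Aut L M" "\<And>i x. i < m \<Longrightarrow> x \<in> A \<Longrightarrow> \<sigma> i x = e (i, x)"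
    by metis
  have "sat M (\<lambda>(i, x). \<sigma> i x) [] \<phi>"
    if "\<phi> \<in> okf L V" "\<forall>\<^sub>F t in F. sat M (E t) [] \<phi>" for \<phi>
  proof -
    have "sat M (\<lambda>(i, x). \<sigma> i x) [] \<phi> \<longleftrightarrow> sat M e [] \<phi>"
    proof (rule sat_cong)
      fix s v assume "(s, v) \<in> fvs \<phi>"
      then have "(s, v) \<in> V"
        using that(1) by (auto simp: okf_def)
      then show "(\<lambda>(i, x). \<sigma> i x) v = e v"
        using \<sigma>(2) by (auto simp: V_def nvars_def N_def)
    qed
    then show ?thesis
      using e(3)[OF that] by simp
  qed
  moreover have "\<sigma> 0 x = x" if "x \<in> A" for x
  proof -
    obtain s where "s \<in> sorts L" "x \<in> carr M s"
      using \<open>x \<in> A\<close> A(1) unfolding univ_def by blast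
    then have "(s, (0, x)) \<in> C"
      using that zero(1) by (auto simp: C_def V_def nvars_def N_def)
    then show ?thesis
      using e(2) \<sigma>(2)[OF zero(1) that] by fastforce
  qed
  ultimately have "is_limit F as \<sigma> m A"
    using \<sigma>(1) unfolding is_limit_def V_def N_def E_def by blast
  then show ?thesis
    by blast
qed

lemma limit_Aut: "is_limit F as \<sigma> m A \<Longrightarrow> i < m \<Longrightarrow> \<sigma> i \<in> Aut L M"
  by (simp add: is_limit_def)

lemma limit_zero: "is_limit F as \<sigma> m A \<Longrightarrow> x \<in> A \<Longrightarrow> \<sigma> 0 x = x"
  by (simp add: is_limit_def)

lemma limit_sat:
  "is_limit F as \<sigma> m A \<Longrightarrow> \<phi> \<in> okf L (nvars L M ({..<m} \<times> A) snd) \<Longrightarrow>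
    (\<forall>\<^sub>F t in F. sat M (\<lambda>(i, x). as t i x) [] \<phi>) \<Longrightarrow> sat M (\<lambda>(i, x). \<sigma> i x) [] \<phi>"
  unfolding is_limit_def by blast

lemma limit_sat2:
  assumes lim: "is_limit F as \<sigma> m A" and "i < m" "k < m" and B: "B \<subseteq> A" and \<delta>: "\<delta> \<in> okf L (dvars B)"
    and ev: "\<forall>\<^sub>F t in F. sat M (case_sum (as t i) (as t k)) [] \<delta>"
  shows "sat M (case_sum (\<sigma> i) (\<sigma> k)) [] \<delta>"
proof -
  define \<rho> :: "'a + 'a \<Rightarrow> nat \<times> 'a" where "\<rho> = case_sum (Pair i) (Pair k)"
  have \<rho>: "(\<lambda>(i, x). g i x) \<circ> \<rho> = case_sum (g i) (g k)" for g :: "nat \<Rightarrow> 'a \<Rightarrow> 'a"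
    by (auto simp: \<rho>_def split: sum.splits)
  have "fm_rename \<rho> \<delta> \<in> okf L (nvars L M ({..<m} \<times> A) snd)"
    by (rule nvars_rename[OF \<delta>]) (use assms in \<open>auto simp: \<rho>_def\<close>)
  moreover have "\<forall>\<^sub>F t in F. sat M (\<lambda>(i, x). as t i x) [] (fm_rename \<rho> \<delta>)"
    using ev unfolding sat_rename[OF \<delta>] \<rho> .
  ultimately have "sat M (\<lambda>(i, x). \<sigma> i x) [] (fm_rename \<rho> \<delta>)"
    using lim unfolding is_limit_def by blast
  then show ?thesis
    unfolding sat_rename[OF \<delta>] \<rho> .
qed

lemma limit_eq:
  assumes lim: "is_limit F as \<sigma> m A" and ik: "i < m" "k < m" and as: "\<And>t i. i < m \<Longrightarrow> as t i \<in> Aut L M"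
    and A: "A \<subseteq> U" "x \<in> A" "y \<in> A" and eq: "\<And>t. as t i x = as t k y"
  shows "\<sigma> i x = \<sigma> k y"
proof -
  have xU: "x \<in> U" "y \<in> U"
    using A by auto
  then obtain s where s: "s \<in> sorts L" "x \<in> carr M s"
    by (auto simp: univ_def)
  have "y \<in> carr M s"
    using Aut_carr[OF as[OF ik(1)] s] Aut_carr_iff[OF as[OF ik(2)] s(1) xU(2)] eq by metis
  then have "Eq (FV s (Inl x)) (FV s (Inr y)) \<in> okf L (dvars A)"
    using s A by (auto simp: okf_def tm_ok_iff nvars_def)
  then have "sat M (case_sum (\<sigma> i) (\<sigma> k)) [] (Eq (FV s (Inl x)) (FV s (Inr y)))"
    by (rule limit_sat2[OF lim ik subset_refl]) (simp add: eq)
  then show ?thesis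
    by simp
qed

text \<open>An automorphism may move \<open>A\<close> outside \<open>A\<close>, so products of
  limits are not visible on \<open>A\<close>. What survives is that some \<open>\<tau>\<close>
  carries one pair of tuples to another: both pairs satisfy the same formulas for every
  \<open>t\<close>, hence also in the limit, and homogeneity provides a new
  \<open>\<tau>\<close>.\<close>

lemma limit_conjugation:
  assumes lim: "is_limit F as \<sigma> m A" and ij: "i < m" "j < m" "k < m" "l < m"
    and as: "\<And>t i. i < m \<Longrightarrow> as t i \<in> Aut L M" and A: "A \<subseteq> U" "small \<kappa> A"
    and conj: "\<And>t. \<exists>\<tau>\<in>Aut L M. \<forall>x\<in>A. \<tau> (as t i x) = as t j x \<and> \<tau> (as t k x) = as t l x"
  obtains \<tau> where "\<tau> \<in> Aut L M" "\<And>x. x \<in> A \<Longrightarrow> \<tau> (\<sigma> i x) = \<sigma> j x" "\<And>x. x \<in> A \<Longrightarrow> \<tau> (\<sigma> k x) = \<sigma> l x"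
proof -
  let ?N = "Inl ` A \<union> Inr ` A :: ('a + 'a) set"
  have wf: "wfa M (dvars A) (case_sum (g p) (g q))"
    if "\<And>i. i < m \<Longrightarrow> g i \<in> Aut L M" "p < m" "q < m" for g :: "nat \<Rightarrow> 'a \<Rightarrow> 'a" and p q
    by (rule wfa_nvars) (use that in auto)
  note \<sigma> = limit_Aut[OF lim]
  obtain \<tau> where \<tau>: "\<tau> \<in> Aut L M"
    "\<And>v. v \<in> ?N \<Longrightarrow> \<tau> (case_sum (\<sigma> i) (\<sigma> k) v) = case_sum (\<sigma> j) (\<sigma> l) v"
  proof (rule homogeneity_nvars)
    show "small \<kappa> ?N"
      by (intro small_Un small_image A)
    show "case_sum id id v \<in> U" if "v \<in> ?N" for v
      using that A by auto
    show "wfa M (dvars A) (case_sum (\<sigma> i) (\<sigma> k))" "wfa M (dvars A) (case_sum (\<sigma> j) (\<sigma> l))"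
      by (rule wf[OF \<sigma>]; use ij in simp)+
    show "sat M (case_sum (\<sigma> j) (\<sigma> l)) [] \<delta>"
      if \<delta>: "\<delta> \<in> okf L (dvars A)" "sat M (case_sum (\<sigma> i) (\<sigma> k)) [] \<delta>" for \<delta>
    proof -
      define \<rho> :: "nat \<Rightarrow> nat \<Rightarrow> 'a + 'a \<Rightarrow> nat \<times> 'a" where "\<rho> p q = case_sum (Pair p) (Pair q)" for p q
      have \<rho>: "(\<lambda>(i, x). g i x) \<circ> \<rho> p q = case_sum (g p) (g q)" for g :: "nat \<Rightarrow> 'a \<Rightarrow> 'a" and p q
        by (auto simp: \<rho>_def split: sum.splits)
      have ok: "fm_rename (\<rho> p q) \<delta> \<in> okf L (nvars L M ({..<m} \<times> A) snd)" if "p < m" "q < m" for p q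
        by (rule nvars_rename[OF \<delta>(1)]) (use that in \<open>auto simp: \<rho>_def\<close>)
      have "sat M (\<lambda>(i, x). as t i x) [] (fm_iff (fm_rename (\<rho> i k) \<delta>) (fm_rename (\<rho> j l) \<delta>))" for t
      proof -
        obtain \<tau> where \<tau>: "\<tau> \<in> Aut L M" "\<forall>x\<in>A. \<tau> (as t i x) = as t j x \<and> \<tau> (as t k x) = as t l x"
          using conj by blast
        have "sat M (\<tau> \<circ> case_sum (as t i) (as t k)) [] \<delta> \<longleftrightarrow> sat M (case_sum (as t i) (as t k)) [] \<delta>"
          by (rule sat_Aut0[OF str lok \<tau>(1) \<delta>(1) wf[OF as ij(1,3)]])
        moreover have "sat M (\<tau> \<circ> case_sum (as t i) (as t k)) [] \<delta> \<longleftrightarrow> sat M (case_sum (as t j) (as t l)) [] \<delta>"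
        proof (rule sat_cong)
          fix s v assume "(s, v) \<in> fvs \<delta>"
          then have "v \<in> ?N"
            using \<delta>(1) by (auto simp: okf_def nvars_def)
          then show "(\<tau> \<circ> case_sum (as t i) (as t k)) v = case_sum (as t j) (as t l) v"
            using \<tau>(2) by auto
        qed
        ultimately show ?thesis
          unfolding sat_iff sat_rename[OF \<delta>(1)] \<rho> by simp
      qed
      then have "sat M (\<lambda>(i, x). \<sigma> i x) [] (fm_iff (fm_rename (\<rho> i k) \<delta>) (fm_rename (\<rho> j l) \<delta>))"
        by (intro limit_sat[OF lim]) (simp_all add: ok ij)
      then show ?thesis
        using \<delta>(2) unfolding sat_iff sat_rename[OF \<delta>(1)] \<rho> by simp
    qed
  qed (rule that)
  show thesis
  proof (rule that[OF \<tau>(1)])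
    show "\<tau> (\<sigma> i x) = \<sigma> j x" "\<tau> (\<sigma> k x) = \<sigma> l x" if "x \<in> A" for x
      using \<tau>(2)[of "Inl x"] \<tau>(2)[of "Inr x"] that by auto
  qed
qed

text \<open>Each formula over \<open>X\<close> eventually has the same truth value for both indices,
  so the limits have the same type over \<open>X\<close>. The parameters are supplied by index
  0.\<close>

lemma limit_same_type:
  assumes lim: "is_limit F as \<sigma> m A" and ij: "i < m" "j < m" "0 < m"
    and as: "\<And>t i. i < m \<Longrightarrow> as t i \<in> Aut L M" and one: "\<And>t. as t 0 = \<one>\<^bsub>G\<^esub>"
    and X: "elem_submodel L M X" "small \<kappa> X" "X \<subseteq> A"
    and ev: "\<And>\<delta>. \<delta> \<in> okf L (dvars X) \<Longrightarrow> \<forall>\<^sub>F t in F. sat M (case_sum (as t i) (\<lambda>x. x)) [] \<delta> \<longleftrightarrow>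
      sat M (case_sum (as t j) (\<lambda>x. x)) [] \<delta>"
  shows "cls (\<sigma> i) = cls (\<sigma> j)"
proof (rule cls_eq_if_tp_eq[OF X(1,2)])
  have XU: "X \<subseteq> U"
    using X(1) by (simp add: elem_submodel_def)
  note \<sigma> = limit_Aut[OF lim]
  show "\<sigma> i \<in> Aut L M" "\<sigma> j \<in> Aut L M"
    by (rule \<sigma>, rule ij)+
  have one_U: "\<one>\<^bsub>G\<^esub> x = x" if "x \<in> X" for x
    using that XU by auto
  have cong0: "sat M (case_sum g h) [] \<delta> \<longleftrightarrow> sat M (case_sum g (\<lambda>x. x)) [] \<delta>"
    if "\<delta> \<in> okf L (dvars X)" "\<And>x. x \<in> X \<Longrightarrow> h x = x" for g h :: "'a \<Rightarrow> 'a" and \<delta> :: "('s, 'f, 'r, 'a + 'a) fm"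
  proof (rule sat_cong)
    fix s v assume "(s, v) \<in> fvs \<delta>"
    then have "v \<in> Inl ` X \<union> Inr ` X"
      using that(1) by (auto simp: okf_def nvars_def)
    then show "case_sum g h v = case_sum g (\<lambda>x. x) v"
      using that(2) by auto
  qed
  define \<rho> :: "nat \<Rightarrow> 'a + 'a \<Rightarrow> nat \<times> 'a" where "\<rho> p = case_sum (Pair p) (Pair 0)" for p
  have \<rho>: "(\<lambda>(i, x). g i x) \<circ> \<rho> p = case_sum (g p) (g 0)" for g :: "nat \<Rightarrow> 'a \<Rightarrow> 'a" and p
    by (auto simp: \<rho>_def split: sum.splits)
  have "sat M (case_sum (\<sigma> i) (\<lambda>x. x)) [] \<delta> \<longleftrightarrow> sat M (case_sum (\<sigma> j) (\<lambda>x. x)) [] \<delta>"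
    if \<delta>: "\<delta> \<in> okf L (dvars X)" for \<delta>
  proof -
    have ok: "fm_rename (\<rho> p) \<delta> \<in> okf L (nvars L M ({..<m} \<times> A) snd)" if "p < m" for p
      by (rule nvars_rename[OF \<delta>]) (use that ij X(3) in \<open>auto simp: \<rho>_def\<close>)
    have "\<forall>\<^sub>F t in F. sat M (\<lambda>(i, x). as t i x) [] (fm_iff (fm_rename (\<rho> i) \<delta>) (fm_rename (\<rho> j) \<delta>))"
      using ev[OF \<delta>]
    proof (rule eventually_mono)
      fix t assume *: "sat M (case_sum (as t i) (\<lambda>x. x)) [] \<delta> \<longleftrightarrow> sat M (case_sum (as t j) (\<lambda>x. x)) [] \<delta>"
      show "sat M (\<lambda>(i, x). as t i x) [] (fm_iff (fm_rename (\<rho> i) \<delta>) (fm_rename (\<rho> j) \<delta>))"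
        using * cong0[OF \<delta>, of "\<one>\<^bsub>G\<^esub>" "as t i"] cong0[OF \<delta>, of "\<one>\<^bsub>G\<^esub>" "as t j"] one_U
        unfolding sat_iff sat_rename[OF \<delta>] \<rho> one by simp
    qed
    then have "sat M (\<lambda>(i, x). \<sigma> i x) [] (fm_iff (fm_rename (\<rho> i) \<delta>) (fm_rename (\<rho> j) \<delta>))"
      by (rule limit_sat[OF lim, rotated]) (simp add: ok ij)
    then show ?thesis
      unfolding sat_iff sat_rename[OF \<delta>] \<rho> using cong0[OF \<delta>, of "\<sigma> 0"] limit_zero[OF lim] X(3) by auto
  qed
  then show "tp L M X (\<sigma> i) X = tp L M X (\<sigma> j) X"
    using tp_dvars_iff[OF \<sigma>[OF ij(1)] XU] tp_dvars_iff[OF \<sigma>[OF ij(2)] XU] by blast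
qed

text \<open>The conclusion of \<open>Autf_closed\<close>, saying that \<open>Autf\<close> is closed
  in the topology given by types over \<open>X\<close>. It is the form in which G-compactness is
  used from here on.\<close>

definition Autf_closed_over :: "'a set \<Rightarrow> bool" where
  "Autf_closed_over X \<longleftrightarrow> (\<forall>f\<in>Aut L M. f \<notin> Autf L \<kappa> M \<longrightarrow>
     (\<exists>\<psi>\<in>okf L (dvars X). sat M (case_sum f (\<lambda>x. x)) [] \<psi> \<and>
       (\<forall>h\<in>Autf L \<kappa> M. \<not> sat M (case_sum h (\<lambda>x. x)) [] \<psi>)))"

text \<open>Applying \<open>g\<close> removes the inverse. A condition on a quotient of two
  automorphisms becomes one on their values on \<open>X\<close>, without composition, which a limit
  can preserve.\<close>

lemma sat_shift:
  assumes f: "f \<in> Aut L M" and g: "g \<in> Aut L M" and X: "X \<subseteq> U" and \<psi>: "\<psi> \<in> okf L (dvars X)"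
  shows "sat M (case_sum (inv\<^bsub>G\<^esub> g \<otimes>\<^bsub>G\<^esub> f) (\<lambda>x. x)) [] \<psi> \<longleftrightarrow> sat M (case_sum f g) [] \<psi>"
proof -
  let ?e = "case_sum (inv\<^bsub>G\<^esub> g \<otimes>\<^bsub>G\<^esub> f) (\<lambda>x. x)"
  have "sat M (g \<circ> ?e) [] \<psi> \<longleftrightarrow> sat M ?e [] \<psi>"
    by (rule sat_Aut0[OF str lok g \<psi> wfa_dvars[OF _ X]]) (simp add: f g)
  moreover have "sat M (g \<circ> ?e) [] \<psi> \<longleftrightarrow> sat M (case_sum f g) [] \<psi>"
  proof (rule sat_cong)
    fix s v assume "(s, v) \<in> fvs \<psi>"
    then have "v \<in> Inl ` X \<union> Inr ` X"
      using \<psi> by (auto simp: okf_def nvars_def)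
    then show "(g \<circ> ?e) v = case_sum f g v"
      using X f g by auto
  qed
  ultimately show ?thesis
    by simp
qed

text \<open>Having the same class is a closed condition. If the limits had different classes, some
  formula over \<open>X\<close> would hold of the inverse of \<open>\<sigma> j\<close> times
  \<open>\<sigma> i\<close> and of no element of \<open>Autf\<close>. By \<open>sat_shift\<close>
  its negation holds of the pairs \<open>as t i\<close>, \<open>as t j\<close> for all
  \<open>t\<close>, hence of the limits.\<close>

lemma limit_cls:
  assumes lim: "is_limit F as \<sigma> m A" and ij: "i < m" "j < m"
    and as: "\<And>t i. i < m \<Longrightarrow> as t i \<in> Aut L M"
    and X: "X \<subseteq> U" "X \<subseteq> A" "Autf_closed_over X" and eq: "\<And>t. cls (as t i) = cls (as t j)"
  shows "cls (\<sigma> i) = cls (\<sigma> j)"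
proof (rule ccontr)
  assume neq: "cls (\<sigma> i) \<noteq> cls (\<sigma> j)"
  note \<sigma> = limit_Aut[OF lim]
  have "inv\<^bsub>G\<^esub> \<sigma> j \<otimes>\<^bsub>G\<^esub> \<sigma> i \<notin> Autf L \<kappa> M"
    using neq cls_eq_iff[OF \<sigma>[OF ij(2)] \<sigma>[OF ij(1)]] by auto
  then obtain \<psi> where \<psi>: "\<psi> \<in> okf L (dvars X)"
    "sat M (case_sum (inv\<^bsub>G\<^esub> \<sigma> j \<otimes>\<^bsub>G\<^esub> \<sigma> i) (\<lambda>x. x)) [] \<psi>"
    "\<forall>h\<in>Autf L \<kappa> M. \<not> sat M (case_sum h (\<lambda>x. x)) [] \<psi>"
    using X(3) \<sigma>[OF ij(1)] \<sigma>[OF ij(2)] unfolding Autf_closed_over_def by (meson mult_closed inv_closed)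
  have "sat M (case_sum (as t i) (as t j)) [] (Neg \<psi>)" for t
  proof -
    have "inv\<^bsub>G\<^esub> as t j \<otimes>\<^bsub>G\<^esub> as t i \<in> Autf L \<kappa> M"
      using eq[of t] cls_eq_iff[OF as[OF ij(2)] as[OF ij(1)]] by metis
    then show ?thesis
      using \<psi>(3) sat_shift[OF as[OF ij(1)] as[OF ij(2)] X(1) \<psi>(1)] by auto
  qed
  then have "sat M (case_sum (\<sigma> i) (\<sigma> j)) [] (Neg \<psi>)"
    using \<psi>(1) by (intro limit_sat2[OF lim ij X(2)]) auto
  then show False
    using \<psi>(2) sat_shift[OF \<sigma>[OF ij(1)] \<sigma>[OF ij(2)] X(1) \<psi>(1)] by simp
qed

text \<open>\<open>transporter f J b b'\<close> consists of the automorphisms \<open>g\<close> such that \<open>g\<^sup>-\<^sup>1 f g\<close> maps \<open>b\<close> to a tuple with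
  the same Lascar type as \<open>b'\<close>.\<close>

definition transporter :: "('a \<Rightarrow> 'a) \<Rightarrow> 'i set \<Rightarrow> ('i \<Rightarrow> 'a) \<Rightarrow> ('i \<Rightarrow> 'a) \<Rightarrow> ('a \<Rightarrow> 'a) set" where
  "transporter f J b b' = {g \<in> Aut L M. \<exists>k\<in>Aut L M. (\<forall>j\<in>J. k (b j) = b' j) \<and>
     cls f \<otimes>\<^bsub>Q\<^esub> cls g = cls g \<otimes>\<^bsub>Q\<^esub> cls k}"

text \<open>If every finite \<open>\<Delta>\<close> failed, a limit of the failures would consist of
  \<open>g\<close>, \<open>g'\<close> with the same type over \<open>X\<close>, hence of the same
  class, and of \<open>k\<close>, \<open>k'\<close> carrying \<open>b\<close> to \<open>b'\<close>
  and to \<open>b''\<close>. In the Lascar group the relations \<open>f g = g k\<close> and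
  \<open>f g' = g' k'\<close> persist, so \<open>k\<close> and \<open>k'\<close> have the same
  class. Then \<open>k'\<close> times the inverse of \<open>k\<close> is in \<open>Autf\<close> and
  carries \<open>b'\<close> to \<open>b''\<close>, against \<open>neq\<close>.\<close>

lemma transporter_separation:
  assumes X: "elem_submodel L M X" "small \<kappa> X" "Autf_closed_over X"
    and J: "small \<kappa> J" and b: "\<And>j. j \<in> J \<Longrightarrow> b j \<in> U" and f: "f \<in> Aut L M"
    and neq: "\<And>h. h \<in> Autf L \<kappa> M \<Longrightarrow> \<exists>j\<in>J. h (b' j) \<noteq> b'' j"
  shows "\<exists>\<Delta>. finite \<Delta> \<and> \<Delta> \<subseteq> okf L (dvars X) \<and>
    (\<forall>g\<in>transporter f J b b'. \<forall>g'\<in>transporter f J b b''.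
       \<exists>\<delta>\<in>\<Delta>. sat M (case_sum g (\<lambda>x. x)) [] \<delta> \<noteq> sat M (case_sum g' (\<lambda>x. x)) [] \<delta>)"
proof (rule ccontr)
  assume no: "\<not> ?thesis"
  let ?T = "transporter f J b b'" and ?T' = "transporter f J b b''"
  let ?sat = "\<lambda>g \<delta>. sat M (case_sum g (\<lambda>x. x)) [] \<delta>"
  define \<D> where "\<D> = okf L (dvars X)"
  have XU: "X \<subseteq> U"
    using X(1) by (simp add: elem_submodel_def)
  define good where "good \<Delta> g k g' k' \<longleftrightarrow> g \<in> Aut L M \<and> k \<in> Aut L M \<and> g' \<in> Aut L M \<and> k' \<in> Aut L M \<and>
     (\<forall>j\<in>J. k (b j) = b' j) \<and> cls f \<otimes>\<^bsub>Q\<^esub> cls g = cls g \<otimes>\<^bsub>Q\<^esub> cls k \<and>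
     (\<forall>j\<in>J. k' (b j) = b'' j) \<and> cls f \<otimes>\<^bsub>Q\<^esub> cls g' = cls g' \<otimes>\<^bsub>Q\<^esub> cls k' \<and>
     (\<forall>\<delta>\<in>\<Delta>. ?sat g \<delta> \<longleftrightarrow> ?sat g' \<delta>)" for \<Delta> g k g' k'
  have "\<exists>g k g' k'. good \<Delta> g k g' k'" if "finite \<Delta>" "\<Delta> \<subseteq> \<D>" for \<Delta>
  proof -
    obtain g g' where g: "g \<in> ?T" "g' \<in> ?T'" "\<forall>\<delta>\<in>\<Delta>. ?sat g \<delta> \<longleftrightarrow> ?sat g' \<delta>"
    proof (rule ccontr)
      assume "\<not> thesis"
      then have "\<forall>g\<in>?T. \<forall>g'\<in>?T'. \<exists>\<delta>\<in>\<Delta>. ?sat g \<delta> \<noteq> ?sat g' \<delta>"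
        using that by blast
      then show False
        using no \<open>finite \<Delta>\<close> \<open>\<Delta> \<subseteq> \<D>\<close> unfolding \<D>_def by blast
    qed
    then show ?thesis
      unfolding good_def transporter_def by blast
  qed
  then have "\<exists>g k g' k'. good (if finite \<Delta> \<and> \<Delta> \<subseteq> \<D> then \<Delta> else {}) g k g' k'" for \<Delta>
    by simp
  then obtain g k g' k' where good: "\<And>\<Delta>. good (if finite \<Delta> \<and> \<Delta> \<subseteq> \<D> then \<Delta> else {}) (g \<Delta>) (k \<Delta>) (g' \<Delta>) (k' \<Delta>)"
    by metis
  then have Aut: "g \<Delta> \<in> Aut L M" "k \<Delta> \<in> Aut L M" "g' \<Delta> \<in> Aut L M" "k' \<Delta> \<in> Aut L M"
    and kb: "j \<in> J \<Longrightarrow> k \<Delta> (b j) = b' j" "j \<in> J \<Longrightarrow> k' \<Delta> (b j) = b'' j"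
    and comm: "cls f \<otimes>\<^bsub>Q\<^esub> cls (g \<Delta>) = cls (g \<Delta>) \<otimes>\<^bsub>Q\<^esub> cls (k \<Delta>)"
      "cls f \<otimes>\<^bsub>Q\<^esub> cls (g' \<Delta>) = cls (g' \<Delta>) \<otimes>\<^bsub>Q\<^esub> cls (k' \<Delta>)" for \<Delta> j
    unfolding good_def by blast+
  define F where "F = finite_subsets_at_top \<D>"
  have F: "F \<noteq> bot"
    by (simp add: F_def)
  have ev: "\<forall>\<^sub>F \<Delta> in F. ?sat (g \<Delta>) \<delta> \<longleftrightarrow> ?sat (g' \<Delta>) \<delta>" if "\<delta> \<in> \<D>" for \<delta>
    unfolding F_def eventually_finite_subsets_at_top
  proof (intro exI[of _ "{\<delta>}"] conjI allI impI)
    fix \<Delta> assume "finite \<Delta> \<and> {\<delta>} \<subseteq> \<Delta> \<and> \<Delta> \<subseteq> \<D>"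
    then show "?sat (g \<Delta>) \<delta> \<longleftrightarrow> ?sat (g' \<Delta>) \<delta>"
      using good[of \<Delta>] unfolding good_def by simp
  qed (use that in auto)
  \<comment> \<open>The products are entries of their own, because the values of the factors on a
    small set do not determine them.\<close>
  define lst where "lst \<Delta> = [\<one>\<^bsub>G\<^esub>, f, g \<Delta>, f \<otimes>\<^bsub>G\<^esub> g \<Delta>, k \<Delta>, g \<Delta> \<otimes>\<^bsub>G\<^esub> k \<Delta>,
    g' \<Delta>, f \<otimes>\<^bsub>G\<^esub> g' \<Delta>, k' \<Delta>, g' \<Delta> \<otimes>\<^bsub>G\<^esub> k' \<Delta>]" for \<Delta>
  define as where "as \<Delta> = nth (lst \<Delta>)" for \<Delta>
  have as_simps: "as \<Delta> 0 = \<one>\<^bsub>G\<^esub>" "as \<Delta> 1 = f" "as \<Delta> 2 = g \<Delta>" "as \<Delta> 3 = f \<otimes>\<^bsub>G\<^esub> g \<Delta>" "as \<Delta> 4 = k \<Delta>"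
    "as \<Delta> 5 = g \<Delta> \<otimes>\<^bsub>G\<^esub> k \<Delta>" "as \<Delta> 6 = g' \<Delta>" "as \<Delta> 7 = f \<otimes>\<^bsub>G\<^esub> g' \<Delta>" "as \<Delta> 8 = k' \<Delta>"
    "as \<Delta> 9 = g' \<Delta> \<otimes>\<^bsub>G\<^esub> k' \<Delta>" for \<Delta>
    by (simp_all add: as_def lst_def)
  have as: "as \<Delta> i \<in> Aut L M" if "i < 10" for i \<Delta>
  proof -
    have "set (lst \<Delta>) \<subseteq> Aut L M" "length (lst \<Delta>) = 10"
      using f Aut by (simp_all add: lst_def)
    then show ?thesis
      unfolding as_def using that nth_mem[of i "lst \<Delta>"] by auto
  qed
  \<comment> \<open>The image of \<open>X\<close> under \<open>f\<close> is included so that the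
    limit of the constant entry \<open>f\<close> agrees with \<open>f\<close> on \<open>X\<close>;
    the tuples are included to retain what \<open>k\<close> and \<open>k'\<close> do to
    \<open>b\<close>.\<close>
  define A where "A = X \<union> f ` X \<union> b ` J \<union> b' ` J \<union> b'' ` J"
  have b'U: "b' j \<in> U" "b'' j \<in> U" if "j \<in> J" for j
    using kb[OF that] Aut b[OF that] Aut_U by metis+
  have A: "A \<subseteq> U" "small \<kappa> A"
    using XU b b'U f unfolding A_def by (auto intro!: small_Un small_image X J)
  have XA: "X \<subseteq> A"
    by (auto simp: A_def)
  obtain \<sigma> where lim: "is_limit F as \<sigma> 10 A"
    using exists_limit[where as = as and m = 10, OF F as A _ as_simps(1)] by auto
  have \<sigma>: "\<sigma> i \<in> Aut L M" if "i < 10" for i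
    by (rule limit_Aut[OF lim that])
  note cls_eq = cls_eqI[OF X(1,2)]
  \<comment> \<open>With the identity as first entry, \<open>limit_conjugation\<close> gives a
    \<open>\<tau>\<close> that agrees with \<open>\<sigma> j\<close> on \<open>A\<close>.\<close>
  have conj: "\<exists>\<tau>\<in>Aut L M. (\<forall>x\<in>A. \<tau> x = \<sigma> j x) \<and> cls (\<sigma> l) = cls \<tau> \<otimes>\<^bsub>Q\<^esub> cls (\<sigma> k)"
    if jkl: "j < 10" "k < 10" "l < 10" "\<And>\<Delta>. as \<Delta> l = as \<Delta> j \<otimes>\<^bsub>G\<^esub> as \<Delta> k" for j k l
  proof -
    have "\<exists>\<tau>\<in>Aut L M. \<forall>x\<in>A. \<tau> (as \<Delta> 0 x) = as \<Delta> j x \<and> \<tau> (as \<Delta> k x) = as \<Delta> l x" for \<Delta>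
      using as[OF jkl(1)] as[OF jkl(2)] jkl(4) A(1) as_simps(1)
      by (intro bexI[of _ "as \<Delta> j"]) auto
    then obtain \<tau> where \<tau>: "\<tau> \<in> Aut L M" "\<And>x. x \<in> A \<Longrightarrow> \<tau> (\<sigma> 0 x) = \<sigma> j x" "\<And>x. x \<in> A \<Longrightarrow> \<tau> (\<sigma> k x) = \<sigma> l x"
      using limit_conjugation[OF lim _ jkl(1-3) as A, of 0] by auto
    have "cls (\<tau> \<otimes>\<^bsub>G\<^esub> \<sigma> k) = cls (\<sigma> l)"
    proof (rule cls_eq)
      fix x assume "x \<in> X"
      then have "x \<in> U" "x \<in> A"
        using XU XA by auto
      then show "(\<tau> \<otimes>\<^bsub>G\<^esub> \<sigma> k) x = \<sigma> l x"
        using \<tau> \<sigma>[OF jkl(2)] by simp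
    qed (simp_all add: \<tau> \<sigma> jkl)
    then have "cls (\<sigma> l) = cls \<tau> \<otimes>\<^bsub>Q\<^esub> cls (\<sigma> k)"
      using \<tau>(1) \<sigma>[OF jkl(2)] by simp
    moreover have "\<forall>x\<in>A. \<tau> x = \<sigma> j x"
      using \<tau>(2) limit_zero[OF lim] by simp
    ultimately show ?thesis
      using \<tau>(1) by blast
  qed
  have conj': "cls (\<sigma> l) = cls (\<sigma> j) \<otimes>\<^bsub>Q\<^esub> cls (\<sigma> k)"
    if jkl: "j < 10" "k < 10" "l < 10" "\<And>\<Delta>. as \<Delta> l = as \<Delta> j \<otimes>\<^bsub>G\<^esub> as \<Delta> k" for j k l
  proof -
    obtain \<tau> where \<tau>: "\<tau> \<in> Aut L M" "\<forall>x\<in>A. \<tau> x = \<sigma> j x" "cls (\<sigma> l) = cls \<tau> \<otimes>\<^bsub>Q\<^esub> cls (\<sigma> k)"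
      using conj[OF jkl] by blast
    have "cls \<tau> = cls (\<sigma> j)"
      using \<tau> \<sigma>[OF jkl(1)] XA by (intro cls_eq) auto
    then show ?thesis
      using \<tau>(3) by simp
  qed
  have "cls (\<sigma> 1) = cls f"
  proof (rule cls_eq)
    fix x assume x: "x \<in> X"
    then have "\<sigma> 1 x = \<sigma> 0 (f x)"
      using f XU by (intro limit_eq[OF lim _ _ as A(1)]) (auto simp: A_def as_simps as_simps(2)[simplified])
    also have "\<dots> = f x"
      using x by (intro limit_zero[OF lim]) (auto simp: A_def)
    finally show "\<sigma> 1 x = f x" .
  qed (simp_all add: \<sigma> f)
  then have f_comm: "cls (\<sigma> 3) = cls f \<otimes>\<^bsub>Q\<^esub> cls (\<sigma> 2)" "cls (\<sigma> 7) = cls f \<otimes>\<^bsub>Q\<^esub> cls (\<sigma> 6)"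
    using conj'[of 1 2 3] conj'[of 1 6 7] by (simp_all add: as_simps as_simps(2)[simplified])
  have k_comm: "cls (\<sigma> 5) = cls (\<sigma> 2) \<otimes>\<^bsub>Q\<^esub> cls (\<sigma> 4)" "cls (\<sigma> 9) = cls (\<sigma> 6) \<otimes>\<^bsub>Q\<^esub> cls (\<sigma> 8)"
    using conj'[of 2 4 5] conj'[of 6 8 9] by (simp_all add: as_simps)
  have "cls (\<sigma> 3) = cls (\<sigma> 5)" "cls (\<sigma> 7) = cls (\<sigma> 9)"
    by (rule limit_cls[OF lim _ _ as XU XA X(3)]; simp add: as_simps f Aut comm)+
  moreover have "cls (\<sigma> 2) = cls (\<sigma> 6)"
    by (rule limit_same_type[OF lim _ _ _ as as_simps(1) X(1,2) XA])
      (simp_all add: as_simps ev \<D>_def)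
  ultimately have "cls (\<sigma> 6) \<otimes>\<^bsub>Q\<^esub> cls (\<sigma> 4) = cls (\<sigma> 6) \<otimes>\<^bsub>Q\<^esub> cls (\<sigma> 8)"
    using f_comm k_comm by metis
  then have eq: "cls (\<sigma> 4) = cls (\<sigma> 8)"
    using \<sigma> Q.Units_l_cancel[of "cls (\<sigma> 6)" "cls (\<sigma> 4)" "cls (\<sigma> 8)"] by (simp add: Q.Units_eq)
  define h where "h = \<sigma> 8 \<otimes>\<^bsub>G\<^esub> inv\<^bsub>G\<^esub> \<sigma> 4"
  have "cls h = \<one>\<^bsub>Q\<^esub>"
    using \<sigma> eq Q.r_inv[OF cls_closed[OF \<sigma>[of 8]]] by (simp add: h_def)
  then have "h \<in> Autf L \<kappa> M"
    using cls_one_iff[of h] \<sigma> by (simp add: h_def)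
  moreover have "h (b' j) = b'' j" if j: "j \<in> J" for j
  proof -
    have bA: "b j \<in> A" "b' j \<in> A" "b'' j \<in> A"
      using j by (auto simp: A_def)
    have "\<sigma> 4 (b j) = \<sigma> 0 (b' j)" "\<sigma> 8 (b j) = \<sigma> 0 (b'' j)"
      using bA kb[OF j] b'U[OF j] by (auto intro!: limit_eq[OF lim _ _ as A(1)] simp: as_simps)
    then have *: "\<sigma> 4 (b j) = b' j" "\<sigma> 8 (b j) = b'' j"
      using limit_zero[OF lim] bA by simp_all
    have "h (b' j) = \<sigma> 8 ((inv\<^bsub>G\<^esub> \<sigma> 4) (\<sigma> 4 (b j)))"
      using \<sigma> b'U[OF j] *(1) by (simp add: h_def)
    then show ?thesis
      using \<sigma> b[OF j] *(2) by simp
  qed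
  ultimately show False
    using neq by blast
qed

text \<open>\<open>l\<close> and \<open>k\<close> determine each other by
  \<open>l f g = g k\<close>, and \<open>l\<close> is in \<open>Autf\<close> exactly when
  \<open>f g\<close> and \<open>g k\<close> have the same class.\<close>

lemma transporter_iff:
  assumes f: "f \<in> Aut L M" and g: "g \<in> Aut L M" and b: "\<And>j. j \<in> J \<Longrightarrow> b j \<in> U" "\<And>j. j \<in> J \<Longrightarrow> b' j \<in> U"
  shows "g \<in> transporter f J b b' \<longleftrightarrow> (\<exists>l\<in>Autf L \<kappa> M. \<forall>j\<in>J. l (f (g (b j))) = g (b' j))"
proof
  assume "g \<in> transporter f J b b'"
  then obtain k where k: "k \<in> Aut L M" "\<forall>j\<in>J. k (b j) = b' j"
    "cls f \<otimes>\<^bsub>Q\<^esub> cls g = cls g \<otimes>\<^bsub>Q\<^esub> cls k"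
    by (auto simp: transporter_def)
  define h where "h = f \<otimes>\<^bsub>G\<^esub> g"
  have h: "h \<in> Aut L M" "cls h = cls (g \<otimes>\<^bsub>G\<^esub> k)"
    using f g k by (simp_all add: h_def)
  define l where "l = (g \<otimes>\<^bsub>G\<^esub> k) \<otimes>\<^bsub>G\<^esub> inv\<^bsub>G\<^esub> h"
  have l: "l \<in> Aut L M"
    using h g k(1) by (simp add: l_def)
  have "cls l = cls (g \<otimes>\<^bsub>G\<^esub> k) \<otimes>\<^bsub>Q\<^esub> cls (inv\<^bsub>G\<^esub> h)"
    unfolding l_def using h g k(1) by (intro cls_mult) simp_all
  also have "\<dots> = \<one>\<^bsub>Q\<^esub>"
    unfolding h(2)[symmetric] cls_inv[OF h(1)] using h(1) by simp
  finally have "l \<in> Autf L \<kappa> M"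
    using cls_one_iff[OF l] by simp
  moreover have "l (f (g (b j))) = g (b' j)" if j: "j \<in> J" for j
  proof -
    have "l (h (b j)) = g (k (b j))"
      using h(1) g k(1) b(1)[OF j] by (simp add: l_def)
    then show ?thesis
      using f g b(1)[OF j] k(2) j by (simp add: h_def)
  qed
  ultimately show "\<exists>l\<in>Autf L \<kappa> M. \<forall>j\<in>J. l (f (g (b j))) = g (b' j)"
    by blast
next
  assume "\<exists>l\<in>Autf L \<kappa> M. \<forall>j\<in>J. l (f (g (b j))) = g (b' j)"
  then obtain l where l: "l \<in> Autf L \<kappa> M" "\<forall>j\<in>J. l (f (g (b j))) = g (b' j)"
    by blast
  note lA = Autf_Aut[OF l(1)]
  define k where "k = inv\<^bsub>G\<^esub> g \<otimes>\<^bsub>G\<^esub> (l \<otimes>\<^bsub>G\<^esub> (f \<otimes>\<^bsub>G\<^esub> g))"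
  have k: "k \<in> Aut L M"
    using f g lA by (simp add: k_def)
  have "k (b j) = b' j" if "j \<in> J" for j
    using f g lA b that l(2) by (simp add: k_def)
  moreover have "cls f \<otimes>\<^bsub>Q\<^esub> cls g = cls g \<otimes>\<^bsub>Q\<^esub> cls k"
    using f g lA l(1) cls_one_iff[OF lA] by (simp add: k_def Q.m_assoc[symmetric])
  ultimately show "g \<in> transporter f J b b'"
    using g k by (auto simp: transporter_def)
qed

text \<open>The set of all \<open>g\<close> for which \<open>f\<close> preserves the Lascar type of \<open>g b\<close> is separated by finitely many
  formulas from its complement, since \<open>g\<^sup>-\<^sup>1 f g\<close> moves \<open>b\<close> to one of finitely many Lascar types.
  Connectedness then shows that it is everything.\<close>

lemma Lascar_strong_transfer:
  assumes FE: "finite_equivalences_invariant"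
    and X: "elem_submodel L M X" "small \<kappa> X" "Autf_closed_over X"
    and J: "small \<kappa> J" and b: "\<And>j. j \<in> J \<Longrightarrow> b j \<in> U" and a: "\<And>i. i \<in> I \<Longrightarrow> a i \<in> U" and f: "f \<in> Aut L M"
    and fin: "finite ((\<lambda>k. restrict (\<lambda>j. k (b j)) J) ` {k \<in> Aut L M. \<forall>i\<in>I. k (a i) = a i})"
    and fa: "\<And>g. g \<in> Aut L M \<Longrightarrow> \<exists>l\<in>Autf L \<kappa> M. \<forall>i\<in>I. l (f (g (a i))) = g (a i)"
    and fb: "\<exists>l\<in>Autf L \<kappa> M. \<forall>j\<in>J. l (f (b j)) = b j"
    and g: "g \<in> Aut L M"
  shows "\<exists>l\<in>Autf L \<kappa> M. \<forall>j\<in>J. l (f (g (b j))) = g (b j)"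
proof -
  define B where "B = (\<lambda>k. restrict (\<lambda>j. k (b j)) J) ` {k \<in> Aut L M. \<forall>i\<in>I. k (a i) = a i}"
  define S where "S = transporter f J b b"
  define near where "near b' \<longleftrightarrow> (\<exists>h\<in>Autf L \<kappa> M. \<forall>j\<in>J. h (b' j) = b j)" for b'
  have XU: "X \<subseteq> U"
    using X(1) by (simp add: elem_submodel_def)
  have "\<forall>b'\<in>{b'\<in>B. \<not> near b'}. \<exists>\<Delta>. finite \<Delta> \<and> \<Delta> \<subseteq> okf L (dvars X) \<and>
    (\<forall>g\<in>transporter f J b b'. \<forall>g'\<in>transporter f J b b.
       \<exists>\<delta>\<in>\<Delta>. sat M (case_sum g (\<lambda>x. x)) [] \<delta> \<noteq> sat M (case_sum g' (\<lambda>x. x)) [] \<delta>)"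
    by (intro ballI transporter_separation[OF X J b f]) (auto simp: near_def)
  from bchoice[OF this] obtain D where "\<forall>b'\<in>{b'\<in>B. \<not> near b'}. finite (D b') \<and> D b' \<subseteq> okf L (dvars X) \<and>
    (\<forall>g\<in>transporter f J b b'. \<forall>g'\<in>transporter f J b b.
       \<exists>\<delta>\<in>D b'. sat M (case_sum g (\<lambda>x. x)) [] \<delta> \<noteq> sat M (case_sum g' (\<lambda>x. x)) [] \<delta>)"
    by (elim exE) (rule that)
  then have D: "finite (D b') \<and> D b' \<subseteq> okf L (dvars X) \<and>
    (\<forall>g\<in>transporter f J b b'. \<forall>g'\<in>S.
       \<exists>\<delta>\<in>D b'. sat M (case_sum g (\<lambda>x. x)) [] \<delta> \<noteq> sat M (case_sum g' (\<lambda>x. x)) [] \<delta>)"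
    if "b' \<in> B" "\<not> near b'" for b'
    unfolding S_def by (rule bspec) (simp add: that)
  \<comment> \<open>Only the finitely many images of \<open>b\<close> under automorphisms fixing all
    \<open>a i\<close> that have another Lascar type than \<open>b\<close> must be excluded.\<close>
  define \<Delta> where "\<Delta> = \<Union>(D ` {b' \<in> B. \<not> near b'})"
  have \<Delta>: "finite \<Delta>" "\<Delta> \<subseteq> okf L (dvars X)"
  proof -
    have "finite {b' \<in> B. \<not> near b'}"
      using fin by (simp add: B_def)
    then show "finite \<Delta>"
      unfolding \<Delta>_def using D by (intro finite_Union finite_imageI) auto
    show "\<Delta> \<subseteq> okf L (dvars X)"
      unfolding \<Delta>_def using D by blast
  qed
  have step: "g \<in> S" if g: "g \<in> Aut L M" and h: "h \<in> S"
    and eq: "\<forall>\<delta>\<in>\<Delta>. sat M (case_sum g (\<lambda>x. x)) [] \<delta> \<longleftrightarrow> sat M (case_sum h (\<lambda>x. x)) [] \<delta>" for g h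
  proof -
    \<comment> \<open>By \<open>fa\<close> the class of the conjugate of \<open>f\<close> by
      \<open>g\<close> contains some \<open>k\<close> fixing all \<open>a i\<close>, and such a
      \<open>k\<close> takes \<open>b\<close> into the finite set \<open>B\<close>.\<close>
    have "g \<in> transporter f I a a"
      using transporter_iff[of f g I a a, OF f g a a] fa[OF g] by blast
    then obtain k where k: "k \<in> Aut L M" "\<forall>i\<in>I. k (a i) = a i"
      "cls f \<otimes>\<^bsub>Q\<^esub> cls g = cls g \<otimes>\<^bsub>Q\<^esub> cls k"
      by (auto simp: transporter_def)
    define b' where "b' = restrict (\<lambda>j. k (b j)) J"
    have b': "b' \<in> B" "g \<in> transporter f J b b'"
      using k g by (auto simp: B_def b'_def transporter_def)
    have "near b'"
    proof (rule ccontr)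
      assume far: "\<not> near b'"
      then obtain \<delta> where "\<delta> \<in> D b'"
        "sat M (case_sum g (\<lambda>x. x)) [] \<delta> \<noteq> sat M (case_sum h (\<lambda>x. x)) [] \<delta>"
        using D[OF b'(1) far] b'(2) h by blast
      moreover have "D b' \<subseteq> \<Delta>"
        using b'(1) far by (auto simp: \<Delta>_def)
      ultimately show False
        using eq by blast
    qed
    then obtain m where m: "m \<in> Autf L \<kappa> M" "\<forall>j\<in>J. m (b' j) = b j"
      by (auto simp: near_def)
    note mA = Autf_Aut[OF m(1)]
    \<comment> \<open>Multiplying \<open>k\<close> by an element of \<open>Autf\<close> keeps its
      class and makes it fix \<open>b\<close>.\<close>
    have "\<forall>j\<in>J. (m \<otimes>\<^bsub>G\<^esub> k) (b j) = b j"
      using m(2) mA k(1) b by (simp add: b'_def)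
    moreover have "cls (m \<otimes>\<^bsub>G\<^esub> k) = cls k"
      using mA k(1) cls_one_iff[OF mA] m(1) by simp
    ultimately show ?thesis
      using g k mA unfolding S_def transporter_def by (auto intro!: bexI[of _ "m \<otimes>\<^bsub>G\<^esub> k"] simp del: cls_mult)
  qed
  have "g \<in> S \<longleftrightarrow> \<one>\<^bsub>G\<^esub> \<in> S"
  proof (rule connected[OF FE X(1,2) XU \<Delta> _ _ g])
    show "g \<in> S \<longleftrightarrow> h \<in> S" if "g \<in> Aut L M" "h \<in> Aut L M" "cls g = cls h" for g h
      using that by (simp add: S_def transporter_def)
    show "g \<in> S \<longleftrightarrow> h \<in> S" if "g \<in> Aut L M" "h \<in> Aut L M"
      "\<forall>\<delta>\<in>\<Delta>. sat M (case_sum g (\<lambda>x. x)) [] \<delta> \<longleftrightarrow> sat M (case_sum h (\<lambda>x. x)) [] \<delta>" for g h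
      using step[of g h] step[of h g] that by blast
  qed
  moreover have "\<one>\<^bsub>G\<^esub> \<in> S"
    using transporter_iff[of f "\<one>\<^bsub>G\<^esub>" J b b, OF f one_closed b b] fb b f by (simp add: S_def)
  ultimately show ?thesis
    unfolding S_def using transporter_iff[of f g J b b, OF f g b b] by simp
qed

end

section \<open>Relativised Lascar groups\<close>

context monster_model
begin

section \<open>Lascar equivalence of tuples under the action of automorphisms\<close>

lemma compose_closed: "u \<in> I \<rightarrow>\<^sub>E U \<Longrightarrow> g \<in> Aut L M \<Longrightarrow> compose I g u \<in> I \<rightarrow>\<^sub>E U"
  by (auto simp: compose_def PiE_iff)

lemma compose_mult:
  "u \<in> I \<rightarrow>\<^sub>E U \<Longrightarrow> g \<in> Aut L M \<Longrightarrow> h \<in> Aut L M \<Longrightarrow> compose I (g \<otimes>\<^bsub>G\<^esub> h) u = compose I g (compose I h u)"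
  by (auto simp: compose_def fun_eq_iff PiE_iff)

lemma compose_one: "u \<in> I \<rightarrow>\<^sub>E U \<Longrightarrow> compose I \<one>\<^bsub>G\<^esub> u = u"
  by (auto simp: compose_def fun_eq_iff PiE_iff extensional_def)

lemma compose_inv: "u \<in> I \<rightarrow>\<^sub>E U \<Longrightarrow> g \<in> Aut L M \<Longrightarrow> compose I (inv\<^bsub>G\<^esub> g) (compose I g u) = u"
  and compose_inv': "u \<in> I \<rightarrow>\<^sub>E U \<Longrightarrow> g \<in> Aut L M \<Longrightarrow> compose I g (compose I (inv\<^bsub>G\<^esub> g) u) = u"
  by (simp_all add: compose_mult[symmetric] compose_one)

lemma lascar_refl: "u \<in> I \<rightarrow>\<^sub>E U \<Longrightarrow> lascar_eq L \<kappa> M I u u"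
  unfolding lascar_eq_def using compose_one Autf.one_closed by blast

lemma lascar_sym:
  assumes "u \<in> I \<rightarrow>\<^sub>E U" "lascar_eq L \<kappa> M I u v"
  shows "lascar_eq L \<kappa> M I v u"
proof -
  obtain f where f: "f \<in> Autf L \<kappa> M" "compose I f u = v"
    using assms(2) by (auto simp: lascar_eq_def)
  then have "compose I (inv\<^bsub>G\<^esub> f) v = u"
    using compose_inv[OF assms(1) Autf_Aut] by blast
  then show ?thesis
    unfolding lascar_eq_def using f(1) Autf.m_inv_closed by blast
qed

lemma lascar_trans:
  assumes "u \<in> I \<rightarrow>\<^sub>E U" "lascar_eq L \<kappa> M I u v" "lascar_eq L \<kappa> M I v w"
  shows "lascar_eq L \<kappa> M I u w"
proof -
  obtain f g where f: "f \<in> Autf L \<kappa> M" "compose I f u = v" and g: "g \<in> Autf L \<kappa> M" "compose I g v = w"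
    using assms(2,3) by (auto simp: lascar_eq_def)
  then have "compose I (g \<otimes>\<^bsub>G\<^esub> f) u = w"
    using compose_mult[OF assms(1)] Autf_Aut by blast
  then show ?thesis
    unfolding lascar_eq_def using f(1) g(1) Autf.m_closed by blast
qed

lemma lascar_compose:
  assumes "u \<in> I \<rightarrow>\<^sub>E U" "g \<in> Aut L M" "lascar_eq L \<kappa> M I u v"
  shows "lascar_eq L \<kappa> M I (compose I g u) (compose I g v)"
proof -
  obtain f where f: "f \<in> Autf L \<kappa> M" "compose I f u = v"
    using assms(3) by (auto simp: lascar_eq_def)
  note fA = Autf_Aut[OF f(1)]
  have "compose I (g \<otimes>\<^bsub>G\<^esub> f \<otimes>\<^bsub>G\<^esub> inv\<^bsub>G\<^esub> g) (compose I g u) = compose I g v"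
    using assms(1,2) fA f(2) by (simp add: compose_mult compose_closed compose_inv)
  moreover have "g \<otimes>\<^bsub>G\<^esub> f \<otimes>\<^bsub>G\<^esub> inv\<^bsub>G\<^esub> g \<in> Autf L \<kappa> M"
    using Autf.inv_op_closed2[of g f] assms(2) f(1) by simp
  ultimately show ?thesis
    unfolding lascar_eq_def by blast
qed

lemma lascar_mult_inv_iff:
  assumes u: "u \<in> I \<rightarrow>\<^sub>E U" and f: "f \<in> Aut L M" "f' \<in> Aut L M"
  shows "lascar_eq L \<kappa> M I (compose I (inv\<^bsub>G\<^esub> f' \<otimes>\<^bsub>G\<^esub> f) u) u \<longleftrightarrow>
    lascar_eq L \<kappa> M I (compose I f u) (compose I f' u)"
proof
  assume "lascar_eq L \<kappa> M I (compose I (inv\<^bsub>G\<^esub> f' \<otimes>\<^bsub>G\<^esub> f) u) u"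
  from lascar_compose[OF compose_closed[OF u mult_closed[OF inv_closed[OF f(2)] f(1)]] f(2) this]
  show "lascar_eq L \<kappa> M I (compose I f u) (compose I f' u)"
    using u f by (simp add: compose_mult compose_inv' compose_closed)
next
  assume "lascar_eq L \<kappa> M I (compose I f u) (compose I f' u)"
  from lascar_compose[OF compose_closed[OF u f(1)] inv_closed[OF f(2)] this]
  show "lascar_eq L \<kappa> M I (compose I (inv\<^bsub>G\<^esub> f' \<otimes>\<^bsub>G\<^esub> f) u) u"
    using u f by (simp add: compose_mult compose_inv)
qed

lemma lascar_compose_iff:
  "lascar_eq L \<kappa> M I (compose I h (compose I g u)) (compose I g u) \<longleftrightarrow>
    (\<exists>l\<in>Autf L \<kappa> M. \<forall>i\<in>I. l (h (g (u i))) = g (u i))"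
  by (auto simp: lascar_eq_def compose_def restrict_def fun_eq_iff)

text \<open>One inclusion is homogeneity for the small index set \<open>I\<close>, the other is
  invariance of formulas under automorphisms.\<close>

lemma realizations_tp:
  assumes I: "small \<kappa> I" and a: "a \<in> I \<rightarrow>\<^sub>E U"
  shows "realizations L M I (tp L M I a {}) = {compose I g a |g. g \<in> Aut L M}"
proof (intro Set.set_eqI iffI)
  fix u assume u: "u \<in> realizations L M I (tp L M I a {})"
  then have uU: "u \<in> I \<rightarrow>\<^sub>E U" and sub: "tp L M I a {} \<subseteq> tp L M I u {}"
    by (auto simp: realizations_def)
  let ?V = "nvars L M I a"
  have Inl: "fm_rename Inl \<phi> \<in> tp L M I u {}" if \<phi>: "\<phi> \<in> okf L ?V" "sat M a [] \<phi>" for \<phi>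
  proof -
    have "fm_rename Inl \<phi> \<in> okf L (map_prod id Inl ` ?V :: ('s \<times> ('b + 'a)) set)"
      by (rule rename_okf[OF \<phi>(1)]) simp
    then have "fm_rename Inl \<phi> \<in> param_fms L M {(s, i). i \<in> I \<and> a i \<in> carr M s} {}"
      by (auto simp: param_fms_iff okf_def nvars_def)
    moreover have "psat M a (fm_rename Inl \<phi>)"
      using \<phi> by (simp add: psat_def sat_rename[OF \<phi>(1)] case_sum_o_inj)
    ultimately show ?thesis
      using sub by (auto simp: tp_def)
  qed
  obtain g where g: "g \<in> Aut L M" "\<And>i. i \<in> I \<Longrightarrow> g (a i) = u i"
  proof (rule homogeneity_nvars[where val = a and e = a])
    show "small \<kappa> I" "\<And>i. i \<in> I \<Longrightarrow> a i \<in> U"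
      using I a by auto
    show "wfa M ?V a"
      by (auto simp: wfa_def nvars_def)
    show "wfa M ?V u"
      unfolding wfa_def
    proof (clarify)
      fix s i assume si: "(s, i) \<in> ?V"
      \<comment> \<open>A type records the sort of a coordinate through the formula
        \<open>x = x\<close>: it belongs to the type of \<open>u\<close> only if its variable has
        the sort of \<open>u i\<close>.\<close>
      have "Eq (FV s i) (FV s i) \<in> okf L ?V"
        by (rule okf_refl[OF si varset_nvars])
      then have "fm_rename Inl (Eq (FV s i) (FV s i)) \<in> tp L M I u {}"
        by (rule Inl) simp
      then show "u i \<in> carr M s"
        by (simp add: tp_def param_fms_iff fm_rename_def)
    qed
    show "sat M u [] \<phi>" if \<phi>: "\<phi> \<in> okf L ?V" "sat M a [] \<phi>" for \<phi>
      using Inl[OF \<phi>] by (simp add: tp_def psat_def sat_rename[OF \<phi>(1)] case_sum_o_inj)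
  qed (rule that)
  have "u = compose I g a"
    using g(2) uU by (auto simp: compose_def fun_eq_iff PiE_iff extensional_def)
  then show "u \<in> {compose I g a |g. g \<in> Aut L M}"
    using g(1) by blast
next
  fix u assume "u \<in> {compose I g a |g. g \<in> Aut L M}"
  then obtain g where g: "g \<in> Aut L M" and u: "u = compose I g a"
    by blast
  have "\<phi> \<in> tp L M I u {}" if \<phi>: "\<phi> \<in> tp L M I a {}" for \<phi>
  proof -
    have ok: "fm_ok L [] \<phi>" and fv: "\<And>s i. (s, Inl i) \<in> fvs \<phi> \<Longrightarrow> i \<in> I \<and> a i \<in> carr M s"
      "\<And>s m. (s, Inr m) \<notin> fvs \<phi>" and sat: "sat M (case_sum a (\<lambda>m. m)) [] \<phi>"
      using \<phi> by (auto simp: tp_def param_fms_iff psat_def)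
    have fv': "\<exists>i. v = Inl i \<and> i \<in> I \<and> a i \<in> carr M s \<and> s \<in> sorts L" if "(s, v) \<in> fvs \<phi>" for s v
      using that fv fm_ok_sorts[OF ok that] by (cases v) auto
    have "sat M (g \<circ> case_sum a (\<lambda>m. m)) [] \<phi>"
      using sat_Aut0[OF str lok g, of \<phi> "fvs \<phi>" "case_sum a (\<lambda>m. m)"] ok sat fv'
      by (fastforce simp: okf_def wfa_def)
    moreover have "sat M (g \<circ> case_sum a (\<lambda>m. m)) [] \<phi> \<longleftrightarrow> sat M (case_sum u (\<lambda>m. m)) [] \<phi>"
    proof (rule sat_cong)
      fix s v assume "(s, v) \<in> fvs \<phi>"
      then show "(g \<circ> case_sum a (\<lambda>m. m)) v = case_sum u (\<lambda>m. m) v"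
        using fv' by (fastforce simp: u compose_def)
    qed
    moreover have "u i \<in> carr M s" if "(s, Inl i) \<in> fvs \<phi>" for s i
    proof -
      have "i \<in> I" "a i \<in> carr M s" "s \<in> sorts L"
        using fv'[OF that] by auto
      then show ?thesis
        using Aut_carr[OF g] by (simp add: u compose_def)
    qed
    ultimately show ?thesis
      using ok fv by (auto simp: tp_def param_fms_iff psat_def)
  qed
  then show "u \<in> realizations L M I (tp L M I a {})"
    using compose_closed[OF a g] by (auto simp: realizations_def u)
qed

text \<open>The multiplication of \<open>Aut_tp\<close> is that of bijections of the set of
  realizations and makes sense only for maps that preserve this set.\<close>

definition stable :: "'i set \<Rightarrow> ('s, 'f, 'r, 'i + 'a) fm set \<Rightarrow> bool" where
  "stable I q \<longleftrightarrow> (\<forall>g\<in>Aut L M. \<forall>u\<in>realizations L M I q. compose I g u \<in> realizations L M I q)"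

lemma stable_tp:
  assumes "small \<kappa> I" "a \<in> I \<rightarrow>\<^sub>E U"
  shows "stable I (tp L M I a {})"
  unfolding stable_def realizations_tp[OF assms]
proof (intro ballI)
  fix g u assume "g \<in> Aut L M" "u \<in> {compose I g a |g. g \<in> Aut L M}"
  then show "compose I g u \<in> {compose I g a |g. g \<in> Aut L M}"
    using compose_mult[OF assms(2)] mult_closed by (smt (verit) mem_Collect_eq)
qed

lemma realizations_U: "u \<in> realizations L M I q \<Longrightarrow> u \<in> I \<rightarrow>\<^sub>E U"
  by (simp add: realizations_def)

lemma restr_aut_apply: "u \<in> realizations L M I q \<Longrightarrow> restr_aut L M I q g u = compose I g u"
  by (simp add: restr_aut_def)

section \<open>The permutation group on the realizations of a type and its quotient\<close>

lemma restr_aut_Bij: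
  assumes q: "stable I q" and g: "g \<in> Aut L M"
  shows "restr_aut L M I q g \<in> Bij (realizations L M I q)"
proof -
  let ?R = "realizations L M I q"
  have "bij_betw (restr_aut L M I q g) ?R ?R"
  proof (rule bij_betw_byWitness[where f' = "compose I (inv\<^bsub>G\<^esub> g)"])
    show "\<forall>u\<in>?R. compose I (inv\<^bsub>G\<^esub> g) (restr_aut L M I q g u) = u"
      by (simp add: restr_aut_apply compose_inv[OF realizations_U g])
    show "\<forall>u\<in>?R. restr_aut L M I q g (compose I (inv\<^bsub>G\<^esub> g) u) = u"
      using q inv_closed[OF g] by (simp add: restr_aut_apply stable_def compose_inv'[OF realizations_U g])
    show "restr_aut L M I q g ` ?R \<subseteq> ?R" "compose I (inv\<^bsub>G\<^esub> g) ` ?R \<subseteq> ?R"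
      using q g inv_closed[OF g] by (auto simp: restr_aut_apply stable_def)
  qed
  then show ?thesis
    by (simp add: Bij_def restr_aut_def)
qed

lemma restr_aut_mult:
  assumes q: "stable I q" and g: "g \<in> Aut L M" "h \<in> Aut L M"
  shows "restr_aut L M I q g \<otimes>\<^bsub>Aut_tp L M I q\<^esub> restr_aut L M I q h = restr_aut L M I q (g \<otimes>\<^bsub>G\<^esub> h)"
proof -
  let ?R = "realizations L M I q"
  have "restr_aut L M I q g \<otimes>\<^bsub>Aut_tp L M I q\<^esub> restr_aut L M I q h =
      compose ?R (restr_aut L M I q g) (restr_aut L M I q h)"
    using restr_aut_Bij[OF q] g by (simp add: Aut_tp_def BijGroup_def)
  also have "\<dots> = restr_aut L M I q (g \<otimes>\<^bsub>G\<^esub> h)"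
  proof
    fix u show "compose ?R (restr_aut L M I q g) (restr_aut L M I q h) u = restr_aut L M I q (g \<otimes>\<^bsub>G\<^esub> h) u"
      using q g
      by (cases "u \<in> ?R")
        (simp_all add: compose_def[of ?R] restr_aut_def stable_def compose_mult[OF realizations_U])
  qed
  finally show ?thesis .
qed

lemma Autf1_eq:
  "Autf1 L \<kappa> M I q = restr_aut L M I q ` {g \<in> Aut L M. \<forall>u\<in>realizations L M I q. lascar_eq L \<kappa> M I (compose I g u) u}"
  by (auto simp: Autf1_def Aut_tp_def restr_aut_apply)

text \<open>Describes the coset by automorphisms of the whole model. Given such a \<open>g\<close>,
  the product \<open>h\<close> of \<open>g\<close> with the inverse of \<open>f\<close> preserves
  the Lascar type of every realization, because the inverse of \<open>f\<close> maps realizations to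
  realizations.\<close>

lemma Gal1_class_eq:
  assumes q: "stable I q" and f: "f \<in> Aut L M"
  shows "Gal1_class L \<kappa> M I q f = restr_aut L M I q `
    {g \<in> Aut L M. \<forall>u\<in>realizations L M I q. lascar_eq L \<kappa> M I (compose I g u) (compose I f u)}"
    (is "?C = ?r ` ?S")
proof (intro Set.set_eqI iffI)
  let ?R = "realizations L M I q"
  fix \<sigma> assume "\<sigma> \<in> ?C"
  then obtain g where g: "g \<in> Aut L M" "\<forall>u\<in>?R. lascar_eq L \<kappa> M I (compose I g u) u"
    "\<sigma> = ?r g \<otimes>\<^bsub>Aut_tp L M I q\<^esub> ?r f"
    by (auto simp: Gal1_class_def r_coset_def Autf1_eq)
  have "g \<otimes>\<^bsub>G\<^esub> f \<in> ?S"
    using g(1,2) f q by (auto simp: compose_mult[OF realizations_U] stable_def)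
  then show "\<sigma> \<in> ?r ` ?S"
    using g(3) restr_aut_mult[OF q g(1) f] by blast
next
  let ?R = "realizations L M I q"
  fix \<sigma> assume "\<sigma> \<in> ?r ` ?S"
  then obtain g where g: "g \<in> Aut L M" "\<forall>u\<in>?R. lascar_eq L \<kappa> M I (compose I g u) (compose I f u)"
    "\<sigma> = ?r g"
    by blast
  define h where "h = g \<otimes>\<^bsub>G\<^esub> inv\<^bsub>G\<^esub> f"
  have h: "h \<in> Aut L M"
    using g f by (simp add: h_def)
  have "lascar_eq L \<kappa> M I (compose I h u) u" if u: "u \<in> ?R" for u
  proof -
    have "compose I (inv\<^bsub>G\<^esub> f) u \<in> ?R"
      using q inv_closed[OF f] u unfolding stable_def by blast
    then have "lascar_eq L \<kappa> M I (compose I g (compose I (inv\<^bsub>G\<^esub> f) u)) (compose I f (compose I (inv\<^bsub>G\<^esub> f) u))"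
      using g(2) by blast
    then show ?thesis
      using compose_mult[OF realizations_U[OF u] g(1) inv_closed[OF f]] compose_inv'[OF realizations_U[OF u] f]
      by (simp add: h_def)
  qed
  then have "?r h \<in> Autf1 L \<kappa> M I q"
    using h by (auto simp: Autf1_eq)
  moreover have "h \<otimes>\<^bsub>G\<^esub> f = g"
    using g(1) f G.inv_solve_right'[of g h f] by (simp add: h_def G.m_assoc)
  then have "\<sigma> = ?r h \<otimes>\<^bsub>Aut_tp L M I q\<^esub> ?r f"
    using restr_aut_mult[OF q h f] g(3) by simp
  ultimately show "\<sigma> \<in> ?C"
    by (auto simp: Gal1_class_def r_coset_def)
qed

lemma Gal1_class_eq_iff:
  assumes q: "stable I q" and f: "f \<in> Aut L M" and g: "g \<in> Aut L M"
  shows "Gal1_class L \<kappa> M I q f = Gal1_class L \<kappa> M I q g \<longleftrightarrow>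
    (\<forall>u\<in>realizations L M I q. lascar_eq L \<kappa> M I (compose I f u) (compose I g u))"
proof
  let ?R = "realizations L M I q"
  assume eq: "Gal1_class L \<kappa> M I q f = Gal1_class L \<kappa> M I q g"
  have "restr_aut L M I q f \<in> Gal1_class L \<kappa> M I q f"
    unfolding Gal1_class_eq[OF q f] using f lascar_refl[OF compose_closed[OF realizations_U f]] by blast
  then obtain h where h: "h \<in> Aut L M" "\<forall>u\<in>?R. lascar_eq L \<kappa> M I (compose I h u) (compose I g u)"
    "restr_aut L M I q f = restr_aut L M I q h"
    unfolding eq Gal1_class_eq[OF q g] by blast
  have "compose I f u = compose I h u" if "u \<in> ?R" for u
    using h(3) restr_aut_apply[OF that, of f] restr_aut_apply[OF that, of h] by simp
  then show "\<forall>u\<in>?R. lascar_eq L \<kappa> M I (compose I f u) (compose I g u)"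
    using h(2) by simp
next
  let ?R = "realizations L M I q"
  assume *: "\<forall>u\<in>?R. lascar_eq L \<kappa> M I (compose I f u) (compose I g u)"
  have "lascar_eq L \<kappa> M I (compose I h u) (compose I f u) \<longleftrightarrow> lascar_eq L \<kappa> M I (compose I h u) (compose I g u)"
    if "h \<in> Aut L M" "u \<in> ?R" for h u
  proof -
    note c = compose_closed[OF realizations_U[OF that(2)]]
    show ?thesis
      using * that lascar_trans[OF c[OF that(1)]] lascar_sym[OF c[OF f]] by blast
  qed
  then show "Gal1_class L \<kappa> M I q f = Gal1_class L \<kappa> M I q g"
    unfolding Gal1_class_eq[OF q f] Gal1_class_eq[OF q g] by (intro arg_cong[where f = "image _"]) auto
qed

lemma carrier_Gal1: "carrier (Gal1 L \<kappa> M I q) = Gal1_class L \<kappa> M I q ` Aut L M"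
  by (auto simp: Gal1_def FactGroup_def RCOSETS_def Gal1_class_def Aut_tp_def)

lemma one_Gal1:
  assumes "stable I q"
  shows "\<one>\<^bsub>Gal1 L \<kappa> M I q\<^esub> = Gal1_class L \<kappa> M I q \<one>\<^bsub>G\<^esub>"
proof -
  have "Gal1_class L \<kappa> M I q \<one>\<^bsub>G\<^esub> = Autf1 L \<kappa> M I q"
    unfolding Gal1_class_eq[OF assms one_closed] Autf1_eq
    by (intro arg_cong[where f = "image _"]) (auto simp: compose_one[OF realizations_U])
  then show ?thesis
    by (simp add: Gal1_def FactGroup_def)
qed

text \<open>\<open>Gal1_proj\<close> is a definite description; \<open>wd\<close> says that its
  value does not depend on the representative.\<close>

lemma Gal1_proj_class:
  assumes f: "f \<in> Aut L M"
    and wd: "\<And>f g. f \<in> Aut L M \<Longrightarrow> g \<in> Aut L M \<Longrightarrow>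
      Gal1_class L \<kappa> M J qbar f = Gal1_class L \<kappa> M J qbar g \<Longrightarrow> Gal1_class L \<kappa> M I q f = Gal1_class L \<kappa> M I q g"
  shows "Gal1_proj L \<kappa> M J qbar I q (Gal1_class L \<kappa> M J qbar f) = Gal1_class L \<kappa> M I q f"
  unfolding Gal1_proj_def
proof (rule the_equality)
  show "\<exists>f'\<in>Aut L M. Gal1_class L \<kappa> M J qbar f = Gal1_class L \<kappa> M J qbar f' \<and>
      Gal1_class L \<kappa> M I q f = Gal1_class L \<kappa> M I q f'"
    using f by blast
next
  fix D assume "\<exists>f'\<in>Aut L M. Gal1_class L \<kappa> M J qbar f = Gal1_class L \<kappa> M J qbar f' \<and>
      D = Gal1_class L \<kappa> M I q f'"
  then obtain f' where "f' \<in> Aut L M" "Gal1_class L \<kappa> M J qbar f = Gal1_class L \<kappa> M J qbar f'"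
      "D = Gal1_class L \<kappa> M I q f'"
    by blast
  then show "D = Gal1_class L \<kappa> M I q f"
    using wd[OF f, of f'] by simp
qed

text \<open>Automorphisms fixing the parameters of an algebraic formula permute its solutions, so
  the orbit stays in a finite set.\<close>

lemma finite_orbit_acl:
  assumes x: "x \<in> acl L M A" and A: "A \<subseteq> U"
  shows "finite {k x |k. k \<in> Aut L M \<and> (\<forall>y\<in>A. k y = y)}"
proof -
  obtain s \<phi> where s: "s \<in> sorts L" and \<phi>: "\<phi> \<in> param_fms L M {(s, ())} A"
    "x \<in> solutions M s \<phi>" "finite (solutions M s \<phi>)"
    using x by (auto simp: acl_def)
  have "k x \<in> solutions M s \<phi>" if k: "k \<in> Aut L M" "\<forall>y\<in>A. k y = y" for k
  proof -
    let ?e = "case_sum (\<lambda>_. x) (\<lambda>m. m)"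
    have xs: "x \<in> carr M s" "sat M ?e [] \<phi>"
      using \<phi>(2) by (auto simp: solutions_def psat_def)
    have fv: "v = Inl () \<and> t = s \<or> (\<exists>m\<in>A. v = Inr m \<and> m \<in> carr M t)" if "(t, v) \<in> fvs \<phi>" for t v
      using \<phi>(1) that by (cases v) (auto simp: param_fms_iff)
    have "\<phi> \<in> okf L (fvs \<phi>)" "wfa M (fvs \<phi>) ?e"
      using \<phi>(1) fv xs(1) by (fastforce simp: okf_def param_fms_def wfa_def)+
    then have "sat M (k \<circ> ?e) [] \<phi>"
      using sat_Aut0[OF str lok k(1)] xs(2) by blast
    moreover have "sat M (k \<circ> ?e) [] \<phi> \<longleftrightarrow> sat M (case_sum (\<lambda>_. k x) (\<lambda>m. m)) [] \<phi>"
    proof (rule sat_cong)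
      fix t v assume "(t, v) \<in> fvs \<phi>"
      then show "(k \<circ> ?e) v = case_sum (\<lambda>_. k x) (\<lambda>m. m) v"
        using fv[of t v] k(2) by auto
    qed
    ultimately show ?thesis
      using Aut_carr[OF k(1) s xs(1)] by (simp add: solutions_def psat_def)
  qed
  then show ?thesis
    using \<phi>(3) by (elim finite_subset[rotated]) auto
qed

lemma acl_U: "acl L M A \<subseteq> U"
  by (auto simp: acl_def solutions_def intro: carr_univ)

text \<open>A representative \<open>f\<close> of a kernel class preserves the Lascar type of
  \<open>a\<close>, so some \<open>l\<close> in \<open>Autf\<close> takes \<open>f a\<close> back to
  \<open>a\<close>, and \<open>l f b\<close> lies in the finite orbit of \<open>b\<close> over
  \<open>a\<close>. This tuple determines the class: if it is the same for \<open>f\<close> and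
  \<open>f'\<close>, then \<open>f b\<close> and \<open>f' b\<close> have the same Lascar type. So
  \<open>h = f'^-1 f\<close> preserves the Lascar types of \<open>b\<close> and of all conjugates of
  \<open>a\<close>, hence by \<open>Lascar_strong_transfer\<close> those of all conjugates of
  \<open>b\<close>.\<close>

theorem finite_kernel_Gal1_proj:
  fixes a :: "'i \<Rightarrow> 'a" and c :: "nat \<Rightarrow> 'a"
  assumes FE: "finite_equivalences_invariant"
    and X: "elem_submodel L M X" "small \<kappa> X" "Autf_closed_over X"
    and I: "small \<kappa> I" and a: "a \<in> I \<rightarrow>\<^sub>E U" and c: "c \<in> {..<n} \<rightarrow>\<^sub>E acl L M (a ` I)"
    and p: "p = tp L M I a {}" and J: "J = I <+> {..<n}" and pbar: "pbar = tp L M J (case_sum a c) {}"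
  shows "finite (kernel (Gal1 L \<kappa> M J pbar) (Gal1 L \<kappa> M I p) (Gal1_proj L \<kappa> M J pbar I p))"
proof -
  define b where "b = case_sum a c"
  have smJ: "small \<kappa> J"
    unfolding J Plus_def by (intro small_Un small_image I small_finite finite_lessThan)
  have b: "b \<in> J \<rightarrow>\<^sub>E U"
  proof (rule PiE_I)
    show "b j \<in> U" if "j \<in> J" for j
      using that a c acl_U[of "a ` I"] by (auto simp: b_def J)
    show "b j = undefined" if "j \<notin> J" for j
      using that a c by (cases j) (auto simp: b_def J)
  qed
  have Rp: "realizations L M I p = {compose I g a |g. g \<in> Aut L M}"
    unfolding p by (rule realizations_tp[OF I a])
  have Rpbar: "realizations L M J pbar = {compose J g b |g. g \<in> Aut L M}"
    unfolding pbar b_def[symmetric] by (rule realizations_tp[OF smJ b])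
  have st: "stable I p" "stable J pbar"
    unfolding p pbar b_def[symmetric] by (rule stable_tp[OF I a], rule stable_tp[OF smJ b])
  \<comment> \<open>An element of \<open>Autf\<close> relating the images of a conjugate of
    \<open>b\<close> also relates those of the conjugate of \<open>a\<close>, whose coordinates are
    among those of \<open>b\<close>.\<close>
  have wd: "Gal1_class L \<kappa> M I p f = Gal1_class L \<kappa> M I p g"
    if fg: "f \<in> Aut L M" "g \<in> Aut L M" and eq: "Gal1_class L \<kappa> M J pbar f = Gal1_class L \<kappa> M J pbar g" for f g
    unfolding Gal1_class_eq_iff[OF st(1) fg]
  proof
    fix u assume "u \<in> realizations L M I p"
    then obtain h where h: "h \<in> Aut L M" "u = compose I h a"
      unfolding Rp by blast
    have "lascar_eq L \<kappa> M J (compose J f (compose J h b)) (compose J g (compose J h b))"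
      using eq h(1) unfolding Gal1_class_eq_iff[OF st(2) fg] Rpbar by blast
    then obtain l where l: "l \<in> Autf L \<kappa> M" "compose J l (compose J f (compose J h b)) = compose J g (compose J h b)"
      by (auto simp: lascar_eq_def)
    have "l (f (h (a i))) = g (h (a i))" if "i \<in> I" for i
      using fun_cong[OF l(2), of "Inl i"] that by (simp add: compose_def J b_def InlI)
    then have "compose I l (compose I f u) = compose I g u"
      by (auto simp: h(2) compose_def)
    then show "lascar_eq L \<kappa> M I (compose I f u) (compose I g u)"
      using l(1) by (auto simp: lascar_eq_def)
  qed
  \<comment> \<open>The orbit of \<open>b\<close> over \<open>a\<close>. The part from
    \<open>a\<close> is constant, and each of the \<open>n\<close> coordinates from \<open>c\<close>
    has finitely many images.\<close>
  define B where "B = (\<lambda>k. restrict (\<lambda>j. k (b j)) J) ` {k \<in> Aut L M. \<forall>i\<in>I. k (a i) = a i}"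
  have fin: "finite B"
  proof -
    define orb where "orb j = {k (c j) |k. k \<in> Aut L M \<and> (\<forall>y\<in>a ` I. k y = y)}" for j
    have "finite (orb j)" if "j < n" for j
      unfolding orb_def using c a that by (intro finite_orbit_acl) auto
    then have "finite (PiE {..<n} orb)"
      by (intro finite_PiE) auto
    moreover have "B \<subseteq> (\<lambda>d. restrict (case_sum a d) J) ` PiE {..<n} orb"
    proof
      fix b' assume "b' \<in> B"
      then obtain k where k: "k \<in> Aut L M" "\<forall>i\<in>I. k (a i) = a i" "b' = restrict (\<lambda>j. k (b j)) J"
        by (auto simp: B_def)
      define d where "d = (\<lambda>j\<in>{..<n}. k (c j))"
      have "d \<in> PiE {..<n} orb"
        using k(1,2) by (auto simp: d_def orb_def)
      moreover have "b' = restrict (case_sum a d) J"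
        using k(2) by (auto simp: k(3) J b_def d_def restrict_def fun_eq_iff)
      ultimately show "b' \<in> (\<lambda>d. restrict (case_sum a d) J) ` PiE {..<n} orb"
        by blast
    qed
    ultimately show ?thesis
      by (rule finite_surj)
  qed
  let ?K = "kernel (Gal1 L \<kappa> M J pbar) (Gal1 L \<kappa> M I p) (Gal1_proj L \<kappa> M J pbar I p)"
  have "\<forall>C\<in>?K. \<exists>q. fst q \<in> Aut L M \<and> C = Gal1_class L \<kappa> M J pbar (fst q) \<and>
      (\<forall>u\<in>realizations L M I p. lascar_eq L \<kappa> M I (compose I (fst q) u) u) \<and>
      snd q \<in> Autf L \<kappa> M \<and> restrict (\<lambda>j. snd q (fst q (b j))) J \<in> B"
  proof
    fix C assume C: "C \<in> ?K"
    then obtain f where f: "f \<in> Aut L M" "C = Gal1_class L \<kappa> M J pbar f"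
      by (auto simp: kernel_def carrier_Gal1)
    have "Gal1_class L \<kappa> M I p f = Gal1_class L \<kappa> M I p \<one>\<^bsub>G\<^esub>"
    proof -
      have "Gal1_proj L \<kappa> M J pbar I p (Gal1_class L \<kappa> M J pbar f) = Gal1_class L \<kappa> M I p f"
        by (rule Gal1_proj_class[OF f(1)]) (rule wd)
      then show ?thesis
        using C one_Gal1[OF st(1)] by (simp add: kernel_def f(2))
    qed
    then have fu: "\<forall>u\<in>realizations L M I p. lascar_eq L \<kappa> M I (compose I f u) u"
      unfolding Gal1_class_eq_iff[OF st(1) f(1) one_closed] by (simp add: compose_one[OF realizations_U])
    moreover have "a \<in> realizations L M I p"
      unfolding Rp by (intro CollectI exI[of _ "\<one>\<^bsub>G\<^esub>"]) (simp add: compose_one[OF a])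
    ultimately obtain l where l: "l \<in> Autf L \<kappa> M" "compose I l (compose I f a) = a"
      by (auto simp: lascar_eq_def)
    note lA = Autf_Aut[OF l(1)]
    have "(l \<otimes>\<^bsub>G\<^esub> f) (a i) = a i" if "i \<in> I" for i
      using fun_cong[OF l(2), of i] that PiE_mem[OF a that] lA f(1) by (simp add: compose_def)
    moreover have "restrict (\<lambda>j. l (f (b j))) J = restrict (\<lambda>j. (l \<otimes>\<^bsub>G\<^esub> f) (b j)) J"
      using PiE_mem[OF b] lA f(1) by (auto simp: restrict_def fun_eq_iff)
    ultimately have "restrict (\<lambda>j. l (f (b j))) J \<in> B"
      unfolding B_def using lA f(1) by auto
    then show "\<exists>q. fst q \<in> Aut L M \<and> C = Gal1_class L \<kappa> M J pbar (fst q) \<and>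
      (\<forall>u\<in>realizations L M I p. lascar_eq L \<kappa> M I (compose I (fst q) u) u) \<and>
      snd q \<in> Autf L \<kappa> M \<and> restrict (\<lambda>j. snd q (fst q (b j))) J \<in> B"
      using f fu l(1) by (intro exI[of _ "(f, l)"]) simp
  qed
  then obtain q where q: "\<And>C. C \<in> ?K \<Longrightarrow> fst (q C) \<in> Aut L M \<and> C = Gal1_class L \<kappa> M J pbar (fst (q C)) \<and>
      (\<forall>u\<in>realizations L M I p. lascar_eq L \<kappa> M I (compose I (fst (q C)) u) u) \<and>
      snd (q C) \<in> Autf L \<kappa> M \<and> restrict (\<lambda>j. snd (q C) (fst (q C) (b j))) J \<in> B"
    by metis
  \<comment> \<open>The tuple \<open>l f b\<close>; choosing \<open>f\<close> and \<open>l\<close>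
    together as the pair \<open>q C\<close> turns it into a function of the class.\<close>
  define val where "val C = restrict (\<lambda>j. snd (q C) (fst (q C) (b j))) J" for C
  have "inj_on val ?K"
  proof (rule inj_onI)
    fix C C' assume C: "C \<in> ?K" "C' \<in> ?K" "val C = val C'"
    define f f' l l' where "f = fst (q C)" and "f' = fst (q C')" and "l = snd (q C)" and "l' = snd (q C')"
    have f: "f \<in> Aut L M" "f' \<in> Aut L M" and CC: "C = Gal1_class L \<kappa> M J pbar f" "C' = Gal1_class L \<kappa> M J pbar f'"
      and l: "l \<in> Autf L \<kappa> M" "l' \<in> Autf L \<kappa> M"
      and fu: "\<And>u. u \<in> realizations L M I p \<Longrightarrow> lascar_eq L \<kappa> M I (compose I f u) u"
      "\<And>u. u \<in> realizations L M I p \<Longrightarrow> lascar_eq L \<kappa> M I (compose I f' u) u"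
      using q[OF C(1)] q[OF C(2)] unfolding f_def f'_def l_def l'_def by blast+
    have "compose J l (compose J f b) = compose J l' (compose J f' b)"
    proof
      fix x show "compose J l (compose J f b) x = compose J l' (compose J f' b) x"
        using fun_cong[OF C(3), of x]
        by (cases "x \<in> J") (simp_all add: val_def compose_def f_def f'_def l_def l'_def)
    qed
    then have "lascar_eq L \<kappa> M J (compose J f b) (compose J l' (compose J f' b))"
      using l(1) unfolding lascar_eq_def by blast
    moreover have "lascar_eq L \<kappa> M J (compose J f' b) (compose J l' (compose J f' b))"
      using l(2) unfolding lascar_eq_def by blast
    ultimately have fb: "lascar_eq L \<kappa> M J (compose J f b) (compose J f' b)"
      using lascar_trans[OF compose_closed[OF b f(1)]] lascar_sym[OF compose_closed[OF b f(2)]] by blast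
    define h where "h = inv\<^bsub>G\<^esub> f' \<otimes>\<^bsub>G\<^esub> f"
    have h: "h \<in> Aut L M"
      using f by (simp add: h_def)
    have fa: "\<exists>l\<in>Autf L \<kappa> M. \<forall>i\<in>I. l (h (g (a i))) = g (a i)" if g: "g \<in> Aut L M" for g
    proof -
      have u: "compose I g a \<in> realizations L M I p" "compose I g a \<in> I \<rightarrow>\<^sub>E U"
        unfolding Rp using g compose_closed[OF a g] by blast+
      have "lascar_eq L \<kappa> M I (compose I f (compose I g a)) (compose I f' (compose I g a))"
        using fu[OF u(1)] lascar_trans[OF compose_closed[OF u(2) f(1)]]
          lascar_sym[OF compose_closed[OF u(2) f(2)]] by blast
      then show ?thesis
        unfolding lascar_mult_inv_iff[OF u(2) f, symmetric] h_def[symmetric] lascar_compose_iff .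
    qed
    have hb: "\<exists>l\<in>Autf L \<kappa> M. \<forall>j\<in>J. l (h (b j)) = b j"
    proof -
      have "lascar_eq L \<kappa> M J (compose J h b) b"
        unfolding h_def lascar_mult_inv_iff[OF b f] by (rule fb)
      then obtain l where l: "l \<in> Autf L \<kappa> M" "compose J l (compose J h b) = b"
        unfolding lascar_eq_def by (elim bexE) (rule that)
      have "l (h (b j)) = b j" if "j \<in> J" for j
        using fun_cong[OF l(2), of j] that by (simp add: compose_def)
      then show ?thesis
        using l(1) by (intro bexI[of _ l]) auto
    qed
    show "C = C'"
      unfolding CC Gal1_class_eq_iff[OF st(2) f]
    proof
      fix v assume "v \<in> realizations L M J pbar"
      then obtain g where g: "g \<in> Aut L M" and v: "v = compose J g b"
        unfolding Rpbar by blast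
      have "\<exists>l\<in>Autf L \<kappa> M. \<forall>j\<in>J. l (h (g (b j))) = g (b j)"
      proof (rule Lascar_strong_transfer[where I = I and a = a, OF FE X smJ _ _ h _ fa hb g])
        show "b j \<in> U" if "j \<in> J" for j
          using b that by auto
        show "a i \<in> U" if "i \<in> I" for i
          using a that by auto
        show "finite ((\<lambda>k. restrict (\<lambda>j. k (b j)) J) ` {k \<in> Aut L M. \<forall>i\<in>I. k (a i) = a i})"
          using fin by (simp add: B_def)
      qed
      then have "lascar_eq L \<kappa> M J (compose J h v) v"
        unfolding v lascar_compose_iff .
      then show "lascar_eq L \<kappa> M J (compose J f v) (compose J f' v)"
        using lascar_mult_inv_iff[OF _ f, of v] compose_closed[OF b g] by (simp add: h_def v)
    qed
  qed
  then show ?thesis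
    by (rule inj_on_finite[OF _ _ fin]) (use q in \<open>auto simp: val_def\<close>)
qed

end

theorem theorem2p5:
  fixes L :: "('s, 'f, 'r) lang"
    and N :: "('s, 'f, 'r, 'a) struct"
    and \<kappa> :: "'k rel"
    and Leq :: "(('s, 'f, 'r) eqsort, ('s, 'f, 'r) eqfun, 'r) lang"
    and M :: "(('s, 'f, 'r) eqsort, ('s, 'f, 'r) eqfun, 'r, ('s, 'f, 'r, 'a) eqelt) struct"
    and I :: "'i set"
    and a :: "'i \<Rightarrow> ('s, 'f, 'r, 'a) eqelt"
    and n :: nat
    and c :: "nat \<Rightarrow> ('s, 'f, 'r, 'a) eqelt"
  assumes "lang_ok L" and "is_struct L N"
    and "Leq = eq_lang L N" and "M = eq_struct N"
    and "monster Leq \<kappa> M"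
    and "acl Leq M {} = dcl Leq M {}"
    and "G_compact Leq \<kappa> M"
    and "small \<kappa> I" and "a \<in> I \<rightarrow>\<^sub>E univ Leq M"
    and "c \<in> {..<n} \<rightarrow>\<^sub>E acl Leq M (a ` I)"
    and "p = tp Leq M I a {}"
    and "J = I <+> {..<n}"
    and "pbar = tp Leq M J (case_sum a c) {}"
    and "\<pi> = Gal1_proj Leq \<kappa> M J pbar I p"
  shows "finite (kernel (Gal1 Leq \<kappa> M J pbar) (Gal1 Leq \<kappa> M I p) \<pi>)"
proof -
  interpret M: monster_model Leq \<kappa> M
    by unfold_locales (rule assms(5))
  have "is_struct (eq_lang L N) (eq_struct N)"
    "acl (eq_lang L N) (eq_struct N) {} = dcl (eq_lang L N) (eq_struct N) {}"
    using M.str assms(6) unfolding assms(3,4) by simp_all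
  \<comment> \<open>Here the form of \<open>M\<close> as the expansion of \<open>N\<close> by
    imaginary sorts is used.\<close>
  then have FE: "M.finite_equivalences_invariant"
    unfolding M.finite_equivalences_invariant_def unfolding assms(3,4)
    using finite_equivalence_invariant[OF assms(1,2)] by blast
  obtain X where X: "elem_submodel Leq M X" "small \<kappa> X" "Hausdorff_space (Gal_topology Leq \<kappa> M X)"
    using assms(7) by (auto simp: G_compact_def)
  \<comment> \<open>The submodel witnessing G-compactness is also the one over which limits and
    separating formulas are taken.\<close>
  have "M.Autf_closed_over X"
    unfolding M.Autf_closed_over_def using M.Autf_closed[OF X] by blast
  then show ?thesis
    unfolding assms(14)
    by (rule M.finite_kernel_Gal1_proj[OF FE X(1,2) _ assms(8-13)])
qed

end
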